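(* Let $\boldsymbol c\in\mathcal F$. The isomorphism $$\phi:\mathcal H_{\boldsymbol c}(\mathbb Z/n,\mathbb C)\xrightarrow{\ \sim\ }\mathrm{End}_{H_{\boldsymbol c}(\mathbb Z/n,\mathbb C)}(\Delta_{\boldsymbol c}(S(\mathfrak h)_W))$$ induced by the KZ-functor is given by $$\phi(\overline T)=\eta=s.\exp\!\Big(\frac{2\pi i}{n}\mathbf{eu}\Big),$$ where $\overline T$ is the natural generator (the class of $T$) of $\mathcal H_{\boldsymbol c}(\mathbb Z/n,\mathbb C)=\mathbb C[T]/\langle\prod_{j=1}^n(T-q^{-j}q_j^{-1})\rangle$.
   Context: For complex numbers, $z_1\equiv z_2\pmod n$ means $z_1-z_2\in n\mathbb Z$. $\mathcal F$ is the set of $\boldsymbol c=(c_1,\dots,c_n)\in\mathbb C^n$ with $c_n=0$ such that for all $1\le i,j\le n$: whenever $c_i-c_j\equiv j-i\pmod n$, then $c_i-c_j=j-i$. Let $n\ge2$, $q=e^{2\pi i/n}$, $q_j=\exp(\frac{2\pi i}{n}c_j)$. $W=\mathbb Z/n=\langle s\rangle$ acts on $\mathfrak h=\mathbb C$ by $s.w=qw$; $\{\xi\}$ is a basis of $\mathfrak h$ and $\{x\}$ the dual basis of $\mathfrak h^*$, so $S(\mathfrak h)=\mathbb C[\xi]$, $S(\mathfrak h^* )=\mathbb C[x]$, $s.\xi=q\xi$, $s.x=q^{-1}x$. Extend $c_i$ to $i\in\mathbb Z$ periodically mod $n$, and put $\varepsilon_i=\frac1n\sum_{m=0}^{n-1}q^{mi}s^m$.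 The rational Cherednik algebra $H_{\boldsymbol c}(\mathbb Z/n,\mathbb C)$ is the $\mathbb C$-algebra generated by $x,\xi,s$ with relations $s^n=1$, $s\xi s^{-1}=q\xi$, $sxs^{-1}=q^{-1}x$, $[\xi,x]=1+\sum_{i=0}^{n-1}(c_{i+1}-c_i)\varepsilon_i$. It is graded by $\deg x=1$, $\deg s=0$, $\deg\xi=-1$. Put $z=\sum_{i=1}^{n-1}c_i\varepsilon_i$ and $\mathbf{eu}=x\xi-z$; then $[\mathbf{eu},h]=\deg(h)h$ for homogeneous $h$. Category $\mathcal O_{\boldsymbol c}(\mathbb Z/n,\mathbb C)$ consists of the finitely generated $H_{\boldsymbol c}(\mathbb Z/n,\mathbb C)$-modules on which $\xi$ acts locally nilpotently. The coinvariant algebra is $S(\mathfrak h)_W=\mathbb C[\xi]/\langle\xi^n\rangle$, a graded module over $\mathbb C[\xi]\rtimes\mathbb Z/n$ via $(f\otimes w).g=f(w.g)$, and $\Delta_{\boldsymbol c}(S(\mathfrak h)_W)=H_{\boldsymbol c}(\mathbb Z/n,\mathbb C)\otimes_{\mathbb C[\xi]\rtimes\mathbb Z/n}S(\mathfrak h)_W$. It is graded with finite-dimensional components preserved by $\mathbf{eu}$, so $\eta=s.\exp(\frac{2\pi i}n\mathbf{eu})$ makes sense as a linear operator on it (exponential taken on each graded component). The KZ-functor (Ginzburg–Guay–Opdam–Rouquier): inverting $x$ (i.e. $x^n$), $H_{\boldsymbol c}(\mathbb Z/n,\mathbb C)[x^{-1}]\cong\mathcal D(\mathbb C^\times)\rtimes\mathbb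 Z/n$ via the Dunkl embedding $x\mapsto x$, $s\mapsto s$, $\xi\mapsto\frac{d}{dx}+x^{-1}z$. For $M$ in $\mathcal O_{\boldsymbol c}(\mathbb Z/n,\mathbb C)$, the localization $M_{\mathrm{reg}}=M[x^{-1}]$ is a $\mathbb Z/n$-equivariant vector bundle with flat connection on $\mathbb C^\times$; it descends to $\mathbb C^\times/(\mathbb Z/n)$ (local sections on the quotient being the $\mathbb Z/n$-invariant sections on the preimage), and $\mathrm{KZ}(M)$ is the space of germs of horizontal holomorphic sections of the descended bundle at the image of a base point $x_0\in\mathbb C^\times$. The group $\pi_1(\mathbb C^\times/(\mathbb Z/n),x_0)\cong\mathbb Z$ acts by monodromy. The generator $T$ is associated with the image of the path $t\mapsto e^{2\pi it/n}x_0$, $0\le t\le1$; the convention is that $T$ acts as the inverse of analytic continuation of horizontal sections along this loop (so that, for the one-dimensional $\mathbb Z/n$-module $E_j$ on which $s$ acts by $q^{-j}$ and $\xi$ acts by $0$, and $\Delta_{\boldsymbol c}(E_j)=H_{\boldsymbol c}(\mathbb Z/n,\mathbb C)\otimes_{\mathbb C[\xi]\rtimes\mathbb Z/n}E_j$, $T$ acts on $\mathrm{KZ}(\Delta_{\boldsymbol c}(E_j))$ by $q^{-j}q_j^{-1}$). This action factors through the cyclotomic Hecke algebra $\mathcal H_{\boldsymbol c}(\mathbb Z/n,\mathbb C)=\mathbb C[T]/\langle\prod_{j=1}^n(T-q^{-j}q_j^{-1})\rangle$, giving an exact functor $\mathrm{KZ}:\mathcal O_{\boldsymbol c}(\mathbb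 Z/n,\mathbb C)\to\mathcal H_{\boldsymbol c}(\mathbb Z/n,\mathbb C)\text{-mod}$, represented by a projective object $P_{\mathrm{KZ}}$. For $\boldsymbol c\in\mathcal F$ one has $P_{\mathrm{KZ}}\cong\Delta_{\boldsymbol c}(S(\mathfrak h)_W)$, and $\phi$ is the algebra homomorphism $\mathcal H_{\boldsymbol c}(\mathbb Z/n,\mathbb C)\to\mathrm{End}_{H_{\boldsymbol c}(\mathbb Z/n,\mathbb C)}(\Delta_{\boldsymbol c}(S(\mathfrak h)_W))^{\mathrm{opp}}$ (the "opp" may be dropped since the Hecke algebra is commutative) such that $\mathrm{KZ}$ is naturally isomorphic to $\mathrm{Hom}_{H_{\boldsymbol c}(\mathbb Z/n,\mathbb C)}(\Delta_{\boldsymbol c}(S(\mathfrak h)_W),-)$ as functors to $\mathcal H_{\boldsymbol c}(\mathbb Z/n,\mathbb C)$-modules, with $h\in\mathcal H_{\boldsymbol c}(\mathbb Z/n,\mathbb C)$ acting on the Hom space by precomposition with $\phi(h)$. *)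

theory Defs
  imports
    "HOL-Analysis.Analysis"
    "HOL-Library.Poly_Mapping"
    "HOL-Computational_Algebra.Polynomial"
    "HOL-Algebra.QuotRing"
    "HOL-Algebra.Module"
    "HOL-Algebra.Free_Abelian_Groups"
    "HOL-Algebra.Algebraic_Closure_Type"
begin

hide_const (open) UnivPoly.coeff UnivPoly.monom UnivPoly.deg Polynomials.degree

section \<open>Parameters\<close>

text \<open>A parameter \<open>(c\<^sub>1, \<dots>, c\<^sub>n)\<close> is a function \<open>c :: nat \<Rightarrow> complex\<close> of which only the values
  at \<open>1, \<dots>, n\<close> are ever used; \<open>c_per n c\<close> is its extension to all integers with period \<open>n\<close>.\<close>

definition cong_mod :: "nat \<Rightarrow> complex \<Rightarrow> complex \<Rightarrow> bool" where
  "cong_mod n z1 z2 \<longleftrightarrow> (\<exists>k::int. z1 - z2 = of_nat n * of_int k)"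

definition param_F :: "nat \<Rightarrow> (nat \<Rightarrow> complex) set" where
  "param_F n = {c. c n = 0 \<and>
     (\<forall>i\<in>{1..n}. \<forall>j\<in>{1..n}.
        cong_mod n (c i - c j) (of_nat j - of_nat i) \<longrightarrow> c i - c j = of_nat j - of_nat i)}"

definition c_per :: "nat \<Rightarrow> (nat \<Rightarrow> complex) \<Rightarrow> int \<Rightarrow> complex" where
  "c_per n c i = c (nat ((i - 1) mod int n) + 1)"

definition rootq :: "nat \<Rightarrow> complex" where
  "rootq n = exp (2 * of_real pi * \<i> / of_nat n)"

definition rootc :: "nat \<Rightarrow> (nat \<Rightarrow> complex) \<Rightarrow> nat \<Rightarrow> complex" where
  "rootc n c j = exp (2 * of_real pi * \<i> / of_nat n * c j)"

section \<open>Modules over a not necessarily commutative ring\<close>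

locale left_module = R?: ring R + M?: abelian_group M
  for R :: "('a, 'r) ring_scheme" (structure) and M :: "('a, 'b, 'm) module_scheme" (structure) +
  assumes smult_closed: "\<lbrakk>a \<in> carrier R; x \<in> carrier M\<rbrakk> \<Longrightarrow> a \<odot>\<^bsub>M\<^esub> x \<in> carrier M"
    and smult_l_distr: "\<lbrakk>a \<in> carrier R; b \<in> carrier R; x \<in> carrier M\<rbrakk> \<Longrightarrow>
      (a \<oplus>\<^bsub>R\<^esub> b) \<odot>\<^bsub>M\<^esub> x = a \<odot>\<^bsub>M\<^esub> x \<oplus>\<^bsub>M\<^esub> b \<odot>\<^bsub>M\<^esub> x"
    and smult_r_distr: "\<lbrakk>a \<in> carrier R; x \<in> carrier M; y \<in> carrier M\<rbrakk> \<Longrightarrow>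
      a \<odot>\<^bsub>M\<^esub> (x \<oplus>\<^bsub>M\<^esub> y) = a \<odot>\<^bsub>M\<^esub> x \<oplus>\<^bsub>M\<^esub> a \<odot>\<^bsub>M\<^esub> y"
    and smult_assoc: "\<lbrakk>a \<in> carrier R; b \<in> carrier R; x \<in> carrier M\<rbrakk> \<Longrightarrow>
      (a \<otimes>\<^bsub>R\<^esub> b) \<odot>\<^bsub>M\<^esub> x = a \<odot>\<^bsub>M\<^esub> (b \<odot>\<^bsub>M\<^esub> x)"
    and smult_one: "x \<in> carrier M \<Longrightarrow> \<one>\<^bsub>R\<^esub> \<odot>\<^bsub>M\<^esub> x = x"

definition mod_hom ::
  "('a, 'r) ring_scheme \<Rightarrow> ('a, 'b, 'm) module_scheme \<Rightarrow> ('a, 'd, 'k) module_scheme \<Rightarrow> ('b \<Rightarrow> 'd) set"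
where
  "mod_hom R M N = {f \<in> carrier M \<rightarrow>\<^sub>E carrier N.
     (\<forall>x\<in>carrier M. \<forall>y\<in>carrier M. f (x \<oplus>\<^bsub>M\<^esub> y) = f x \<oplus>\<^bsub>N\<^esub> f y) \<and>
     (\<forall>a\<in>carrier R. \<forall>x\<in>carrier M. f (a \<odot>\<^bsub>M\<^esub> x) = a \<odot>\<^bsub>N\<^esub> f x)}"

definition fin_gen :: "('a, 'r) ring_scheme \<Rightarrow> ('a, 'b, 'm) module_scheme \<Rightarrow> bool" where
  "fin_gen R M \<longleftrightarrow> (\<exists>S. finite S \<and> S \<subseteq> carrier M \<and>
     (\<forall>N. submodule N R M \<and> S \<subseteq> N \<longrightarrow> N = carrier M))"

definition End_ring :: "('a, 'r) ring_scheme \<Rightarrow> ('a, 'b, 'm) module_scheme \<Rightarrow> ('b \<Rightarrow> 'b) ring" where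
  "End_ring R M =
     \<lparr>carrier = mod_hom R M M,
      mult = (\<lambda>f g. compose (carrier M) f g),
      one = (\<lambda>x\<in>carrier M. x),
      zero = (\<lambda>x\<in>carrier M. \<zero>\<^bsub>M\<^esub>),
      add = (\<lambda>f g. \<lambda>x\<in>carrier M. f x \<oplus>\<^bsub>M\<^esub> g x)\<rparr>"

definition opp_ring :: "('a, 'r) ring_scheme \<Rightarrow> ('a, 'r) ring_scheme" where
  "opp_ring R = R\<lparr>mult := (\<lambda>a b. b \<otimes>\<^bsub>R\<^esub> a)\<rparr>"

text \<open>The tensor product \<open>R \<otimes>\<^sub>B M\<close>, where \<open>R\<close> is a right \<open>B\<close>-module along \<open>\<iota> : B \<rightarrow> R\<close>:
  the free abelian group on \<open>R \<times> M\<close> modulo biadditivity and \<open>r \<iota>(b) \<otimes> m = r \<otimes> b m\<close>, with \<open>R\<close>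
  acting on the left factor.  The ring fields \<open>mult\<close> and \<open>one\<close> of a module record carry
  no meaning.\<close>

definition tensor_rels ::
  "('a, 'r) ring_scheme \<Rightarrow> ('b, 's) ring_scheme \<Rightarrow> ('b \<Rightarrow> 'a) \<Rightarrow> ('b, 'e, 'm) module_scheme
     \<Rightarrow> ('a \<times> 'e \<Rightarrow>\<^sub>0 int) set"
where
  "tensor_rels R B \<iota> M =
     {frag_of (r \<oplus>\<^bsub>R\<^esub> r', m) - frag_of (r, m) - frag_of (r', m) | r r' m.
        r \<in> carrier R \<and> r' \<in> carrier R \<and> m \<in> carrier M} \<union>
     {frag_of (r, m \<oplus>\<^bsub>M\<^esub> m') - frag_of (r, m) - frag_of (r, m') | r m m'.
        r \<in> carrier R \<and> m \<in> carrier M \<and> m' \<in> carrier M} \<union>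
     {frag_of (r \<otimes>\<^bsub>R\<^esub> \<iota> b, m) - frag_of (r, b \<odot>\<^bsub>M\<^esub> m) | r b m.
        r \<in> carrier R \<and> b \<in> carrier B \<and> m \<in> carrier M}"

definition tensor_null ::
  "('a, 'r) ring_scheme \<Rightarrow> ('b, 's) ring_scheme \<Rightarrow> ('b \<Rightarrow> 'a) \<Rightarrow> ('b, 'e, 'm) module_scheme
     \<Rightarrow> ('a \<times> 'e \<Rightarrow>\<^sub>0 int) set"
where
  "tensor_null R B \<iota> M =
     generate (free_Abelian_group (carrier R \<times> carrier M)) (tensor_rels R B \<iota> M)"

definition tensor_class ::
  "('a, 'r) ring_scheme \<Rightarrow> ('b, 's) ring_scheme \<Rightarrow> ('b \<Rightarrow> 'a) \<Rightarrow> ('b, 'e, 'm) module_scheme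
     \<Rightarrow> ('a \<times> 'e \<Rightarrow>\<^sub>0 int) \<Rightarrow> ('a \<times> 'e \<Rightarrow>\<^sub>0 int) set"
where
  "tensor_class R B \<iota> M t =
     tensor_null R B \<iota> M #>\<^bsub>free_Abelian_group (carrier R \<times> carrier M)\<^esub> t"

definition tensor_module ::
  "('a, 'r) ring_scheme \<Rightarrow> ('b, 's) ring_scheme \<Rightarrow> ('b \<Rightarrow> 'a) \<Rightarrow> ('b, 'e, 'm) module_scheme
     \<Rightarrow> ('a, ('a \<times> 'e \<Rightarrow>\<^sub>0 int) set) module"
where
  "tensor_module R B \<iota> M =
     (let Q = free_Abelian_group (carrier R \<times> carrier M) Mod tensor_null R B \<iota> M in
     \<lparr>carrier = carrier Q, mult = undefined, one = undefined,
      zero = \<one>\<^bsub>Q\<^esub>, add = (\<lambda>A A'. A \<otimes>\<^bsub>Q\<^esub> A'),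
      smult = (\<lambda>r A. \<Union>t\<in>A. tensor_class R B \<iota> M
                 (frag_extend (\<lambda>(r', m). frag_of (r \<otimes>\<^bsub>R\<^esub> r', m)) t))\<rparr>)"

section \<open>The rational Cherednik algebra\<close>

text \<open>The free algebra \<open>\<complex>\<langle>x, \<xi>, s\<rangle>\<close> is the monoid algebra of the free monoid on three letters.\<close>

datatype gen = Gx | Gxi | Gs

datatype gword = Word (letters: "gen list")

instantiation gword :: monoid_add
begin

definition zero_gword :: gword where "zero_gword = Word []"

definition plus_gword :: "gword \<Rightarrow> gword \<Rightarrow> gword" where
  "plus_gword u v = Word (letters u @ letters v)"

instance
  by standard (simp_all add: zero_gword_def plus_gword_def)

end

type_synonym falg = "gword \<Rightarrow>\<^sub>0 complex"

definition scal :: "complex \<Rightarrow> falg" where "scal a = Poly_Mapping.single 0 a"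

definition genx :: falg where "genx = Poly_Mapping.single (Word [Gx]) 1"
definition genxi :: falg where "genxi = Poly_Mapping.single (Word [Gxi]) 1"
definition gens :: falg where "gens = Poly_Mapping.single (Word [Gs]) 1"

definition eps :: "nat \<Rightarrow> nat \<Rightarrow> falg" where
  "eps n i = scal (1 / of_nat n) * (\<Sum>m<n. scal (rootq n ^ (m * i)) * gens ^ m)"

text \<open>In the relations below \<open>s\<^sup>n\<^sup>-\<^sup>1\<close> stands for the inverse of \<open>s\<close>.\<close>

definition cher_rels :: "nat \<Rightarrow> (nat \<Rightarrow> complex) \<Rightarrow> falg set" where
  "cher_rels n c =
     {gens ^ n - 1,
      gens * genxi * gens ^ (n - 1) - scal (rootq n) * genxi,
      gens * genx * gens ^ (n - 1) - scal (inverse (rootq n)) * genx,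
      (genxi * genx - genx * genxi)
        - (1 + (\<Sum>i<n. scal (c_per n c (int i + 1) - c_per n c (int i)) * eps n i))}"

definition falg_ring :: "falg ring" where "falg_ring = ring_of_type_algebra"

definition cher_ideal :: "nat \<Rightarrow> (nat \<Rightarrow> complex) \<Rightarrow> falg set" where
  "cher_ideal n c = Idl\<^bsub>falg_ring\<^esub> (cher_rels n c)"

definition Cher :: "nat \<Rightarrow> (nat \<Rightarrow> complex) \<Rightarrow> falg set ring" where
  "Cher n c = falg_ring Quot cher_ideal n c"

definition cl :: "nat \<Rightarrow> (nat \<Rightarrow> complex) \<Rightarrow> falg \<Rightarrow> falg set" where
  "cl n c a = cher_ideal n c +>\<^bsub>falg_ring\<^esub> a"

text \<open>\<open>act n c M a\<close> is the action on the \<open>Cher n c\<close>-module \<open>M\<close> of the element represented by \<open>a\<close>;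
  in particular \<open>act n c M (scal z)\<close> is multiplication by the complex number \<open>z\<close>.\<close>

definition act ::
  "nat \<Rightarrow> (nat \<Rightarrow> complex) \<Rightarrow> (falg set, 'm, 'k) module_scheme \<Rightarrow> falg \<Rightarrow> 'm \<Rightarrow> 'm"
where
  "act n c M a m = cl n c a \<odot>\<^bsub>M\<^esub> m"

definition zel :: "nat \<Rightarrow> (nat \<Rightarrow> complex) \<Rightarrow> falg" where
  "zel n c = (\<Sum>i\<in>{1..n-1}. scal (c i) * eps n i)"

definition eu :: "nat \<Rightarrow> (nat \<Rightarrow> complex) \<Rightarrow> falg" where
  "eu n c = genx * genxi - zel n c"

fun gdeg :: "gen \<Rightarrow> int" where
  "gdeg Gx = 1"
| "gdeg Gxi = -1"
| "gdeg Gs = 0"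

definition Cher_deg :: "nat \<Rightarrow> (nat \<Rightarrow> complex) \<Rightarrow> int \<Rightarrow> falg set set" where
  "Cher_deg n c d =
     cl n c ` {a. \<forall>w\<in>Poly_Mapping.keys a. sum_list (map gdeg (letters w)) = d}"

definition cat_O :: "nat \<Rightarrow> (nat \<Rightarrow> complex) \<Rightarrow> (falg set, 'm) module set" where
  "cat_O n c = {M. left_module (Cher n c) M \<and> fin_gen (Cher n c) M \<and>
     (\<forall>m\<in>carrier M. \<exists>k. act n c M (genxi ^ k) m = \<zero>\<^bsub>M\<^esub>)}"

section \<open>The standard module attached to the coinvariant algebra\<close>

text \<open>An element \<open>a\<close> of the skew group ring represents the sum over \<open>k < n\<close> of
  \<open>a k \<otimes> s\<^sup>k\<close> with \<open>a k \<in> \<complex>[\<xi>]\<close>.  Since \<open>s.\<xi> = q\<xi>\<close>, \<open>s\<^sup>k\<close> sends \<open>g(\<xi>)\<close> to \<open>g(q\<^sup>k\<xi>)\<close>.\<close>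

definition s_poly :: "nat \<Rightarrow> nat \<Rightarrow> complex poly \<Rightarrow> complex poly" where
  "s_poly n k g = pcompose g [:0, rootq n ^ k:]"

definition skew_ring :: "nat \<Rightarrow> (nat \<Rightarrow> complex poly) ring" where
  "skew_ring n =
     \<lparr>carrier = {a. \<forall>k\<ge>n. a k = 0},
      mult = (\<lambda>a b k. if k < n
                then \<Sum>(i, j)\<in>{(i, j). i < n \<and> j < n \<and> (i + j) mod n = k}. a i * s_poly n i (b j)
                else 0),
      one = (\<lambda>k. if k = 0 then 1 else 0),
      zero = (\<lambda>k. 0),
      add = (\<lambda>a b k. a k + b k)\<rparr>"

definition skew_incl :: "nat \<Rightarrow> (nat \<Rightarrow> complex) \<Rightarrow> (nat \<Rightarrow> complex poly) \<Rightarrow> falg set" where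
  "skew_incl n c a =
     cl n c (\<Sum>k<n. (\<Sum>i\<le>degree (a k). scal (coeff (a k) i) * genxi ^ i) * gens ^ k)"

definition poly_ring :: "complex poly ring" where "poly_ring = ring_of_type_algebra"

definition coinv_ideal :: "nat \<Rightarrow> complex poly set" where
  "coinv_ideal n = PIdl\<^bsub>poly_ring\<^esub> (monom 1 n)"

definition coinv_alg :: "nat \<Rightarrow> complex poly set ring" where
  "coinv_alg n = poly_ring Quot coinv_ideal n"

definition coinv_module :: "nat \<Rightarrow> (nat \<Rightarrow> complex poly, complex poly set) module" where
  "coinv_module n =
     (let Q = coinv_alg n in
     \<lparr>carrier = carrier Q, mult = mult Q, one = one Q, zero = zero Q, add = add Q,
      smult = (\<lambda>a G. \<Union>g\<in>G. coinv_ideal n +>\<^bsub>poly_ring\<^esub> (\<Sum>k<n. a k * s_poly n k g))\<rparr>)"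

definition coinv_deg :: "nat \<Rightarrow> int \<Rightarrow> complex poly set set" where
  "coinv_deg n d = (\<lambda>g. coinv_ideal n +>\<^bsub>poly_ring\<^esub> g) `
     {g. \<forall>i. coeff g i \<noteq> 0 \<longrightarrow> - int i = d}"

type_synonym delta_elt = "(falg set \<times> complex poly set \<Rightarrow>\<^sub>0 int) set"

definition Delta :: "nat \<Rightarrow> (nat \<Rightarrow> complex) \<Rightarrow> (falg set, delta_elt) module" where
  "Delta n c = tensor_module (Cher n c) (skew_ring n) (skew_incl n c) (coinv_module n)"

definition pure_tensor ::
  "nat \<Rightarrow> (nat \<Rightarrow> complex) \<Rightarrow> falg set \<Rightarrow> complex poly set \<Rightarrow> delta_elt"
where
  "pure_tensor n c h g =
     tensor_class (Cher n c) (skew_ring n) (skew_incl n c) (coinv_module n) (frag_of (h, g))"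

definition Delta_deg :: "nat \<Rightarrow> (nat \<Rightarrow> complex) \<Rightarrow> int \<Rightarrow> delta_elt set" where
  "Delta_deg n c d = generate (add_monoid (Delta n c))
     {pure_tensor n c h g | h g a b. h \<in> Cher_deg n c a \<and> g \<in> coinv_deg n b \<and> a + b = d}"

text \<open>Convergence of a series in a complex subspace \<open>V\<close> of \<open>M\<close>, tested on all linear functionals of \<open>V\<close>.
  It is only used for finite-dimensional \<open>V\<close>, where this is convergence in the canonical
  topology.\<close>

definition fd_sums ::
  "nat \<Rightarrow> (nat \<Rightarrow> complex) \<Rightarrow> (falg set, 'm, 'k) module_scheme \<Rightarrow> 'm set \<Rightarrow> (nat \<Rightarrow> 'm) \<Rightarrow> 'm \<Rightarrow> bool"
where
  "fd_sums n c M V f w \<longleftrightarrow> range f \<subseteq> V \<and> w \<in> V \<and>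
     (\<forall>lam::'m \<Rightarrow> complex.
        (\<forall>u\<in>V. \<forall>v\<in>V. lam (u \<oplus>\<^bsub>M\<^esub> v) = lam u + lam v) \<and>
        (\<forall>a. \<forall>v\<in>V. lam (act n c M (scal a) v) = a * lam v)
        \<longrightarrow> (\<lambda>k. lam (f k)) sums lam w)"

definition eta :: "nat \<Rightarrow> (nat \<Rightarrow> complex) \<Rightarrow> delta_elt \<Rightarrow> delta_elt" where
  "eta n c = (let P = Delta n c in
     THE f. f \<in> carrier P \<rightarrow>\<^sub>E carrier P \<and>
       (\<forall>u\<in>carrier P. \<forall>v\<in>carrier P. f (u \<oplus>\<^bsub>P\<^esub> v) = f u \<oplus>\<^bsub>P\<^esub> f v) \<and>
       (\<forall>a. \<forall>v\<in>carrier P. f (act n c P (scal a) v) = act n c P (scal a) (f v)) \<and>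
       (\<forall>d. \<forall>v\<in>Delta_deg n c d. \<exists>w.
          fd_sums n c P (Delta_deg n c d)
            (\<lambda>k. act n c P (scal (1 / fact k) * (scal (2 * of_real pi * \<i> / of_nat n) * eu n c) ^ k) v) w \<and>
          f v = act n c P gens w))"

section \<open>Localization and the Dunkl embedding\<close>

text \<open>A module over \<open>\<D>(\<complex>\<^sup>\<times>) \<rtimes> \<int>/n\<close>, given by its complex vector space and the operators
  \<open>x\<close>, \<open>s\<close> and \<open>d/dx\<close>.\<close>

record 'e dmod = "(complex, 'e) module" +
  opx :: "'e \<Rightarrow> 'e"
  ops :: "'e \<Rightarrow> 'e"
  opd :: "'e \<Rightarrow> 'e"

definition loc_rel ::
  "nat \<Rightarrow> (nat \<Rightarrow> complex) \<Rightarrow> (falg set, 'm, 'k) module_scheme \<Rightarrow> (('m \<times> nat) \<times> ('m \<times> nat)) set"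
where
  "loc_rel n c M = {((m, k), (m', k')). m \<in> carrier M \<and> m' \<in> carrier M \<and>
     (\<exists>l. act n c M (genx ^ (l + k')) m = act n c M (genx ^ (l + k)) m')}"

text \<open>\<open>frac n c M m k\<close> is the fraction \<open>x\<^sup>-\<^sup>k m\<close>.\<close>

definition frac ::
  "nat \<Rightarrow> (nat \<Rightarrow> complex) \<Rightarrow> (falg set, 'm, 'k) module_scheme \<Rightarrow> 'm \<Rightarrow> nat \<Rightarrow> ('m \<times> nat) set"
where
  "frac n c M m k = loc_rel n c M `` {(m, k)}"

text \<open>The formulas for \<open>ops\<close> and \<open>opd\<close> come from \<open>s x\<^sup>-\<^sup>k = q\<^sup>k x\<^sup>-\<^sup>k s\<close> and from
  \<open>d/dx = \<xi> - x\<^sup>-\<^sup>1 z\<close> (the Dunkl embedding), i.e.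
  \<open>d/dx (x\<^sup>-\<^sup>k m) = x\<^sup>-\<^sup>k (\<xi> - x\<^sup>-\<^sup>1 z) m - k x\<^sup>-\<^sup>k\<^sup>-\<^sup>1 m\<close>.\<close>

definition Mreg ::
  "nat \<Rightarrow> (nat \<Rightarrow> complex) \<Rightarrow> (falg set, 'm, 'k) module_scheme \<Rightarrow> ('m \<times> nat) set dmod"
where
  "Mreg n c M =
     \<lparr>carrier = (carrier M \<times> UNIV) // loc_rel n c M,
      mult = undefined, one = undefined,
      zero = frac n c M \<zero>\<^bsub>M\<^esub> 0,
      add = (\<lambda>A B. \<Union>(m, k)\<in>A. \<Union>(m', k')\<in>B.
        frac n c M (act n c M (genx ^ k') m \<oplus>\<^bsub>M\<^esub> act n c M (genx ^ k) m') (k + k')),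
      smult = (\<lambda>a A. \<Union>(m, k)\<in>A. frac n c M (act n c M (scal a) m) k),
      opx = (\<lambda>A. \<Union>(m, k)\<in>A. frac n c M (act n c M genx m) k),
      ops = (\<lambda>A. \<Union>(m, k)\<in>A. frac n c M (act n c M (scal (rootq n ^ k) * gens) m) k),
      opd = (\<lambda>A. \<Union>(m, k)\<in>A.
        frac n c M (act n c M (genx * genxi - zel n c - scal (of_nat k)) m) (k + 1))\<rparr>"

definition Mreg_map ::
  "nat \<Rightarrow> (nat \<Rightarrow> complex) \<Rightarrow> (falg set, 'd, 'k) module_scheme \<Rightarrow> ('m \<Rightarrow> 'd)
     \<Rightarrow> ('m \<times> nat) set \<Rightarrow> ('d \<times> nat) set"
where
  "Mreg_map n c N f A = (\<Union>(m, k)\<in>A. frac n c N (f m) k)"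

section \<open>Horizontal sections\<close>

text \<open>The vector bundle on \<open>\<complex>\<^sup>\<times>\<close> attached to \<open>N\<close> has fibre \<open>N / (x - a) N\<close> at \<open>a\<close>; the
  value at \<open>a\<close> of the section given by \<open>v \<in> N\<close> is \<open>fib N a v\<close>.\<close>

definition fib :: "'e dmod \<Rightarrow> complex \<Rightarrow> 'e \<Rightarrow> 'e set" where
  "fib N a v = {opx N w \<oplus>\<^bsub>N\<^esub> (- a) \<odot>\<^bsub>N\<^esub> w | w. w \<in> carrier N} +>\<^bsub>N\<^esub> v"

text \<open>\<open>has_nabla N U \<sigma> \<tau>\<close>: \<open>\<sigma>\<close> is a holomorphic section over \<open>U\<close> and \<open>\<tau> = \<nabla>\<sigma>\<close>.  Holomorphic
  sections are locally finite sums of \<open>f\<^sub>i m\<^sub>i\<close> with \<open>f\<^sub>i\<close> holomorphic and \<open>m\<^sub>i \<in> N\<close>, and the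
  connection maps such a sum to the sum of \<open>f\<^sub>i' m\<^sub>i + f\<^sub>i (d/dx) m\<^sub>i\<close>.\<close>

definition has_nabla ::
  "'e dmod \<Rightarrow> complex set \<Rightarrow> (complex \<Rightarrow> 'e set) \<Rightarrow> (complex \<Rightarrow> 'e set) \<Rightarrow> bool"
where
  "has_nabla N U \<sigma> \<tau> \<longleftrightarrow> (\<forall>a\<in>U. \<exists>B r f m. open B \<and> a \<in> B \<and> B \<subseteq> U \<and>
     (\<forall>i<r. f i holomorphic_on B \<and> m i \<in> carrier N) \<and>
     (\<forall>b\<in>B. \<sigma> b = fib N b (\<Oplus>\<^bsub>N\<^esub>i\<in>{..<r::nat}. f i b \<odot>\<^bsub>N\<^esub> m i) \<and>
             \<tau> b = fib N b (\<Oplus>\<^bsub>N\<^esub>i\<in>{..<r}.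
                 deriv (f i) b \<odot>\<^bsub>N\<^esub> m i \<oplus>\<^bsub>N\<^esub> f i b \<odot>\<^bsub>N\<^esub> opd N (m i))))"

text \<open>Open subsets of \<open>\<complex>\<^sup>\<times>/(\<int>/n)\<close> are represented by their preimages, the invariant open
  subsets of \<open>\<complex>\<^sup>\<times>\<close>, and sections of the descended bundle by the invariant sections over these.
  The germ at \<open>a\<close> of such a section is its germ at the image of \<open>a\<close>; it depends only on the
  orbit of \<open>a\<close>.\<close>

definition inv_open :: "nat \<Rightarrow> complex set \<Rightarrow> bool" where
  "inv_open n U \<longleftrightarrow> open U \<and> 0 \<notin> U \<and> (\<forall>a\<in>U. rootq n * a \<in> U)"

definition hor_sections :: "nat \<Rightarrow> 'e dmod \<Rightarrow> (complex set \<times> (complex \<Rightarrow> 'e set)) set" where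
  "hor_sections n N = {(U, \<sigma>). inv_open n U \<and> \<sigma> \<in> extensional U \<and>
     has_nabla N U \<sigma> (\<lambda>b. fib N b \<zero>\<^bsub>N\<^esub>) \<and>
     (\<forall>a\<in>U. \<sigma> (rootq n * a) = ops N ` \<sigma> a)}"

type_synonym 'e germ = "(complex set \<times> (complex \<Rightarrow> 'e set)) set"

definition germ :: "nat \<Rightarrow> 'e dmod \<Rightarrow> complex \<Rightarrow> complex set \<times> (complex \<Rightarrow> 'e set) \<Rightarrow> 'e germ" where
  "germ n N a p = {p' \<in> hor_sections n N. \<exists>W. inv_open n W \<and> a \<in> W \<and>
     W \<subseteq> fst p \<inter> fst p' \<and> (\<forall>b\<in>W. snd p b = snd p' b)}"

definition germ_space :: "nat \<Rightarrow> 'e dmod \<Rightarrow> complex \<Rightarrow> (complex, 'e germ) module" where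
  "germ_space n N a =
     \<lparr>carrier = {germ n N a p | p. p \<in> hor_sections n N \<and> a \<in> fst p},
      mult = undefined, one = undefined,
      zero = germ n N a (- {0}, \<lambda>b\<in>- {0}. fib N b \<zero>\<^bsub>N\<^esub>),
      add = (\<lambda>g g'. \<Union>(U, \<sigma>)\<in>g. \<Union>(U', \<sigma>')\<in>g'.
        germ n N a (U \<inter> U', \<lambda>b\<in>U \<inter> U'. \<sigma> b <+>\<^bsub>N\<^esub> \<sigma>' b)),
      smult = (\<lambda>z g. \<Union>(U, \<sigma>)\<in>g. germ n N a (U, \<lambda>b\<in>U. \<Union>v\<in>\<sigma> b. fib N b (z \<odot>\<^bsub>N\<^esub> v)))\<rparr>"

text \<open>\<open>continues n N \<gamma> g g'\<close>: analytic continuation along the image of the path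
  \<open>\<gamma> : [0, 1] \<rightarrow> \<complex>\<^sup>\<times>\<close> leads from \<open>g\<close> to \<open>g'\<close>.\<close>

definition continues :: "nat \<Rightarrow> 'e dmod \<Rightarrow> (real \<Rightarrow> complex) \<Rightarrow> 'e germ \<Rightarrow> 'e germ \<Rightarrow> bool" where
  "continues n N \<gamma> g g' \<longleftrightarrow> (\<exists>G. G 0 = g \<and> G 1 = g' \<and>
     (\<forall>t\<in>{0..1}. \<exists>p\<in>hor_sections n N. \<exists>\<epsilon>>0. \<forall>u\<in>{0..1}.
        \<bar>u - t\<bar> < \<epsilon> \<longrightarrow> \<gamma> u \<in> fst p \<and> G u = germ n N (\<gamma> u) p))"

text \<open>\<open>T\<close> acts as the inverse of analytic continuation.\<close>

definition monodromy :: "nat \<Rightarrow> 'e dmod \<Rightarrow> complex \<Rightarrow> 'e germ \<Rightarrow> 'e germ" where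
  "monodromy n N x0 g = (THE g'. g' \<in> carrier (germ_space n N x0) \<and>
     continues n N (\<lambda>t. exp (2 * of_real pi * \<i> * of_real t / of_nat n) * x0) g' g)"

section \<open>The Hecke algebra and the KZ functor\<close>

definition Hecke_ideal :: "nat \<Rightarrow> (nat \<Rightarrow> complex) \<Rightarrow> complex poly set" where
  "Hecke_ideal n c = PIdl\<^bsub>poly_ring\<^esub>
     (\<Prod>j\<in>{1..n}. [: - (inverse (rootq n ^ j) * inverse (rootc n c j)), 1 :])"

definition Hecke :: "nat \<Rightarrow> (nat \<Rightarrow> complex) \<Rightarrow> complex poly set ring" where
  "Hecke n c = poly_ring Quot Hecke_ideal n c"

definition Hecke_cl :: "nat \<Rightarrow> (nat \<Rightarrow> complex) \<Rightarrow> complex poly \<Rightarrow> complex poly set" where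
  "Hecke_cl n c p = Hecke_ideal n c +>\<^bsub>poly_ring\<^esub> p"

definition Tbar :: "nat \<Rightarrow> (nat \<Rightarrow> complex) \<Rightarrow> complex poly set" where
  "Tbar n c = Hecke_cl n c [:0, 1:]"

definition KZ ::
  "nat \<Rightarrow> (nat \<Rightarrow> complex) \<Rightarrow> complex \<Rightarrow> (falg set, 'm, 'k) module_scheme
     \<Rightarrow> (complex poly set, ('m \<times> nat) set germ) module"
where
  "KZ n c x0 M =
     (let N = Mreg n c M; V = germ_space n N x0 in
     \<lparr>carrier = carrier V, mult = undefined, one = undefined, zero = zero V, add = add V,
      smult = (\<lambda>h g. THE g'. \<forall>p\<in>h.
        g' = (\<Oplus>\<^bsub>V\<^esub>i\<in>{..degree p}. coeff p i \<odot>\<^bsub>V\<^esub> (monodromy n N x0 ^^ i) g))\<rparr>)"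

definition KZ_map ::
  "nat \<Rightarrow> (nat \<Rightarrow> complex) \<Rightarrow> complex \<Rightarrow> (falg set, 'd, 'k) module_scheme \<Rightarrow> ('m \<Rightarrow> 'd)
     \<Rightarrow> ('m \<times> nat) set germ \<Rightarrow> ('d \<times> nat) set germ"
where
  "KZ_map n c x0 M' f g = (\<Union>(U, \<sigma>)\<in>g. germ n (Mreg n c M') x0
     (U, \<lambda>b\<in>U. \<Union>v\<in>\<sigma> b. fib (Mreg n c M') b (Mreg_map n c M' f v)))"

text \<open>The \<open>Hecke n c\<close>-module \<open>Hom(\<Delta>, M)\<close>, where \<open>h\<close> acts by precomposition with \<open>\<phi> h\<close>.\<close>

definition Hom_module ::
  "nat \<Rightarrow> (nat \<Rightarrow> complex) \<Rightarrow> (complex poly set \<Rightarrow> delta_elt \<Rightarrow> delta_elt)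
     \<Rightarrow> (falg set, 'm, 'k) module_scheme \<Rightarrow> (complex poly set, delta_elt \<Rightarrow> 'm) module"
where
  "Hom_module n c \<phi> M =
     (let P = Delta n c in
     \<lparr>carrier = mod_hom (Cher n c) P M, mult = undefined, one = undefined,
      zero = (\<lambda>v\<in>carrier P. \<zero>\<^bsub>M\<^esub>),
      add = (\<lambda>f g. \<lambda>v\<in>carrier P. f v \<oplus>\<^bsub>M\<^esub> g v),
      smult = (\<lambda>h f. compose (carrier P) f (\<phi> h))\<rparr>)"

text \<open>\<open>\<phi>\<close> is an algebra homomorphism to \<open>End(\<Delta>)\<^sup>o\<^sup>p\<^sup>p\<close> through which \<open>KZ\<close> and \<open>Hom(\<Delta>, -)\<close> are naturally
  isomorphic as functors to \<open>Hecke n c\<close>-modules.  The objects of category \<open>O\<close> are taken with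
  underlying set in the type \<open>delta_elt\<close>.  This type contains \<open>\<Delta>\<close> itself, and it has more elements
  than any finitely generated \<open>Cher n c\<close>-module, so every object is isomorphic to one of this
  form.\<close>

definition KZ_induces ::
  "nat \<Rightarrow> (nat \<Rightarrow> complex) \<Rightarrow> complex \<Rightarrow> (complex poly set \<Rightarrow> delta_elt \<Rightarrow> delta_elt) \<Rightarrow> bool"
where
  "KZ_induces n c x0 \<phi> \<longleftrightarrow>
     \<phi> \<in> ring_hom (Hecke n c) (opp_ring (End_ring (Cher n c) (Delta n c))) \<and>
     (\<forall>a. \<phi> (Hecke_cl n c [:a:]) = (\<lambda>v\<in>carrier (Delta n c). act n c (Delta n c) (scal a) v)) \<and>
     (\<exists>\<Psi> :: (falg set, delta_elt) module \<Rightarrow> (delta_elt \<times> nat) set germ \<Rightarrow> delta_elt \<Rightarrow> delta_elt.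
        (\<forall>M\<in>cat_O n c.
           \<Psi> M \<in> mod_hom (Hecke n c) (KZ n c x0 M) (Hom_module n c \<phi> M) \<and>
           bij_betw (\<Psi> M) (carrier (KZ n c x0 M)) (carrier (Hom_module n c \<phi> M))) \<and>
        (\<forall>M\<in>cat_O n c. \<forall>M'\<in>cat_O n c. \<forall>f\<in>mod_hom (Cher n c) M M'.
           \<forall>g\<in>carrier (KZ n c x0 M).
             \<Psi> M' (KZ_map n c x0 M' f g) = compose (carrier (Delta n c)) f (\<Psi> M g)))"

end

theory Submission
  imports Defs "HOL-Complex_Analysis.Cauchy_Integral_Formula" "HOL-Library.Function_Algebras"
begin

text \<open>
  Everything is made explicit on the standard module \<open>\<Delta> = Delta n c\<close>, and then the Yoneda lemma
  identifies \<open>\<phi>\<close>.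

  Let \<open>u0\<close> be the generator \<open>1 \<otimes> 1\<close> of \<open>\<Delta>\<close>.  The elements \<open>x\<^sup>i \<xi>\<^sup>k u0\<close> with \<open>k < n\<close> span \<open>\<Delta>\<close>
  (\<open>Delta_nf\<close>), and sending \<open>x\<^sup>i \<xi>\<^sup>k u0\<close> to the function \<open>b \<mapsto> b\<^sup>i\<^sup>-\<^sup>k e\<^sub>k\<close> identifies \<open>\<Delta>\<close> with a space of
  functions \<open>\<complex>\<^sup>\<times> \<rightarrow> \<complex>\<^sup>n\<close> (\<open>Phi_act\<close>, \<open>Phi_inj\<close>).  There \<open>x\<close> is multiplication by \<open>b\<close>, \<open>s\<close> is the
  rotation \<open>u(b) \<mapsto> u(b/q)\<close>, and \<open>eu\<close> is \<open>b d/db + A\<close> with the constant bidiagonal matrix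
  \<open>A e\<^sub>k = a\<^sub>k e\<^sub>k + e\<^sub>k\<^sub>+\<^sub>1\<close>, \<open>a\<^sub>k = k - c\<^sub>n\<^sub>-\<^sub>k\<close>.

  In degree \<open>d\<close> all functions are of the form \<open>b\<^sup>d y\<close>, so \<open>exp(2\<pi>i/n eu)\<close> is \<open>q\<^sup>d exp(2\<pi>i/n A)\<close> while
  \<open>s\<close> is \<open>q\<^sup>-\<^sup>d\<close>.  The powers of \<open>q\<close> cancel: \<open>\<eta>\<close> is the constant matrix \<open>B = exp(2\<pi>i/n A)\<close>
  applied pointwise (\<open>eta_eq_etaop\<close>).  As \<open>B\<close> commutes with all the operators above, \<open>\<eta>\<close> is an
  endomorphism of \<open>\<Delta>\<close>.

  The Dunkl embedding makes \<open>d/dx = x\<^sup>-\<^sup>1 eu\<close> on \<open>\<Delta>\<^sub>r\<^sub>e\<^sub>g\<close>, so a horizontal invariant section is a solution of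
  \<open>b F' = - A F\<close> with \<open>F(q b) = F(b)\<close> (\<open>sec_hor\<close>, \<open>hor_sec\<close>).  Its germ at \<open>x\<^sub>0\<close> is determined by the
  value in \<open>\<complex>\<^sup>n\<close>, which may be prescribed, and the solutions \<open>exp(- A log (b/x\<^sub>0)) y\<close> show that \<open>T\<close> acts
  on \<open>KZ(\<Delta>) \<cong> \<complex>\<^sup>n\<close> by \<open>B\<close> (\<open>monodromy_Germ\<close>).  A map applied pointwise acts on values in the same way, so
  \<open>KZ(\<eta>)\<close> is \<open>B\<close> as well (\<open>KZ_map_etaop\<close>).

  Now let \<open>\<Psi>\<close> be the natural isomorphism from \<open>KZ\<close> to \<open>Hom(\<Delta>, -)\<close> and let \<open>g\<^sub>0 \<in> KZ(\<Delta>)\<close> correspond to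
  the identity of \<open>\<Delta>\<close>.  Linearity and naturality give
  \<open>\<phi>(T) = \<Psi>(T g\<^sub>0) = \<Psi>(KZ(\<eta>) g\<^sub>0) = \<eta> \<circ> id = \<eta>\<close>.

  It remains to see that \<open>\<phi>\<close> is bijective.  The polynomial \<open>\<Prod>(T - q\<^sup>-\<^sup>j q\<^sub>j\<^sup>-\<^sup>1)\<close> that defines the Hecke
  algebra is the characteristic polynomial \<open>\<chi>\<close> of \<open>B\<close>.  The condition \<open>c \<in> \<F>\<close> says that
  \<open>a \<mapsto> exp(2\<pi>i/n a)\<close> is injective on the \<open>a\<^sub>k\<close>.  Hence \<open>B\<close> has the same eigenspaces as \<open>A\<close>, which are lines
  because of the entries \<open>1\<close> below the diagonal, and \<open>\<chi>\<close> is also the minimal polynomial of \<open>B\<close>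
  (\<open>char_poly_dvd\<close>).  If \<open>\<phi>(p) = 0\<close> then \<open>p(B) = 0\<close> on \<open>KZ(\<Delta>)\<close>, so \<open>\<chi>\<close> divides \<open>p\<close>: \<open>\<phi>\<close> is injective.  As
  \<open>\<phi>(p) = \<Psi>(p(B) g\<^sub>0)\<close>, the map \<open>p \<mapsto> p(B) g\<^sub>0\<close> is injective on the \<open>n\<close>-dimensional Hecke algebra and therefore maps onto \<open>\<complex>\<^sup>n \<cong> KZ(\<Delta>)\<close>
  (\<open>cyclic_vector_generates\<close>), which is in bijection with the endomorphisms of \<open>\<Delta>\<close>: \<open>\<phi>\<close> is
  surjective.
\<close>

section \<open>The exponential of a bidiagonal operator\<close>

text \<open>Vectors of \<open>\<complex>\<^sup>n\<close> are functions on the natural numbers that vanish from \<open>n\<close> on, because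
  \<open>n\<close> is a variable of the theorem.\<close>

definition fin_vecs :: "nat \<Rightarrow> (nat \<Rightarrow> complex) set" where
  "fin_vecs n = {v. \<forall>k\<ge>n. v k = 0}"

definition lincomb :: "complex \<Rightarrow> (nat \<Rightarrow> complex) \<Rightarrow> complex \<Rightarrow> (nat \<Rightarrow> complex) \<Rightarrow> nat \<Rightarrow> complex" where
  "lincomb x u y v = (\<lambda>k. x * u k + y * v k)"

text \<open>The matrix with diagonal \<open>a\<close> and entries \<open>1\<close> directly below it.\<close>

definition bidiag :: "nat \<Rightarrow> (nat \<Rightarrow> complex) \<Rightarrow> (nat \<Rightarrow> complex) \<Rightarrow> nat \<Rightarrow> complex" where
  "bidiag n a v k = (if k < n then a k * v k + (if k = 0 then 0 else v (k - 1)) else 0)"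

text \<open>The matrix \<open>exp(z A)\<close>, where \<open>A = bidiag n a\<close>.\<close>

definition bexp :: "nat \<Rightarrow> (nat \<Rightarrow> complex) \<Rightarrow> complex \<Rightarrow> (nat \<Rightarrow> complex) \<Rightarrow> nat \<Rightarrow> complex" where
  "bexp n a z v k = suminf (\<lambda>j. z ^ j / fact j * (bidiag n a ^^ j) v k)"

lemma bidiag_lincomb:
  "bidiag n a (lincomb x u y v) = lincomb x (bidiag n a u) y (bidiag n a v)"
  by (rule ext) (simp add: bidiag_def lincomb_def algebra_simps)

lemma bidiag_funpow_lincomb:
  "(bidiag n a ^^ j) (lincomb x u y v) = lincomb x ((bidiag n a ^^ j) u) y ((bidiag n a ^^ j) v)"
  by (induction j) (simp_all add: bidiag_lincomb)

lemma bidiag_fin_vecs: "bidiag n a v \<in> fin_vecs n"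
  by (simp add: bidiag_def fin_vecs_def)

lemma bidiag_funpow_bound:
  assumes "\<And>i. i \<le> k \<Longrightarrow> norm (a i) + 1 \<le> R" "\<And>i. i \<le> k \<Longrightarrow> norm (v i) \<le> S"
  shows "i \<le> k \<Longrightarrow> norm ((bidiag n a ^^ j) v i) \<le> R ^ j * S"
proof (induction j arbitrary: i)
  case 0
  then show ?case using assms by simp
next
  case (Suc j)
  let ?w = "(bidiag n a ^^ j) v"
  have S: "0 \<le> S" using assms(2)[of 0] norm_ge_zero[of "v 0"] by linarith
  have R: "1 \<le> R" using assms(1)[of 0] norm_ge_zero[of "a 0"] by linarith
  have R0: "0 \<le> R ^ j * S" using R S by simp
  have "norm (bidiag n a ?w i) \<le> norm (a i) * norm (?w i) + norm (if i = 0 then 0 else ?w (i - 1))"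
    by (auto simp: bidiag_def norm_mult intro: norm_triangle_le)
  also have "\<dots> \<le> norm (a i) * (R ^ j * S) + R ^ j * S"
    using Suc.IH[OF Suc.prems] Suc.IH[of "i - 1"] Suc.prems R0
    by (intro add_mono mult_left_mono) auto
  also have "\<dots> = (norm (a i) + 1) * (R ^ j * S)" by (simp add: algebra_simps)
  also have "\<dots> \<le> R * (R ^ j * S)" using assms(1)[OF Suc.prems] R0 by (intro mult_right_mono) auto
  finally show ?case by (simp add: algebra_simps)
qed

lemma bexp_summable: "summable (\<lambda>j. z ^ j / fact j * (bidiag n a ^^ j) v k)"
proof -
  \<comment> \<open>\<open>R\<close> bounds the operator norm on the leading coordinates; only these matter for coordinate \<open>k\<close>.\<close>
  define R where "R = Max ((\<lambda>i. norm (a i) + 1) ` {..k})"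
  define S where "S = Max ((\<lambda>i. norm (v i)) ` {..k})"
  have b: "norm ((bidiag n a ^^ j) v k) \<le> R ^ j * S" for j
    by (rule bidiag_funpow_bound[where k = k]) (auto simp: R_def S_def intro!: Max_ge)
  have "summable (\<lambda>j. inverse (fact j) * (norm z * R) ^ j * S)"
    by (intro summable_mult2 summable_exp)
  then show ?thesis
  proof (rule summable_comparison_test'[where N = 0])
    fix j :: nat
    have "norm (z ^ j / fact j * (bidiag n a ^^ j) v k) \<le> norm z ^ j / fact j * (R ^ j * S)"
      unfolding norm_mult norm_divide norm_power norm_fact by (intro mult_left_mono b) simp
    then show "norm (z ^ j / fact j * (bidiag n a ^^ j) v k) \<le> inverse (fact j) * (norm z * R) ^ j * S"
      by (simp add: power_mult_distrib field_simps)
  qed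
qed

lemma bexp_lincomb: "bexp n a z (lincomb x u y v) = lincomb x (bexp n a z u) y (bexp n a z v)"
proof
  fix k
  have "(\<lambda>j. z ^ j / fact j * (bidiag n a ^^ j) v k) sums bexp n a z v k" for v
    unfolding bexp_def by (rule summable_sums[OF bexp_summable])
  from sums_add[OF sums_mult[OF this, of x] sums_mult[OF this, of y], of u v]
  have "(\<lambda>j. z ^ j / fact j * (bidiag n a ^^ j) (lincomb x u y v) k) sums (x * bexp n a z u k + y * bexp n a z v k)"
    unfolding bidiag_funpow_lincomb by (simp add: lincomb_def algebra_simps)
  then show "bexp n a z (lincomb x u y v) k = lincomb x (bexp n a z u) y (bexp n a z v) k"
    by (simp add: bexp_def sums_iff lincomb_def)
qed

lemma bidiag_bexp: "bidiag n a (bexp n a z v) = bexp n a z (bidiag n a v)"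
proof
  fix k
  have comm: "(bidiag n a ^^ j) (bidiag n a v) k = bidiag n a ((bidiag n a ^^ j) v) k" for j
    by (simp add: funpow_swap1)
  show "bidiag n a (bexp n a z v) k = bexp n a z (bidiag n a v) k"
  proof (cases "k < n")
    case False
    then have "bexp n a z (bidiag n a v) k = suminf (\<lambda>j. 0)"
      unfolding bexp_def comm by (simp add: bidiag_def)
    then show ?thesis using False by (simp add: bidiag_def)
  next
    case True
    define w where "w i j = z ^ j / fact j * (bidiag n a ^^ j) v i" for i j
    have w: "w i sums bexp n a z v i" for i
      unfolding w_def bexp_def by (rule summable_sums[OF bexp_summable])
    have "(\<lambda>j. a k * w k j + (if k = 0 then 0 else w (k - 1) j)) sums bidiag n a (bexp n a z v) k"
      using sums_add[OF sums_mult[OF w[of k], of "a k"] w[of "k - 1"]] sums_mult[OF w[of k], of "a k"] True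
      by (cases "k = 0") (simp_all add: bidiag_def)
    moreover have "z ^ j / fact j * bidiag n a ((bidiag n a ^^ j) v) k
        = a k * w k j + (if k = 0 then 0 else w (k - 1) j)" for j
      by (simp add: w_def bidiag_def True algebra_simps add_divide_distrib)
    ultimately show ?thesis unfolding bexp_def comm by (simp add: sums_iff)
  qed
qed

lemma bexp_deriv: "((\<lambda>z. bexp n a z v k) has_field_derivative bidiag n a (bexp n a z v) k) (at z)"
proof -
  define c where "c j = (bidiag n a ^^ j) v k / fact j" for j
  have s: "summable (\<lambda>j. c j * y ^ j)" for y
    using bexp_summable[of y n a v k] by (simp add: c_def algebra_simps)
  have 1: "((\<lambda>z. suminf (\<lambda>j. c j * z ^ j)) has_field_derivative suminf (\<lambda>j. diffs c j * z ^ j)) (at z)"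
    by (rule termdiffs_strong_converges_everywhere[OF s])
  have 2: "(\<lambda>z. suminf (\<lambda>j. c j * z ^ j)) = (\<lambda>z. bexp n a z v k)"
    by (simp add: bexp_def c_def algebra_simps)
  have "diffs c j * z ^ j = z ^ j / fact j * (bidiag n a ^^ j) (bidiag n a v) k" for j
  proof -
    have "of_nat (Suc j) / fact (Suc j) = (1 / fact j :: complex)" by (simp del: of_nat_Suc)
    then have "diffs c j = (1 / fact j) * (bidiag n a ^^ Suc j) v k"
      unfolding diffs_def c_def by (metis times_divide_eq_right times_divide_eq_left)
    then show ?thesis by (simp add: funpow_swap1)
  qed
  then have 3: "suminf (\<lambda>j. diffs c j * z ^ j) = bidiag n a (bexp n a z v) k"
    by (simp add: bidiag_bexp) (simp add: bexp_def)
  show ?thesis using 1 unfolding 2 3 .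
qed

lemma bexp_0 [simp]: "bexp n a 0 v = v"
proof
  fix k
  have "suminf (\<lambda>j. 0 ^ j / fact j * (bidiag n a ^^ j) v k) = (\<Sum>j\<in>{0}. 0 ^ j / fact j * (bidiag n a ^^ j) v k)"
    by (rule suminf_finite) auto
  then show "bexp n a 0 v k = v k" by (simp add: bexp_def)
qed

lemma bexp_above: assumes "k \<ge> n" shows "bexp n a z v k = v k"
proof -
  have "suminf (\<lambda>j. z ^ j / fact j * (bidiag n a ^^ j) v k) = (\<Sum>j\<in>{0}. z ^ j / fact j * (bidiag n a ^^ j) v k)"
  proof (rule suminf_finite)
    fix j :: nat assume "j \<notin> {0}"
    then obtain i where "j = Suc i" by (cases j) auto
    then show "z ^ j / fact j * (bidiag n a ^^ j) v k = 0" using assms by (simp add: bidiag_def)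
  qed auto
  then show ?thesis by (simp add: bexp_def)
qed

lemma bexp_fin_vecs: "v \<in> fin_vecs n \<Longrightarrow> bexp n a z v \<in> fin_vecs n"
  by (simp add: fin_vecs_def bexp_above)

lemma bexp_lower_triangular:
  assumes "k < n" "\<And>i. i < k \<Longrightarrow> v i = 0"
  shows "bexp n a z v k = exp (a k * z) * v k" "\<And>i. i < k \<Longrightarrow> bexp n a z v i = 0"
proof -
  have A: "(bidiag n a ^^ j) v k = a k ^ j * v k \<and> (\<forall>i<k. (bidiag n a ^^ j) v i = 0)" for j
    by (induction j) (use assms in \<open>auto simp: bidiag_def\<close>)
  have "(\<lambda>j. (a k * z) ^ j /\<^sub>R fact j * v k) sums (exp (a k * z) * v k)"
    by (intro sums_mult2 exp_converges)
  then have "(\<lambda>j. z ^ j / fact j * (bidiag n a ^^ j) v k) sums (exp (a k * z) * v k)"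
    using A by (simp add: scaleR_conv_of_real power_mult_distrib field_simps)
  then show "bexp n a z v k = exp (a k * z) * v k" unfolding bexp_def by (rule sums_unique[symmetric])
  show "bexp n a z v i = 0" if "i < k" for i
    using A that by (simp add: bexp_def)
qed

text \<open>Since \<open>A\<close> is lower triangular, \<open>y' = h A y\<close> can be solved one coordinate at a time: once the
  coordinates before \<open>k\<close> vanish, \<open>exp(- a\<^sub>k L) y\<^sub>k\<close> has derivative \<open>0\<close>.  The factor \<open>h\<close> with primitive
  \<open>L\<close> covers both the group law of \<open>exp(z A)\<close> (\<open>h = 1\<close>) and the connection on \<open>\<complex>\<^sup>\<times>\<close> (\<open>h = - 1/z\<close>).\<close>

lemma bidiag_ode_unique:
  fixes y :: "complex \<Rightarrow> nat \<Rightarrow> complex"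
  assumes S: "convex S" "open S"
    and L: "\<And>z. z \<in> S \<Longrightarrow> (L has_field_derivative h z) (at z)"
    and y: "\<And>z k. \<lbrakk>z \<in> S; k < n\<rbrakk> \<Longrightarrow>
      ((\<lambda>z. y z k) has_field_derivative h z * bidiag n a (y z) k) (at z)"
    and z0: "z0 \<in> S" "\<And>k. k < n \<Longrightarrow> y z0 k = 0"
  shows "\<lbrakk>z \<in> S; k < n\<rbrakk> \<Longrightarrow> y z k = 0"
proof (induction k arbitrary: z rule: less_induct)
  case (less k)
  define g where "g z = exp (- a k * L z) * y z k" for z
  have "(g has_field_derivative 0) (at w within S)" if w: "w \<in> S" for w
  proof -
    have b: "bidiag n a (y w) k = a k * y w k"
      using less.IH[of "k - 1" w] less.prems w by (cases k) (auto simp: bidiag_def)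
    have "(g has_field_derivative
       exp (- a k * L w) * (h w * bidiag n a (y w) k) + exp (- a k * L w) * (- a k * h w) * y w k) (at w)"
      unfolding g_def using y[OF w less.prems(2)] L[OF w]
      by (auto intro!: derivative_eq_intros)
    then show ?thesis unfolding b by (simp add: algebra_simps has_field_derivative_at_within)
  qed
  then obtain d where d: "\<And>w. w \<in> S \<Longrightarrow> g w = d"
    using has_field_derivative_zero_constant[OF S(1), of g] by blast
  have "g z0 = 0" using z0(2) less.prems by (simp add: g_def)
  then have "g z = 0" using d z0(1) less.prems(1) by metis
  then show ?case by (simp add: g_def)
qed

lemma bexp_unique:
  assumes y: "\<And>z k. k < n \<Longrightarrow> ((\<lambda>z. y z k) has_field_derivative bidiag n a (y z) k) (at z)"
    and k: "k < n"
  shows "y z k = bexp n a z (y 0) k"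
proof -
  define d where "d z = lincomb 1 (y z) (- 1) (bexp n a z (y 0))" for z
  have "d z k = 0"
  proof (rule bidiag_ode_unique[where y = d and z = z and k = k and S = UNIV and L = "\<lambda>z. z" and h = "\<lambda>z. 1" and ?z0.0 = 0 and n = n and a = a])
    fix z :: complex and k assume "k < n"
    then show "((\<lambda>z. d z k) has_field_derivative 1 * bidiag n a (d z) k) (at z)"
      using y[of k z] bexp_deriv[of n a "y 0" k z] unfolding d_def bidiag_lincomb
      by (auto simp: lincomb_def intro!: derivative_eq_intros)
  qed (auto simp: d_def lincomb_def k)
  then show ?thesis by (simp add: d_def lincomb_def)
qed

lemma bexp_add: "bexp n a (z + w) v = bexp n a z (bexp n a w v)"
proof
  fix k
  show "bexp n a (z + w) v k = bexp n a z (bexp n a w v) k"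
  proof (cases "k < n")
    case True
    have "((\<lambda>z. bexp n a (z + w) v k) has_field_derivative bidiag n a (bexp n a (z + w) v) k) (at z)" for z k
      using bexp_deriv[of n a v k "z + w"] by (simp add: DERIV_shift)
    from bexp_unique[where y = "\<lambda>z. bexp n a (z + w) v", OF this True, of z]
    show ?thesis by simp
  qed (simp add: bexp_above)
qed

text \<open>On functions of degree \<open>d\<close> the Euler element is \<open>d + A\<close>; this separates the scalar factor.\<close>

lemma bexp_shift:
  assumes "v \<in> fin_vecs n"
  shows "bexp n (\<lambda>k. d + a k) z v = (\<lambda>k. exp (d * z) * bexp n a z v k)"
proof
  fix k
  show "bexp n (\<lambda>k. d + a k) z v k = exp (d * z) * bexp n a z v k"
  proof (cases "k < n")
    case True
    define y where "y z k = exp (d * z) * bexp n a z v k" for z k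
    have "((\<lambda>z. y z k) has_field_derivative bidiag n (\<lambda>k. d + a k) (y z) k) (at z)" if "k < n" for z k
      unfolding y_def using that
      by (auto intro!: derivative_eq_intros bexp_deriv simp: bidiag_def algebra_simps)
    from bexp_unique[where y = y, OF this True, of z]
    have "y z k = bexp n (\<lambda>k. d + a k) z (y 0) k" .
    moreover have "y 0 = v" by (rule ext) (simp add: y_def)
    ultimately show ?thesis by (simp add: y_def)
  qed (use assms in \<open>simp add: bexp_above fin_vecs_def\<close>)
qed

lemma bidiag_shift:
  assumes "v \<in> fin_vecs n"
  shows "bidiag n (\<lambda>k. d + a k) v = (\<lambda>k. d * v k + bidiag n a v k)"
  using assms by (auto simp: bidiag_def fin_vecs_def algebra_simps)

text \<open>Spectral mapping for eigenspaces: if \<open>exp(w \<cdot>)\<close> separates \<open>al\<close> from the other diagonal entries,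
  an eigenvector of \<open>exp(w A)\<close> is one of \<open>A\<close>.  Otherwise let \<open>j\<close> be the first nonzero coordinate of
  \<open>v = (A - al) u\<close>.  This \<open>v\<close> is an eigenvector of \<open>exp(w A)\<close> too, so \<open>a\<^sub>j = al\<close>, and then coordinate \<open>j\<close> of
  \<open>exp(- al z) exp(z A) u\<close> is \<open>u\<^sub>j + z v\<^sub>j\<close>, which has to return to \<open>u\<^sub>j\<close> at \<open>z = w\<close>.

  Only the first \<open>m\<close> coordinates are considered.  They form a quotient representation, as \<open>A\<close> is lower
  triangular, and \<open>char_poly_dvd\<close> proceeds by induction along these quotients.\<close>

lemma bexp_eigenvector:
  assumes m: "m \<le> n"
    and eig: "\<And>k. k < m \<Longrightarrow> bexp n a w u k = exp (al * w) * u k"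
    and sep: "\<And>k. \<lbrakk>k < m; exp (a k * w) = exp (al * w)\<rbrakk> \<Longrightarrow> a k = al"
    and w: "w \<noteq> 0" and k: "k < m"
  shows "bidiag n a u k = al * u k"
proof -
  define v where "v = lincomb 1 (bidiag n a u) (- al) u"
  have "v j = 0" if "j < m" for j
    using that
  proof (induction j rule: less_induct)
    case (less j)
    have jn: "j < n" using less.prems m by simp
    have low: "v i = 0" if "i < j" for i using less that by auto
    show ?case
    proof (rule ccontr)
      assume vj: "v j \<noteq> 0"
      have "bexp n a w v j = exp (al * w) * v j"
      proof -
        have "bidiag n a (bexp n a w u) j = exp (al * w) * bidiag n a u j"
          using eig less.prems by (auto simp: bidiag_def algebra_simps)
        then show ?thesis
          unfolding v_def bexp_lincomb bidiag_bexp[symmetric] using eig[OF less.prems]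
          by (simp add: lincomb_def algebra_simps)
      qed
      then have aj: "a j = al"
        using sep[OF less.prems] bexp_lower_triangular(1)[OF jn low, where a = a and z = w] vj by auto
      define g where "g z = exp (- al * z) * bexp n a z u j - z * v j" for z
      have "(g has_field_derivative 0) (at z)" for z
      proof -
        have "bexp n a z v j = bidiag n a (bexp n a z u) j - al * bexp n a z u j"
          by (simp add: v_def bexp_lincomb bidiag_bexp) (simp add: lincomb_def)
        then have *: "bidiag n a (bexp n a z u) j = al * bexp n a z u j + exp (al * z) * v j"
          using bexp_lower_triangular(1)[OF jn low, where a = a and z = z] aj by simp
        have "(g has_field_derivative exp (- al * z) * bidiag n a (bexp n a z u) j
            + exp (- al * z) * (- al) * bexp n a z u j - v j) (at z)"
          unfolding g_def by (auto intro!: derivative_eq_intros bexp_deriv)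
        moreover have "exp (- al * z) * bidiag n a (bexp n a z u) j
            + exp (- al * z) * (- al) * bexp n a z u j - v j = 0"
          unfolding * by (simp add: algebra_simps exp_minus)
        ultimately show ?thesis by simp
      qed
      then have "g w = g 0"
        using has_field_derivative_zero_constant[OF convex_UNIV, of g] by auto
      then have "exp (- al * w) * (exp (al * w) * u j) - w * v j = u j"
        using eig[OF less.prems] by (simp add: g_def)
      moreover have "exp (- al * w) * (exp (al * w) * u j) = u j"
        by (simp add: mult.assoc[symmetric] exp_minus)
      ultimately have "w * v j = 0" by (simp only: diff_eq_eq) simp
      then show False using vj w by simp
    qed
  qed
  from this[OF k] show ?thesis by (simp add: v_def lincomb_def)
qed

section \<open>Polynomials in a linear operator\<close>

definition lin_op :: "((nat \<Rightarrow> complex) \<Rightarrow> (nat \<Rightarrow> complex)) \<Rightarrow> bool" where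
  "lin_op B \<longleftrightarrow> (\<forall>x u y v. B (lincomb x u y v) = lincomb x (B u) y (B v))"

definition poly_op ::
  "((nat \<Rightarrow> complex) \<Rightarrow> (nat \<Rightarrow> complex)) \<Rightarrow> complex poly \<Rightarrow> (nat \<Rightarrow> complex) \<Rightarrow> nat \<Rightarrow> complex"
where
  "poly_op B p v = (\<lambda>k. \<Sum>i\<le>degree p. coeff p i * (B ^^ i) v k)"

lemma lin_op_bexp: "lin_op (bexp n a z)"
  by (simp add: lin_op_def bexp_lincomb)

lemma poly_op_degree_le:
  assumes "degree p \<le> N"
  shows "poly_op B p v k = (\<Sum>i\<le>N. coeff p i * (B ^^ i) v k)"
  unfolding poly_op_def
  by (rule sum.mono_neutral_left) (use assms in \<open>auto simp: coeff_eq_0\<close>)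

lemma poly_op_add: "poly_op B (p + q) v = lincomb 1 (poly_op B p v) 1 (poly_op B q v)"
proof
  fix k
  let ?N = "max (degree p) (degree q)"
  have "degree (p + q) \<le> ?N" by (rule degree_add_le_max)
  then show "poly_op B (p + q) v k = lincomb 1 (poly_op B p v) 1 (poly_op B q v) k"
    by (simp add: poly_op_degree_le[of _ ?N] lincomb_def sum.distrib algebra_simps)
qed

lemma poly_op_smult: "poly_op B (Polynomial.smult x p) v = (\<lambda>k. x * poly_op B p v k)"
proof
  fix k
  have "degree (Polynomial.smult x p) \<le> degree p" by (rule degree_smult_le)
  then show "poly_op B (Polynomial.smult x p) v k = x * poly_op B p v k"
    by (simp add: poly_op_degree_le[of _ "degree p"] sum_distrib_left mult.assoc)
qed

lemma poly_op_diff: "poly_op B (p - q) v = lincomb 1 (poly_op B p v) (- 1) (poly_op B q v)"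
  using poly_op_add[of B p "Polynomial.smult (- 1) q" v]
  by (simp add: poly_op_smult lincomb_def del: smult_minus_left) (simp add: fun_eq_iff)

lemma poly_op_0 [simp]: "poly_op B 0 v = (\<lambda>k. 0)"
  by (simp add: poly_op_def)

lemma poly_op_pCons: "poly_op B (pCons x p) v = (\<lambda>k. x * v k + poly_op B p (B v) k)"
proof
  fix k
  have "degree (pCons x p) \<le> Suc (degree p)" by (rule degree_pCons_le)
  then have "poly_op B (pCons x p) v k = (\<Sum>i\<le>Suc (degree p). coeff (pCons x p) i * (B ^^ i) v k)"
    by (rule poly_op_degree_le)
  also have "\<dots> = x * v k + (\<Sum>i\<le>degree p. coeff p i * (B ^^ Suc i) v k)"
    unfolding sum.atMost_Suc_shift by simp
  also have "\<dots> = x * v k + poly_op B p (B v) k"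
    by (simp add: poly_op_def funpow_swap1)
  finally show "poly_op B (pCons x p) v k = x * v k + poly_op B p (B v) k" .
qed

lemma lin_op_zero: "lin_op B \<Longrightarrow> B (\<lambda>k. 0) = (\<lambda>k. 0)"
  unfolding lin_op_def
  by (drule spec[of _ 0], drule spec[of _ "\<lambda>k. 0"], drule spec[of _ 0], drule spec[of _ "\<lambda>k. 0"])
     (simp add: lincomb_def)

lemma poly_op_commute:
  assumes "lin_op B" shows "poly_op B p (B v) = B (poly_op B p v)"
proof (induction p arbitrary: v)
  case 0
  then show ?case using lin_op_zero[OF assms] by simp
next
  case (pCons x p)
  have "poly_op B (pCons x p) (B v) = lincomb x (B v) 1 (B (poly_op B p (B v)))"
    by (simp add: poly_op_pCons pCons.IH lincomb_def)
  also have "\<dots> = B (lincomb x v 1 (poly_op B p (B v)))"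
    using assms by (simp add: lin_op_def)
  also have "lincomb x v 1 (poly_op B p (B v)) = poly_op B (pCons x p) v"
    by (simp add: poly_op_pCons lincomb_def)
  finally show ?case .
qed

lemma poly_op_mult:
  assumes "lin_op B" shows "poly_op B (p * q) v = poly_op B p (poly_op B q v)"
proof (induction p arbitrary: v)
  case (pCons x p)
  then show ?case
    by (simp add: poly_op_add poly_op_smult poly_op_pCons lincomb_def poly_op_commute[OF assms])
qed simp

lemma poly_op_linear_factor: "poly_op B [:- x, 1:] v = lincomb 1 (B v) (- x) v"
  by (simp add: poly_op_pCons lincomb_def)

lemma lin_op_poly_op:
  assumes "lin_op B" shows "lin_op (poly_op B p)"
proof -
  have "(B ^^ i) (lincomb x u y v) = lincomb x ((B ^^ i) u) y ((B ^^ i) v)" for i x u y v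
    using assms by (induction i) (simp_all add: lin_op_def)
  then show ?thesis
    unfolding lin_op_def poly_op_def
    by (simp add: lincomb_def sum.distrib sum_distrib_left algebra_simps)
qed

lemma poly_op_fin_vecs:
  assumes "\<And>v. v \<in> fin_vecs n \<Longrightarrow> B v \<in> fin_vecs n" "v \<in> fin_vecs n"
  shows "poly_op B p v \<in> fin_vecs n"
proof -
  have "(B ^^ i) v \<in> fin_vecs n" for i by (induction i) (use assms in auto)
  then show ?thesis by (simp add: poly_op_def fin_vecs_def)
qed

text \<open>Cayley-Hamilton for the triangular matrix \<open>exp(w A)\<close>: each linear factor kills one more leading
  coordinate.\<close>

lemma poly_op_char_poly:
  assumes "v \<in> fin_vecs n"
  shows "poly_op (bexp n a w) (\<Prod>k<n. [:- exp (a k * w), 1:]) v = (\<lambda>k. 0)"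
proof -
  let ?B = "bexp n a w"
  have fin: "poly_op ?B p v \<in> fin_vecs n" for p
    by (rule poly_op_fin_vecs) (use assms bexp_fin_vecs in auto)
  have "poly_op ?B (\<Prod>k<m. [:- exp (a k * w), 1:]) v i = 0" if "i < m" "m \<le> n" for i m
    using that
  proof (induction m arbitrary: i)
    case (Suc m)
    define u where "u = poly_op ?B (\<Prod>k<m. [:- exp (a k * w), 1:]) v"
    have u: "u i = 0" if "i < m" for i using Suc.IH[OF that] Suc.prems by (simp add: u_def)
    have mn: "m < n" using Suc.prems by simp
    have "poly_op ?B (\<Prod>k<Suc m. [:- exp (a k * w), 1:]) v = lincomb 1 (?B u) (- exp (a m * w)) u"
      unfolding prod.lessThan_Suc
      by (subst mult.commute) (simp only: poly_op_mult[OF lin_op_bexp] poly_op_linear_factor u_def)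
    then show ?case
      using bexp_lower_triangular(1)[OF mn u, where a = a and z = w]
        bexp_lower_triangular(2)[OF mn u, where a = a and z = w and i = i] u[of i] Suc.prems
      by (cases "i = m") (simp_all add: lincomb_def)
  qed simp
  from this[OF _ order_refl] fin show ?thesis
    unfolding fin_vecs_def by (metis (mono_tags, lifting) mem_Collect_eq not_le)
qed

text \<open>The minimal polynomial of \<open>B = exp(w A)\<close> is the characteristic one.  Suppose \<open>p(B)\<close> vanishes on the
  quotient by the span of \<open>e\<^sub>k\<close>, \<open>k > m\<close>.  Applied to \<open>e\<^sub>m\<close> this gives \<open>p = (X - \<lambda>\<^sub>m) q\<close>.  The image of
  \<open>q(B)\<close> consists of eigenvectors of \<open>B\<close>, hence of \<open>A\<close>, for the eigenvalue of \<open>e\<^sub>m\<close>; because of the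
  entries \<open>1\<close> below the diagonal these are multiples of \<open>e\<^sub>m\<close>.  So \<open>q(B)\<close> vanishes on the next smaller
  quotient.\<close>

lemma char_poly_dvd:
  assumes sep: "\<And>i j. \<lbrakk>i < n; j < n; exp (a i * w) = exp (a j * w)\<rbrakk> \<Longrightarrow> a i = a j"
    and w: "w \<noteq> 0" and m: "m \<le> n"
    and p: "\<And>v k. \<lbrakk>v \<in> fin_vecs n; k < m\<rbrakk> \<Longrightarrow> poly_op (bexp n a w) p v k = 0"
  shows "(\<Prod>k<m. [:- exp (a k * w), 1:]) dvd p"
  using m p
proof (induction m arbitrary: p)
  case (Suc m)
  let ?B = "bexp n a w" and ?f = "[:- exp (a m * w), 1:]"
  have mn: "m < n" using Suc.prems by simp
  define e :: "nat \<Rightarrow> complex" where "e = (\<lambda>k. if k = m then 1 else 0)"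
  have e: "e \<in> fin_vecs n" using mn by (simp add: e_def fin_vecs_def)
  have "(?B ^^ i) e m = exp (a m * w) ^ i \<and> (\<forall>j<m. (?B ^^ i) e j = 0)" for i
  proof (induction i)
    case (Suc i)
    then show ?case
      using bexp_lower_triangular[OF mn, of "(?B ^^ i) e", where a = a and z = w] by auto
  qed (simp add: e_def)
  then have "poly_op ?B p e m = poly p (exp (a m * w))"
    by (simp add: poly_op_def poly_altdef)
  then have "poly p (exp (a m * w)) = 0" using Suc.prems(2)[OF e, of m] by simp
  then obtain q where q: "p = ?f * q" unfolding poly_eq_0_iff_dvd by (auto elim: dvdE)
  have "poly_op ?B q v k = 0" if v: "v \<in> fin_vecs n" and k: "k < m" for v k
  proof -
    define u where "u = poly_op ?B q v"
    have "?B u i = exp (a m * w) * u i" if "i < Suc m" for i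
      using Suc.prems(2)[OF v that] unfolding q poly_op_mult[OF lin_op_bexp] poly_op_linear_factor
      by (simp add: lincomb_def u_def)
    then have ev: "bidiag n a u i = a m * u i" if "i < Suc m" for i
      by (rule bexp_eigenvector[OF Suc.prems(1) _ _ w that]) (use sep mn in auto)
    have "u k = 0"
      using k
    proof (induction rule: strict_inc_induct)
      case (base i)
      then show ?case using ev[of m] mn by (auto simp: bidiag_def split: if_splits)
    next
      case (step i)
      then show ?case using ev[of "Suc i"] mn by (simp add: bidiag_def)
    qed
    then show ?thesis by (simp add: u_def)
  qed
  from Suc.IH[OF _ this] Suc.prems(1) have "(\<Prod>k<m. [:- exp (a k * w), 1:]) dvd q" by simp
  then show ?case unfolding q prod.lessThan_Suc by (subst mult.commute) (rule mult_dvd_mono, simp_all)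
qed simp

definition vscale :: "complex \<Rightarrow> (nat \<Rightarrow> complex) \<Rightarrow> nat \<Rightarrow> complex" where
  "vscale x v = (\<lambda>k. x * v k)"

interpretation fv: vector_space vscale
  by unfold_locales (auto simp: vscale_def algebra_simps)

text \<open>If \<open>v0\<close> is annihilated by no nonzero polynomial of degree less than \<open>n\<close>, the \<open>n\<close> vectors
  \<open>B\<^sup>i v0\<close> with \<open>i < n\<close> are linearly independent, hence a basis.\<close>

lemma cyclic_vector_generates:
  assumes B: "lin_op B" "\<And>v. v \<in> fin_vecs n \<Longrightarrow> B v \<in> fin_vecs n"
    and v0: "v0 \<in> fin_vecs n" and f: "f \<noteq> 0" "degree f = n"
    and ann: "\<And>p. poly_op B p v0 = (\<lambda>k. 0) \<Longrightarrow> f dvd p"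
    and y: "y \<in> fin_vecs n"
  shows "\<exists>p. y = poly_op B p v0"
proof -
  define w where "w i = (B ^^ i) v0" for i
  define e :: "nat \<Rightarrow> nat \<Rightarrow> complex" where "e i = (\<lambda>k. if k = i then 1 else 0)" for i
  have w_poly: "w i = poly_op B (monom 1 i) v0" for i
    by (rule ext) (simp add: w_def poly_op_def degree_monom_eq coeff_monom if_distrib[of "\<lambda>x. x * _"] cong: if_cong)
  have sp: "\<exists>p. x = poly_op B p v0 \<and> (\<forall>j\<ge>i. coeff p j = 0)" if "x \<in> fv.span (w ` {..<i})" for x i
    using that
  proof (induction rule: fv.span_induct_alt)
    case base
    show ?case by (rule exI[of _ 0]) (simp add: zero_fun_def)
  next
    case (step z b x)
    then obtain p j where p: "x = poly_op B p v0" "\<forall>j\<ge>i. coeff p j = 0" and j: "b = w j" "j < i" by auto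
    have "vscale z b + x = poly_op B (Polynomial.smult z (monom 1 j) + p) v0"
      by (simp add: poly_op_add poly_op_smult p j w_poly vscale_def lincomb_def plus_fun_def)
    moreover have "\<forall>l\<ge>i. coeff (Polynomial.smult z (monom 1 j) + p) l = 0" using p j by auto
    ultimately show ?case by blast
  qed
  have wi: "w i \<notin> fv.span (w ` {..<i})" if "i < n" for i
  proof
    assume "w i \<in> fv.span (w ` {..<i})"
    from sp[OF this] obtain p where p: "w i = poly_op B p v0" "\<forall>j\<ge>i. coeff p j = 0" by blast
    have "poly_op B (monom 1 i - p) v0 = (\<lambda>k. 0)"
      by (simp add: poly_op_diff lincomb_def w_poly[symmetric] p(1)[symmetric])
    then have d: "f dvd monom 1 i - p" by (rule ann)
    have "coeff (monom 1 i - p) i = 1" using p(2) by simp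
    then have "monom 1 i - p \<noteq> 0" by fastforce
    from dvd_imp_degree_le[OF d this] have "n \<le> degree (monom 1 i - p)" using f by simp
    moreover have "degree (monom 1 i - p) \<le> i"
      by (rule degree_le) (use p(2) in \<open>auto simp: coeff_monom\<close>)
    ultimately show False using that by simp
  qed
  have ind: "fv.independent (w ` {..<i}) \<and> card (w ` {..<i}) = i" if "i \<le> n" for i
    using that
  proof (induction i)
    case (Suc i)
    have ni: "w i \<notin> w ` {..<i}" using wi[of i] Suc.prems fv.span_base by auto
    show ?case using Suc ni wi[of i]
      by (simp add: lessThan_Suc fv.independent_insertI)
  qed (simp add: fv.independent_empty)
  have fin: "x \<in> fv.span (e ` {..<n})" if "x \<in> fin_vecs n" for x
  proof -
    have "x = (\<Sum>i<n. vscale (x i) (e i))"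
    proof
      fix k
      have "(\<Sum>i<n. vscale (x i) (e i)) k = (\<Sum>i<n. x i * e i k)"
        by (induction n) (simp_all add: vscale_def)
      also have "\<dots> = x k" using that
        by (auto simp: e_def fin_vecs_def if_distrib[of "\<lambda>z. _ * z"] cong: if_cong)
      finally show "x k = (\<Sum>i<n. vscale (x i) (e i)) k" by simp
    qed
    also have "\<dots> \<in> fv.span (e ` {..<n})"
      by (intro fv.span_sum fv.span_scale fv.span_base) auto
    finally show ?thesis .
  qed
  have "y \<in> fv.span (w ` {..<n})"
  proof (rule ccontr)
    assume ny: "y \<notin> fv.span (w ` {..<n})"
    then have "y \<notin> w ` {..<n}" by (metis fv.span_base)
    moreover have "fv.independent (insert y (w ` {..<n}))"
      using ind[of n] ny by (simp add: fv.independent_insertI)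
    moreover have "(B ^^ i) v0 \<in> fin_vecs n" for i by (induction i) (use B(2) v0 in auto)
    then have "insert y (w ` {..<n}) \<subseteq> fv.span (e ` {..<n})"
      using fin y by (auto simp: w_def)
    ultimately have "card (insert y (w ` {..<n})) \<le> card (e ` {..<n})"
      using fv.independent_span_bound[of "e ` {..<n}"] by blast
    also have "\<dots> \<le> n" using card_image_le[of "{..<n}" e] by simp
    finally show False using \<open>y \<notin> w ` {..<n}\<close> ind[of n] by simp
  qed
  with sp[of y n] show ?thesis by blast
qed

section \<open>Quotients of a ring given by a type\<close>

text \<open>The algebras of interest are quotients of rings whose carrier is a whole type.  The following facts
  translate statements about their cosets into statements about elements of the type.\<close>

abbreviation "type_ring \<equiv> ring_of_type_algebra"

lemma type_ring_simps [simp]: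
  "carrier (type_ring :: 'a::ring_1 ring) = UNIV"
  "(a::'a) \<oplus>\<^bsub>type_ring\<^esub> b = a + b"
  "(a::'a) \<otimes>\<^bsub>type_ring\<^esub> b = a * b"
  "\<zero>\<^bsub>type_ring\<^esub> = (0::'a)"
  "\<one>\<^bsub>type_ring\<^esub> = (1::'a)"
  by (simp_all add: ring_of_type_algebra_def)

lemma ring_type_ring: "ring (type_ring :: 'a::ring_1 ring)"
proof -
  have "\<exists>y. x + y = 0" for x :: 'a
    using add.right_inverse by blast
  then show ?thesis
    unfolding ring_of_type_algebra_def using add.right_inverse
    by unfold_locales (auto simp: algebra_simps Units_def)
qed

lemma ideal_type_ring_iff:
  fixes I :: "'a::ring_1 set"
  shows "ideal I type_ring \<longleftrightarrow>
    0 \<in> I \<and> (\<forall>a\<in>I. \<forall>b\<in>I. a + b \<in> I) \<and> (\<forall>a\<in>I. \<forall>r. r * a \<in> I \<and> a * r \<in> I)"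
proof
  assume "ideal I type_ring"
  then interpret ideal I "type_ring :: 'a ring" .
  show "0 \<in> I \<and> (\<forall>a\<in>I. \<forall>b\<in>I. a + b \<in> I) \<and> (\<forall>a\<in>I. \<forall>r. r * a \<in> I \<and> a * r \<in> I)"
    using additive_subgroup.zero_closed[OF is_additive_subgroup] additive_subgroup.a_closed[OF is_additive_subgroup] I_l_closed I_r_closed by auto
next
  assume I: "0 \<in> I \<and> (\<forall>a\<in>I. \<forall>b\<in>I. a + b \<in> I) \<and> (\<forall>a\<in>I. \<forall>r. r * a \<in> I \<and> a * r \<in> I)"
  interpret R: ring "type_ring :: 'a ring" by (rule ring_type_ring)
  have minus: "\<ominus>\<^bsub>type_ring\<^esub> a = - a" for a :: 'a
    using R.minus_equality[of "- a" a] by simp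
  have neg: "- a \<in> I" if "a \<in> I" for a using I that by (metis mult_minus1)
  show "ideal I type_ring"
  proof (rule idealI[OF ring_type_ring])
    show "subgroup I (add_monoid type_ring)"
      using I neg by (intro R.add.subgroupI) (auto simp: minus a_inv_def[symmetric])
  qed (use I in auto)
qed

lemma type_coset_def:
  "I +>\<^bsub>type_ring\<^esub> (a::'a::ring_1) = {h + a | h. h \<in> I}"
  by (auto simp: a_r_coset_def r_coset_def)

context
  fixes I :: "'a::ring_1 set"
  assumes I: "ideal I type_ring"
begin

lemma type_ideal_neg: "a \<in> I \<Longrightarrow> - a \<in> I"
  using I unfolding ideal_type_ring_iff by (metis mult_minus1)

lemma type_coset_mem: "b \<in> I +>\<^bsub>type_ring\<^esub> a \<longleftrightarrow> b - a \<in> I"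
  unfolding type_coset_def by (auto intro: exI[of _ "b - a"])

lemma type_coset_eq_iff:
  "I +>\<^bsub>type_ring\<^esub> a = I +>\<^bsub>type_ring\<^esub> b \<longleftrightarrow> a - b \<in> I"
proof
  assume "I +>\<^bsub>type_ring\<^esub> a = I +>\<^bsub>type_ring\<^esub> b"
  moreover have "a \<in> I +>\<^bsub>type_ring\<^esub> a"
    using I by (simp add: type_coset_mem ideal_type_ring_iff)
  ultimately show "a - b \<in> I" by (simp add: type_coset_mem)
next
  assume d: "a - b \<in> I"
  have "x - a \<in> I \<longleftrightarrow> x - b \<in> I" for x
  proof
    assume "x - a \<in> I"
    then have "(x - a) + (a - b) \<in> I" using d I unfolding ideal_type_ring_iff by blast
    then show "x - b \<in> I" by simp
  next
    assume "x - b \<in> I"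
    then have "(x - b) + - (a - b) \<in> I" using type_ideal_neg[OF d] I unfolding ideal_type_ring_iff by blast
    then show "x - a \<in> I" by simp
  qed
  then show "I +>\<^bsub>type_ring\<^esub> a = I +>\<^bsub>type_ring\<^esub> b"
    by (auto simp: type_coset_mem)
qed

lemma type_quot_ring: "ring (type_ring Quot I)"
  by (rule ideal.quotient_is_ring[OF I])

lemma type_quot_carrier:
  "carrier (type_ring Quot I) = range (\<lambda>a. I +>\<^bsub>type_ring\<^esub> a)"
  by (auto simp: FactRing_def A_RCOSETS_def RCOSETS_def a_r_coset_def ring_of_type_algebra_def)

lemma type_quot_ops:
  "(I +>\<^bsub>type_ring\<^esub> a) \<oplus>\<^bsub>type_ring Quot I\<^esub> (I +>\<^bsub>type_ring\<^esub> b)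
     = I +>\<^bsub>type_ring\<^esub> (a + b)"
  "(I +>\<^bsub>type_ring\<^esub> a) \<otimes>\<^bsub>type_ring Quot I\<^esub> (I +>\<^bsub>type_ring\<^esub> b)
     = I +>\<^bsub>type_ring\<^esub> (a * b)"
  "\<one>\<^bsub>type_ring Quot I\<^esub> = I +>\<^bsub>type_ring\<^esub> 1"
  "\<zero>\<^bsub>type_ring Quot I\<^esub> = I +>\<^bsub>type_ring\<^esub> 0"
proof -
  interpret ideal I "type_ring :: 'a ring" by (rule I)
  show "(I +>\<^bsub>type_ring\<^esub> a) \<otimes>\<^bsub>type_ring Quot I\<^esub> (I +>\<^bsub>type_ring\<^esub> b)
     = I +>\<^bsub>type_ring\<^esub> (a * b)"
    by (simp add: FactRing_def rcoset_mult_add)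
  show "(I +>\<^bsub>type_ring\<^esub> a) \<oplus>\<^bsub>type_ring Quot I\<^esub> (I +>\<^bsub>type_ring\<^esub> b)
     = I +>\<^bsub>type_ring\<^esub> (a + b)"
    by (simp add: FactRing_def a_rcos_sum)
qed (auto simp: FactRing_def type_coset_def)

end

section \<open>Abelian groups given by a parametrization\<close>

lemma sum_fun_apply: "(\<Sum>i\<in>I. x i) b = (\<Sum>i\<in>I. x i b)"
  by (induction I rule: infinite_finite_induct) simp_all

text \<open>The localization and the space of germs are sets of equivalence classes whose addition is defined
  through representatives.  For both a parametrization \<open>g\<close> by vectors or functions is available, and then
  the group axioms and finite sums are inherited from the parameters.\<close>

lemma abelian_group_image:
  fixes g :: "'a::ab_group_add \<Rightarrow> 'b"
  assumes V: "carrier V = g ` A" "\<zero>\<^bsub>V\<^esub> = g 0"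
    and add: "\<And>x y. \<lbrakk>x \<in> A; y \<in> A\<rbrakk> \<Longrightarrow> g x \<oplus>\<^bsub>V\<^esub> g y = g (x + y)"
    and A: "0 \<in> A" "\<And>x y. \<lbrakk>x \<in> A; y \<in> A\<rbrakk> \<Longrightarrow> x - y \<in> A"
  shows "abelian_group V"
    and "\<lbrakk>finite I; \<And>i. i \<in> I \<Longrightarrow> x i \<in> A\<rbrakk> \<Longrightarrow>
      (\<Oplus>\<^bsub>V\<^esub>i\<in>I. g (x i)) = g (\<Sum>i\<in>I. x i) \<and> (\<Sum>i\<in>I. x i) \<in> A"
proof -
  have A_add: "x + y \<in> A" if "x \<in> A" "y \<in> A" for x y
    using A(2)[OF that(1) A(2)[OF A(1) that(2)]] by simp
  show V': "abelian_group V"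
  proof (rule comm_group_abelian_groupI, rule comm_groupI)
    fix v assume "v \<in> carrier (add_monoid V)"
    then obtain x where x: "x \<in> A" "v = g x" using V by auto
    have "- x \<in> A" using A(2)[OF A(1) x(1)] by simp
    then show "\<exists>w\<in>carrier (add_monoid V). w \<otimes>\<^bsub>add_monoid V\<^esub> v = \<one>\<^bsub>add_monoid V\<^esub>"
      using x V by (intro bexI[of _ "g (- x)"]) (simp_all add: add)
  qed (use V A(1) in \<open>auto simp: add A_add add_ac\<close>)
  then interpret V: abelian_group V .
  show "(\<Oplus>\<^bsub>V\<^esub>i\<in>I. g (x i)) = g (\<Sum>i\<in>I. x i) \<and> (\<Sum>i\<in>I. x i) \<in> A"
    if "finite I" "\<And>i. i \<in> I \<Longrightarrow> x i \<in> A"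
    using that
  proof (induction I)
    case (insert i I)
    have "(\<lambda>i. g (x i)) \<in> I \<rightarrow> carrier V" using insert V by auto
    then show ?case using insert V by (subst V.finsum_insert) (auto simp: add A_add)
  qed (use V A(1) in simp)
qed

section \<open>Tensor products over a noncommutative ring\<close>

text \<open>The tensor product of \<open>R\<close>, as a right \<open>B\<close>-module along \<open>\<iota>\<close>, with the left \<open>B\<close>-module \<open>M\<close>.\<close>

locale tensor_setup =
  fixes R :: "('a, 'r) ring_scheme" and B :: "('b, 's) ring_scheme"
    and \<iota> :: "'b \<Rightarrow> 'a" and M :: "('b, 'e, 'm) module_scheme"
  assumes R: "ring R"
    and iota: "\<And>b. b \<in> carrier B \<Longrightarrow> \<iota> b \<in> carrier R"
    and M_add: "\<And>m m'. \<lbrakk>m \<in> carrier M; m' \<in> carrier M\<rbrakk> \<Longrightarrow> m \<oplus>\<^bsub>M\<^esub> m' \<in> carrier M"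
    and M_smult: "\<And>b m. \<lbrakk>b \<in> carrier B; m \<in> carrier M\<rbrakk> \<Longrightarrow> b \<odot>\<^bsub>M\<^esub> m \<in> carrier M"
begin

interpretation R: ring R by (rule R)

abbreviation "S \<equiv> carrier R \<times> carrier M"
abbreviation "F \<equiv> free_Abelian_group S"
abbreviation "T \<equiv> tensor_module R B \<iota> M"
abbreviation "tcl \<equiv> tensor_class R B \<iota> M"
abbreviation "null \<equiv> tensor_null R B \<iota> M"
abbreviation "rels \<equiv> tensor_rels R B \<iota> M"

interpretation F: comm_group F by (rule abelian_free_Abelian_group)

lemma keys_diffI:
  "\<lbrakk>Poly_Mapping.keys x \<subseteq> A; Poly_Mapping.keys y \<subseteq> A\<rbrakk> \<Longrightarrow> Poly_Mapping.keys (x - y :: _ \<Rightarrow>\<^sub>0 int) \<subseteq> A"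
  using keys_diff[of x y] by blast

lemma relsI:
  "\<lbrakk>s \<in> carrier R; s' \<in> carrier R; m \<in> carrier M\<rbrakk> \<Longrightarrow>
    frag_of (s \<oplus>\<^bsub>R\<^esub> s', m) - frag_of (s, m) - frag_of (s', m) \<in> rels"
  "\<lbrakk>s \<in> carrier R; m \<in> carrier M; m' \<in> carrier M\<rbrakk> \<Longrightarrow>
    frag_of (s, m \<oplus>\<^bsub>M\<^esub> m') - frag_of (s, m) - frag_of (s, m') \<in> rels"
  "\<lbrakk>s \<in> carrier R; b \<in> carrier B; m \<in> carrier M\<rbrakk> \<Longrightarrow>
    frag_of (s \<otimes>\<^bsub>R\<^esub> \<iota> b, m) - frag_of (s, b \<odot>\<^bsub>M\<^esub> m) \<in> rels"
  unfolding tensor_rels_def by blast+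

lemma rels_cases:
  assumes "x \<in> rels"
  obtains (add_left) s s' m where "x = frag_of (s \<oplus>\<^bsub>R\<^esub> s', m) - frag_of (s, m) - frag_of (s', m)"
      "s \<in> carrier R" "s' \<in> carrier R" "m \<in> carrier M"
    | (add_right) s m m' where "x = frag_of (s, m \<oplus>\<^bsub>M\<^esub> m') - frag_of (s, m) - frag_of (s, m')"
      "s \<in> carrier R" "m \<in> carrier M" "m' \<in> carrier M"
    | (balanced) s b m where "x = frag_of (s \<otimes>\<^bsub>R\<^esub> \<iota> b, m) - frag_of (s, b \<odot>\<^bsub>M\<^esub> m)"
      "s \<in> carrier R" "b \<in> carrier B" "m \<in> carrier M"
  using assms unfolding tensor_rels_def by (elim UnE CollectE exE conjE) blast+

lemma rels_carrier: "rels \<subseteq> carrier F"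
proof
  fix x assume "x \<in> rels"
  then show "x \<in> carrier F"
    unfolding carrier_free_Abelian_group_iff
    by (cases rule: rels_cases; hypsubst; intro keys_diffI; simp add: M_add M_smult iota R.m_closed)
qed

lemma null_subgroup: "subgroup null F"
  unfolding tensor_null_def by (rule F.generate_is_subgroup[OF rels_carrier])

lemma null_normal: "null \<lhd> F"
  by (rule F.subgroup_imp_normal[OF null_subgroup])

lemma null_diff: "\<lbrakk>x \<in> null; y \<in> null\<rbrakk> \<Longrightarrow> x - y \<in> null"
  using subgroup.m_closed[OF null_subgroup, of x "- y"] subgroup.m_inv_closed[OF null_subgroup, of y]
    subgroup.subset[OF null_subgroup] by force

lemma tcl_eq_iff:
  assumes "t \<in> carrier F" "t' \<in> carrier F"
  shows "tcl t = tcl t' \<longleftrightarrow> t - t' \<in> null"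
proof
  assume "tcl t = tcl t'"
  then have "t \<in> tcl t'" using F.rcos_self[OF assms(1) null_subgroup] by (simp add: tensor_class_def)
  then show "t - t' \<in> null" by (auto simp: tensor_class_def r_coset_def)
next
  assume "t - t' \<in> null"
  then have "t \<in> tcl t'" unfolding tensor_class_def r_coset_def by (auto intro!: bexI[of _ "t - t'"])
  then show "tcl t = tcl t'"
    using F.repr_independence[OF _ assms(2) null_subgroup] by (simp add: tensor_class_def)
qed

lemma T_carrier: "carrier T = tcl ` carrier F"
  by (simp add: tensor_module_def Let_def carrier_FactGroup tensor_class_def image_def)

lemma T_zero: "\<zero>\<^bsub>T\<^esub> = tcl 0"
  using F.coset_mult_one[of null] subgroup.subset[OF null_subgroup]
  by (simp add: tensor_module_def Let_def tensor_class_def)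

lemma T_add:
  assumes "t \<in> carrier F" "t' \<in> carrier F"
  shows "tcl t \<oplus>\<^bsub>T\<^esub> tcl t' = tcl (t + t')"
  using normal.rcos_sum[OF null_normal assms]
  by (simp add: tensor_module_def Let_def tensor_class_def)

lemma add_monoid_T:
  "carrier (add_monoid T) = carrier (F Mod null)"
  "x \<otimes>\<^bsub>add_monoid T\<^esub> y = x \<otimes>\<^bsub>F Mod null\<^esub> y"
  "\<one>\<^bsub>add_monoid T\<^esub> = \<one>\<^bsub>F Mod null\<^esub>"
  by (simp_all add: tensor_module_def Let_def)

lemma T_abelian_group: "abelian_group T"
proof -
  interpret Q: comm_group "F Mod null" by (rule F.abelian_FactGroup[OF null_subgroup])
  have "comm_group (add_monoid T)"
    by (rule comm_groupI; unfold add_monoid_T)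
      (simp_all del: mult_FactGroup one_FactGroup add: Q.m_ac Q.l_inv_ex)
  then show ?thesis by (rule comm_group_abelian_groupI)
qed

text \<open>The action of \<open>r\<close> on formal sums of pairs, before passing to the quotient.\<close>

definition lmul :: "'a \<Rightarrow> ('a \<times> 'e \<Rightarrow>\<^sub>0 int) \<Rightarrow> ('a \<times> 'e \<Rightarrow>\<^sub>0 int)" where
  "lmul r = frag_extend (\<lambda>(r', m). frag_of (r \<otimes>\<^bsub>R\<^esub> r', m))"

lemma lmul_carrier: "\<lbrakk>r \<in> carrier R; t \<in> carrier F\<rbrakk> \<Longrightarrow> lmul r t \<in> carrier F"
  using keys_frag_extend[of "\<lambda>(r', m). frag_of (r \<otimes>\<^bsub>R\<^esub> r', m)" t]
  by (fastforce simp: lmul_def)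

lemma lmul_null:
  assumes r: "r \<in> carrier R" and t: "t \<in> null"
  shows "lmul r t \<in> null"
proof -
  have gen: "x \<in> null" if "x \<in> rels" for x
    using that unfolding tensor_null_def by (rule generate.incl)
  have rel: "lmul r x \<in> rels" if "x \<in> rels" for x
    using that
  proof (cases rule: rels_cases)
    case (add_left s s' m)
    then show ?thesis
      using r relsI(1)[of "r \<otimes>\<^bsub>R\<^esub> s" "r \<otimes>\<^bsub>R\<^esub> s'" m] by (simp add: lmul_def frag_extend_diff R.r_distr)
  next
    case (add_right s m m')
    then show ?thesis
      using r relsI(2)[of "r \<otimes>\<^bsub>R\<^esub> s" m m'] by (simp add: lmul_def frag_extend_diff)
  next
    case (balanced s b m)
    then show ?thesis
      using r relsI(3)[of "r \<otimes>\<^bsub>R\<^esub> s" b m] by (simp add: lmul_def frag_extend_diff R.m_assoc iota)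
  qed
  have zero: "0 \<in> null" using subgroup.one_closed[OF null_subgroup] by simp
  show ?thesis
    using t unfolding tensor_null_def
  proof (induction rule: generate.induct)
    case one
    then show ?case using zero by (simp add: lmul_def tensor_null_def)
  next
    case (incl h)
    then show ?case using gen[OF rel] by (simp add: tensor_null_def)
  next
    case (inv h)
    then have "lmul r (inv\<^bsub>F\<^esub> h) = 0 - lmul r h"
      using rels_carrier by (auto simp: lmul_def frag_extend_minus)
    then show ?case using null_diff[OF zero gen[OF rel[OF inv]]] by (simp add: tensor_null_def)
  next
    case (eng h1 h2)
    then show ?case
      using subgroup.m_closed[OF null_subgroup, of "lmul r h1" "lmul r h2"]
      by (simp add: lmul_def frag_extend_add tensor_null_def)
  qed
qed

lemma T_smult:
  assumes r: "r \<in> carrier R" and t: "t \<in> carrier F"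
  shows "r \<odot>\<^bsub>T\<^esub> tcl t = tcl (lmul r t)"
proof -
  have "tcl (lmul r t') = tcl (lmul r t)" if t': "t' \<in> tcl t" for t'
  proof -
    obtain h where h: "h \<in> null" "t' = h + t"
      using t' by (auto simp: tensor_class_def r_coset_def)
    have hc: "h \<in> carrier F" using h subgroup.subset[OF null_subgroup] by blast
    then have t'c: "t' \<in> carrier F" using F.m_closed[OF hc t] h by simp
    have "lmul r t' - lmul r t = lmul r h"
      by (simp add: h lmul_def frag_extend_add)
    then show ?thesis
      using lmul_null[OF r h(1)] tcl_eq_iff[OF lmul_carrier[OF r t'c] lmul_carrier[OF r t]] by simp
  qed
  moreover have "t \<in> tcl t" using F.rcos_self[OF t null_subgroup] by (simp add: tensor_class_def)
  moreover have "r \<odot>\<^bsub>T\<^esub> tcl t = (\<Union>t'\<in>tcl t. tcl (lmul r t'))"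
    by (simp add: tensor_module_def Let_def lmul_def)
  ultimately show ?thesis by (metis (no_types, lifting) SUP_eq_const empty_iff)
qed

abbreviation "pt r m \<equiv> tcl (frag_of (r, m))"

lemma pt_carrier: "\<lbrakk>r \<in> carrier R; m \<in> carrier M\<rbrakk> \<Longrightarrow> pt r m \<in> carrier T"
  unfolding T_carrier by (rule imageI) simp

lemma pt_smult: "\<lbrakk>r \<in> carrier R; r' \<in> carrier R; m \<in> carrier M\<rbrakk> \<Longrightarrow> r \<odot>\<^bsub>T\<^esub> pt r' m = pt (r \<otimes>\<^bsub>R\<^esub> r') m"
  by (subst T_smult) (simp_all add: lmul_def)

lemma pt_balanced:
  assumes "r \<in> carrier R" "b \<in> carrier B" "m \<in> carrier M"
  shows "pt (r \<otimes>\<^bsub>R\<^esub> \<iota> b) m = pt r (b \<odot>\<^bsub>M\<^esub> m)"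
proof -
  have "frag_of (r \<otimes>\<^bsub>R\<^esub> \<iota> b, m) - frag_of (r, b \<odot>\<^bsub>M\<^esub> m) \<in> null"
    unfolding tensor_null_def by (rule generate.incl[OF relsI(3)[OF assms]])
  then show ?thesis by (subst tcl_eq_iff) (use assms iota M_smult in auto)
qed

lemma pt_add_left:
  assumes "r \<in> carrier R" "r' \<in> carrier R" "m \<in> carrier M"
  shows "pt (r \<oplus>\<^bsub>R\<^esub> r') m = pt r m \<oplus>\<^bsub>T\<^esub> pt r' m"
proof -
  have k: "frag_of (r, m) \<in> carrier F" "frag_of (r', m) \<in> carrier F" using assms by auto
  have "frag_of (r \<oplus>\<^bsub>R\<^esub> r', m) - frag_of (r, m) - frag_of (r', m) \<in> null"
    unfolding tensor_null_def by (rule generate.incl[OF relsI(1)[OF assms]])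
  then have "frag_of (r \<oplus>\<^bsub>R\<^esub> r', m) - (frag_of (r, m) + frag_of (r', m)) \<in> null"
    by (simp add: diff_diff_eq)
  moreover have "frag_of (r, m) + frag_of (r', m) \<in> carrier F"
    using F.m_closed[OF k] by simp
  ultimately show ?thesis
    by (subst T_add[OF k], subst tcl_eq_iff) (use assms in auto)
qed

text \<open>Pure tensors generate the tensor product as a group, so a property that is stable under differences
  needs to be checked for them only.\<close>

lemma T_induct [consumes 1, case_names diff pure]:
  assumes x: "x \<in> carrier T"
    and diff: "\<And>x y. \<lbrakk>x \<in> carrier T; y \<in> carrier T; P x; P y\<rbrakk> \<Longrightarrow> P (x \<ominus>\<^bsub>T\<^esub> y)"
    and pure: "\<And>r m. \<lbrakk>r \<in> carrier R; m \<in> carrier M\<rbrakk> \<Longrightarrow> P (pt r m)"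
    and ne: "carrier M \<noteq> {}"
  shows "P x"
proof -
  interpret T: abelian_group T by (rule T_abelian_group)
  have tdiff: "tcl (a - b) = tcl a \<ominus>\<^bsub>T\<^esub> tcl b" if "a \<in> carrier F" "b \<in> carrier F" for a b
  proof -
    have ab: "a - b \<in> carrier F" using that keys_diffI[of a S b] by simp
    have c: "tcl a \<in> carrier T" "tcl b \<in> carrier T" "tcl (a - b) \<in> carrier T"
      using that ab unfolding T_carrier by blast+
    have "tcl (a - b) \<oplus>\<^bsub>T\<^esub> tcl b = tcl a" by (simp add: T_add[OF ab that(2)])
    then show ?thesis using c T.add.inv_solve_right'[of "tcl (a - b)" "tcl a" "tcl b"]
      by (simp add: a_minus_def a_inv_def)
  qed
  obtain m0 where m0: "m0 \<in> carrier M" using ne by blast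
  have "P (tcl t)" if "Poly_Mapping.keys t \<subseteq> S" for t
  proof (rule free_Abelian_group_induct[OF that, of "\<lambda>t. P (tcl t)"], goal_cases)
    case 1
    have p: "pt \<zero>\<^bsub>R\<^esub> m0 \<in> carrier T" "P (pt \<zero>\<^bsub>R\<^esub> m0)" using pt_carrier pure m0 by auto
    have "P (pt \<zero>\<^bsub>R\<^esub> m0 \<ominus>\<^bsub>T\<^esub> pt \<zero>\<^bsub>R\<^esub> m0)" by (rule diff) (use p in auto)
    then show ?case using p by (simp add: T_zero[symmetric] T.r_neg a_minus_def)
  next
    case (2 x y)
    then show ?case using tdiff[of x y] diff[of "tcl x" "tcl y"] unfolding T_carrier by auto
  next
    case (3 a)
    then show ?case using pure by (cases a) auto
  qed
  then show ?thesis using x unfolding T_carrier by auto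
qed

lemma T_left_module:
  assumes ne: "carrier M \<noteq> {}"
  shows "left_module R T"
proof -
  interpret T: abelian_group T by (rule T_abelian_group)
  have sm: "r \<odot>\<^bsub>T\<^esub> x \<in> carrier T" if "r \<in> carrier R" "x \<in> carrier T" for r x
    using that(2) unfolding T_carrier
    using T_smult[OF that(1)] lmul_carrier[OF that(1)] by auto
  have sadd: "r \<odot>\<^bsub>T\<^esub> (x \<oplus>\<^bsub>T\<^esub> y) = r \<odot>\<^bsub>T\<^esub> x \<oplus>\<^bsub>T\<^esub> r \<odot>\<^bsub>T\<^esub> y"
    if r: "r \<in> carrier R" and xy: "x \<in> carrier T" "y \<in> carrier T" for r x y
  proof -
    obtain t t' where t: "t \<in> carrier F" "x = tcl t" "t' \<in> carrier F" "y = tcl t'"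
      using xy unfolding T_carrier by blast
    have c: "t + t' \<in> carrier F" using F.m_closed[OF t(1,3)] by simp
    show ?thesis
      unfolding t T_add[OF t(1,3)] T_smult[OF r t(1)] T_smult[OF r t(3)] T_smult[OF r c]
        T_add[OF lmul_carrier[OF r t(1)] lmul_carrier[OF r t(3)]]
      by (simp add: lmul_def frag_extend_add)
  qed
  have sdiff: "r \<odot>\<^bsub>T\<^esub> (x \<ominus>\<^bsub>T\<^esub> y) = r \<odot>\<^bsub>T\<^esub> x \<ominus>\<^bsub>T\<^esub> r \<odot>\<^bsub>T\<^esub> y"
    if r: "r \<in> carrier R" and xy: "x \<in> carrier T" "y \<in> carrier T" for r x y
  proof -
    have d: "x \<ominus>\<^bsub>T\<^esub> y \<in> carrier T" using xy by simp
    have "(x \<ominus>\<^bsub>T\<^esub> y) \<oplus>\<^bsub>T\<^esub> y = x" using xy by (simp add: a_minus_def T.a_assoc T.l_neg)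
    then have "r \<odot>\<^bsub>T\<^esub> (x \<ominus>\<^bsub>T\<^esub> y) \<oplus>\<^bsub>T\<^esub> r \<odot>\<^bsub>T\<^esub> y = r \<odot>\<^bsub>T\<^esub> x"
      using sadd[OF r d xy(2)] by simp
    then show ?thesis
      using T.add.inv_solve_right'[of "r \<odot>\<^bsub>T\<^esub> (x \<ominus>\<^bsub>T\<^esub> y)" "r \<odot>\<^bsub>T\<^esub> x" "r \<odot>\<^bsub>T\<^esub> y"] sm[OF r] xy d
      by (simp add: a_minus_def a_inv_def)
  qed
  show ?thesis
  proof (intro left_module.intro left_module_axioms.intro R T_abelian_group sm sadd)
    fix a b x assume a: "a \<in> carrier R" and b: "b \<in> carrier R" and x: "x \<in> carrier T"
    show "(a \<oplus>\<^bsub>R\<^esub> b) \<odot>\<^bsub>T\<^esub> x = a \<odot>\<^bsub>T\<^esub> x \<oplus>\<^bsub>T\<^esub> b \<odot>\<^bsub>T\<^esub> x"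
      using x
    proof (induction x rule: T_induct)
      case (diff x y)
      have c: "a \<odot>\<^bsub>T\<^esub> x \<in> carrier T" "b \<odot>\<^bsub>T\<^esub> x \<in> carrier T" "a \<odot>\<^bsub>T\<^esub> y \<in> carrier T" "b \<odot>\<^bsub>T\<^esub> y \<in> carrier T"
        using sm a b diff by auto
      show ?case
        unfolding sdiff[OF R.a_closed[OF a b] diff(1,2)] sdiff[OF a diff(1,2)] sdiff[OF b diff(1,2)] diff(3,4)
        using c by (simp add: a_minus_def T.minus_add T.a_ac)
    qed (use a b ne in \<open>auto simp: pt_smult pt_add_left R.l_distr\<close>)
    show "(a \<otimes>\<^bsub>R\<^esub> b) \<odot>\<^bsub>T\<^esub> x = a \<odot>\<^bsub>T\<^esub> (b \<odot>\<^bsub>T\<^esub> x)"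
      using x by (induction x rule: T_induct) (use a b ne sm in \<open>auto simp: sdiff pt_smult R.m_assoc\<close>)
  next
    fix x assume x: "x \<in> carrier T"
    show "\<one>\<^bsub>R\<^esub> \<odot>\<^bsub>T\<^esub> x = x"
      using x by (induction x rule: T_induct) (use ne in \<open>auto simp: sdiff pt_smult\<close>)
  qed
qed

lemma T_universal:
  assumes G: "comm_group G"
    and f: "\<And>r m. \<lbrakk>r \<in> carrier R; m \<in> carrier M\<rbrakk> \<Longrightarrow> f r m \<in> carrier G"
    and f1: "\<And>r r' m. \<lbrakk>r \<in> carrier R; r' \<in> carrier R; m \<in> carrier M\<rbrakk> \<Longrightarrow>
        f (r \<oplus>\<^bsub>R\<^esub> r') m = f r m \<otimes>\<^bsub>G\<^esub> f r' m"
    and f2: "\<And>r m m'. \<lbrakk>r \<in> carrier R; m \<in> carrier M; m' \<in> carrier M\<rbrakk> \<Longrightarrow>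
        f r (m \<oplus>\<^bsub>M\<^esub> m') = f r m \<otimes>\<^bsub>G\<^esub> f r m'"
    and f3: "\<And>r b m. \<lbrakk>r \<in> carrier R; b \<in> carrier B; m \<in> carrier M\<rbrakk> \<Longrightarrow>
        f (r \<otimes>\<^bsub>R\<^esub> \<iota> b) m = f r (b \<odot>\<^bsub>M\<^esub> m)"
  obtains h where "h \<in> hom (add_monoid T) G"
    "\<And>r m. \<lbrakk>r \<in> carrier R; m \<in> carrier M\<rbrakk> \<Longrightarrow> h (pt r m) = f r m"
proof -
  interpret G: comm_group G by (rule G)
  have im: "(\<lambda>(r, m). f r m) ` S \<subseteq> carrier G" using f by auto
  obtain h where h: "h \<in> hom F G" "\<And>x. x \<in> S \<Longrightarrow> h (frag_of x) = (\<lambda>(r, m). f r m) x"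
    using G.free_Abelian_group_universal[OF im] by metis
  interpret gh: group_hom F G h
    using h(1) by (simp add: group_hom_def group_hom_axioms_def F.group_axioms G.group_axioms)
  have hd: "h (x - y) = h x \<otimes>\<^bsub>G\<^esub> inv\<^bsub>G\<^esub> h y" if "x \<in> carrier F" "y \<in> carrier F" for x y
    using gh.hom_mult[OF that(1), of "- y"] gh.hom_inv[OF that(2)] that by simp
  have fc: "frag_of (r, m) \<in> carrier F" if "r \<in> carrier R" "m \<in> carrier M" for r m
    using that by simp
  have dc: "x - y \<in> carrier F" if "x \<in> carrier F" "y \<in> carrier F" for x y
    using that keys_diffI[of x S y] by simp
  have hf: "h (frag_of (r, m)) = f r m" if "r \<in> carrier R" "m \<in> carrier M" for r m
    using h(2)[of "(r, m)"] that by simp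
  have "rels \<subseteq> kernel F G h"
  proof
    fix x assume x: "x \<in> rels"
    then have "h x = \<one>\<^bsub>G\<^esub>"
    proof (cases rule: rels_cases)
      case add_left
      then show ?thesis
        by (simp add: hd fc dc hf f1 f R.add.m_closed G.m_ac G.inv_solve_right del: carrier_free_Abelian_group_iff)
    next
      case add_right
      then show ?thesis
        by (simp add: hd fc dc hf f2 f M_add G.m_ac G.inv_solve_right del: carrier_free_Abelian_group_iff)
    next
      case balanced
      then show ?thesis
        by (simp add: hd fc hf f3 f M_smult iota del: carrier_free_Abelian_group_iff)
    qed
    then show "x \<in> kernel F G h" unfolding kernel_def using subsetD[OF rels_carrier x] by blast
  qed
  then have k: "null \<subseteq> kernel F G h"
    unfolding tensor_null_def by (rule F.generate_subgroup_incl[OF _ gh.subgroup_kernel])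
  obtain g where g: "g \<in> hom (F Mod null) G" "\<And>x. x \<in> carrier F \<Longrightarrow> g (null #>\<^bsub>F\<^esub> x) = h x"
    using gh.FactGroup_universal_kernel[OF null_normal k] by blast
  show ?thesis
  proof (rule that)
    show "g \<in> hom (add_monoid T) G" using g(1) unfolding hom_def add_monoid_T .
    fix r m assume "r \<in> carrier R" "m \<in> carrier M"
    then show "g (pt r m) = f r m" using g(2)[of "frag_of (r, m)"] hf by (simp add: tensor_class_def)
  qed
qed

end

section \<open>The Cherednik algebra and its modules\<close>

lemma falg_ring_type: "falg_ring = type_ring"
  by (simp add: falg_ring_def)

lemma cher_ideal_ideal: "ideal (cher_ideal n c) type_ring"
  unfolding cher_ideal_def falg_ring_type
  by (rule ring.genideal_ideal[OF ring_type_ring]) simp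

lemma cher_rels_in_ideal: "cher_rels n c \<subseteq> cher_ideal n c"
  unfolding cher_ideal_def falg_ring_type
  by (rule ring.genideal_self[OF ring_type_ring]) simp

lemma Cher_ring: "ring (Cher n c)"
  unfolding Cher_def falg_ring_type by (rule type_quot_ring[OF cher_ideal_ideal])

lemma Cher_carrier: "carrier (Cher n c) = range (cl n c)"
  unfolding Cher_def cl_def falg_ring_type by (rule type_quot_carrier[OF cher_ideal_ideal])

lemma cl_carrier [simp]: "cl n c a \<in> carrier (Cher n c)"
  by (simp add: Cher_carrier)

lemma cl_eq_iff: "cl n c a = cl n c b \<longleftrightarrow> a - b \<in> cher_ideal n c"
  unfolding cl_def falg_ring_type by (rule type_coset_eq_iff[OF cher_ideal_ideal])

lemma cl_ops:
  "cl n c a \<oplus>\<^bsub>Cher n c\<^esub> cl n c b = cl n c (a + b)"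
  "cl n c a \<otimes>\<^bsub>Cher n c\<^esub> cl n c b = cl n c (a * b)"
  "\<one>\<^bsub>Cher n c\<^esub> = cl n c 1"
  "\<zero>\<^bsub>Cher n c\<^esub> = cl n c 0"
  unfolding Cher_def cl_def falg_ring_type by (rule type_quot_ops[OF cher_ideal_ideal])+

lemma scal_add: "scal (a + b) = scal a + scal b"
  by (simp add: scal_def single_add)

lemma scal_mult: "scal (a * b) = scal a * scal b"
  by (simp add: scal_def mult_single)

lemma scal_0 [simp]: "scal 0 = 0"
  by (simp add: scal_def)

lemma scal_1 [simp]: "scal 1 = 1"
  by (simp add: scal_def)

lemma falg_induct [case_names single add]:
  fixes a :: falg
  assumes single: "\<And>w z. P (Poly_Mapping.single w z)"
    and add: "\<And>a b. \<lbrakk>P a; P b\<rbrakk> \<Longrightarrow> P (a + b)"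
  shows "P a"
proof (induction a rule: update_induct)
  case const
  show ?case using single[of 0 0] by simp
next
  case (update f w z)
  have "Poly_Mapping.update w z f = Poly_Mapping.single w z + f"
    by (rule poly_mapping_eqI)
      (use update in \<open>auto simp: lookup_update lookup_add lookup_single when_def in_keys_iff\<close>)
  then show ?case using add[OF single update.IH] by simp
qed

text \<open>Scalars are the multiples of the empty word, hence central in the free algebra.\<close>

lemma scal_commute: "scal z * a = a * scal z"
  by (induction a rule: falg_induct)
     (simp_all add: scal_def mult_single algebra_simps)

context left_module
begin

lemma smult_zero: "a \<in> carrier R \<Longrightarrow> a \<odot>\<^bsub>M\<^esub> \<zero>\<^bsub>M\<^esub> = \<zero>\<^bsub>M\<^esub>"
  using smult_r_distr[of a "\<zero>\<^bsub>M\<^esub>" "\<zero>\<^bsub>M\<^esub>"] smult_closed[of a "\<zero>\<^bsub>M\<^esub>"] M.add.l_cancel_one[of "a \<odot>\<^bsub>M\<^esub> \<zero>\<^bsub>M\<^esub>" "a \<odot>\<^bsub>M\<^esub> \<zero>\<^bsub>M\<^esub>"]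
  by simp

lemma zero_smult: "x \<in> carrier M \<Longrightarrow> \<zero> \<odot>\<^bsub>M\<^esub> x = \<zero>\<^bsub>M\<^esub>"
  using smult_l_distr[of \<zero> \<zero> x] smult_closed[of \<zero> x] M.add.l_cancel_one[of "\<zero> \<odot>\<^bsub>M\<^esub> x" "\<zero> \<odot>\<^bsub>M\<^esub> x"]
  by simp

end

locale cher_module =
  fixes n :: nat and c :: "nat \<Rightarrow> complex" and M :: "(falg set, 'm, 'k) module_scheme"
  assumes left_module: "left_module (Cher n c) M"
begin

sublocale M: left_module "Cher n c" M by (rule left_module)

lemma act_closed: "m \<in> carrier M \<Longrightarrow> act n c M a m \<in> carrier M"
  unfolding act_def by (rule M.smult_closed) simp_all

lemma act_mult: "m \<in> carrier M \<Longrightarrow> act n c M (a * b) m = act n c M a (act n c M b m)"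
  unfolding act_def cl_ops(2)[symmetric] by (rule M.smult_assoc) simp_all

lemma act_add: "m \<in> carrier M \<Longrightarrow> act n c M (a + b) m = act n c M a m \<oplus>\<^bsub>M\<^esub> act n c M b m"
  unfolding act_def cl_ops(1)[symmetric] by (rule M.smult_l_distr) simp_all

lemma act_1: "m \<in> carrier M \<Longrightarrow> act n c M 1 m = m"
  unfolding act_def cl_ops(3)[symmetric] by (rule M.smult_one)

lemma act_0: "m \<in> carrier M \<Longrightarrow> act n c M 0 m = \<zero>\<^bsub>M\<^esub>"
  unfolding act_def cl_ops(4)[symmetric] by (rule M.zero_smult)

lemma act_zero: "act n c M a \<zero>\<^bsub>M\<^esub> = \<zero>\<^bsub>M\<^esub>"
  unfolding act_def by (rule M.smult_zero) simp

end

section \<open>Roots of unity\<close>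

context
  fixes n :: nat
  assumes n: "0 < n"
begin

lemma rootq_power: "rootq n ^ k = exp (of_nat k * (2 * of_real pi * \<i> / of_nat n))"
  unfolding rootq_def by (rule exp_of_nat_mult[symmetric])

lemma rootq_power_n [simp]: "rootq n ^ n = 1"
  using n by (simp add: rootq_power)

lemma rootq_nonzero [simp]: "rootq n \<noteq> 0"
  by (simp add: rootq_def)

lemma rootq_power_eq_1_iff: "rootq n ^ k = 1 \<longleftrightarrow> n dvd k"
proof
  assume "rootq n ^ k = 1"
  then obtain l :: int where "Im (of_nat k * (2 * of_real pi * \<i> / of_nat n)) = of_int (2 * l) * pi"
    unfolding rootq_power exp_eq_1 by blast
  moreover have "of_nat k * (2 * of_real pi * \<i> / of_nat n) = \<i> * of_real (real k * 2 * pi / real n)"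
    by (simp add: field_simps)
  ultimately have "real k * 2 * pi / real n = of_int (2 * l) * pi"
    by simp
  then have "real k = of_int l * real n" using n by (simp add: field_simps)
  then have "int k = l * int n" by (metis of_int_eq_iff of_int_mult of_int_of_nat_eq)
  then have "int n dvd int k" by simp
  then show "n dvd k" by simp
next
  assume "n dvd k"
  then show "rootq n ^ k = 1" by (auto elim!: dvdE simp: power_mult)
qed

lemma rootq_orthogonality:
  "(\<Sum>m<n. (rootq n ^ k) ^ m) = (if n dvd k then of_nat n else 0)"
proof (cases "n dvd k")
  case False
  then have 1: "rootq n ^ k \<noteq> 1" by (simp add: rootq_power_eq_1_iff)
  have "(rootq n ^ k) ^ n = 1" by (metis mult.commute power_mult power_one rootq_power_n)
  then show ?thesis using False geometric_sum[OF 1, of n] by simp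
next
  case True
  then have "rootq n ^ k = 1" by (simp add: rootq_power_eq_1_iff)
  then show ?thesis using True by simp
qed

end

section \<open>The Cherednik algebra as Dunkl operators on vector-valued functions\<close>

text \<open>The functions \<open>u\<close> from \<open>\<complex>\<^sup>\<times>\<close> to \<open>\<complex>\<^sup>n\<close> on which the Cherednik algebra will act; \<open>u b k\<close> is the
  coordinate \<open>k\<close> of the value at \<open>b\<close>.\<close>

type_synonym mfun = "complex \<Rightarrow> nat \<Rightarrow> complex"

locale cyclic_cher =
  fixes n :: nat and c :: "nat \<Rightarrow> complex"
  assumes n2: "2 \<le> n" and cn: "c n = 0"
begin

lemma n0: "0 < n" using n2 by simp

abbreviation "q \<equiv> rootq n"
lemmas q_n [simp] = rootq_power_n[OF n0]
lemmas q_nz [simp] = rootq_nonzero[OF n0]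

text \<open>The eigenvalues of the residue matrix \<open>A = bidiag n ev\<close>; \<open>ev k\<close> is the eigenvalue \<open>- c\<^sub>n\<^sub>-\<^sub>k\<close> of
  \<open>eu\<close> on the lowest vector of the standard module of \<open>E\<^sub>n\<^sub>-\<^sub>k\<close>, minus the degree \<open>- k\<close> in which this
  module starts inside \<open>\<Delta>\<close>.\<close>

definition ev :: "nat \<Rightarrow> complex" where "ev k = of_nat k - c (n - k)"

text \<open>The operators by which \<open>x\<close>, \<open>s\<close>, \<open>eu\<close>, \<open>\<epsilon>\<^sub>i\<close>, \<open>z\<close> and \<open>\<xi>\<close> act.  The choice of \<open>eu\<close> as
  \<open>b d/db + A\<close> determines \<open>\<xi> = x\<^sup>-\<^sup>1 (eu + z)\<close>.\<close>

definition mX :: "mfun \<Rightarrow> mfun" where "mX u b k = b * u b k"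
definition mS :: "mfun \<Rightarrow> mfun" where "mS u b k = u (b / q) k"
definition mEu :: "mfun \<Rightarrow> mfun" where
  "mEu u b k = (if b = 0 then 0 else b * deriv (\<lambda>y. u y k) b + bidiag n ev (u b) k)"
definition mep :: "nat \<Rightarrow> mfun \<Rightarrow> mfun" where
  "mep i u b k = 1 / of_nat n * (\<Sum>m<n. q ^ (m * i) * u (b / q ^ m) k)"
definition mZ :: "mfun \<Rightarrow> mfun" where
  "mZ u b k = (\<Sum>i\<in>{1..n-1}. c i * mep i u b k)"
definition mXi :: "mfun \<Rightarrow> mfun" where
  "mXi u b k = (mEu u b k + mZ u b k) / b"

definition mlin :: "complex \<Rightarrow> mfun \<Rightarrow> complex \<Rightarrow> mfun \<Rightarrow> mfun" where
  "mlin x u y v = (\<lambda>b k. x * u b k + y * v b k)"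

text \<open>The value at \<open>0\<close> is fixed to be \<open>0\<close>, so that two functions are equal as soon as they agree on \<open>\<complex>\<^sup>\<times>\<close>.
  The operators above respect this; for \<open>mXi\<close> the reason is \<open>y / 0 = 0\<close>.\<close>

definition Lfun :: "mfun set" where
  "Lfun = {u. u 0 = (\<lambda>k. 0) \<and> (\<forall>b. u b \<in> fin_vecs n) \<and> (\<forall>k. (\<lambda>b. u b k) holomorphic_on - {0})}"

lemma open_cstar: "open (- {0::complex})"
  by (simp add: open_Compl)

lemma Lfun_deriv:
  "\<lbrakk>u \<in> Lfun; b \<noteq> 0\<rbrakk> \<Longrightarrow> ((\<lambda>b. u b k) has_field_derivative deriv (\<lambda>b. u b k) b) (at b)"
  unfolding Lfun_def using holomorphic_derivI[OF _ open_cstar] by auto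

lemma mlin_Lfun: "\<lbrakk>u \<in> Lfun; v \<in> Lfun\<rbrakk> \<Longrightarrow> mlin x u y v \<in> Lfun"
  by (auto simp: Lfun_def mlin_def fin_vecs_def intro!: holomorphic_intros)

lemma zero_Lfun: "(\<lambda>b k. 0) \<in> Lfun"
  by (auto simp: Lfun_def fin_vecs_def)

lemma mX_Lfun: "u \<in> Lfun \<Longrightarrow> mX u \<in> Lfun"
  by (auto simp: Lfun_def mX_def fin_vecs_def intro!: holomorphic_intros)

lemma dilate_holo:
  assumes "(\<lambda>b. u b k) holomorphic_on - {0}" "z \<noteq> 0"
  shows "(\<lambda>b. u (b / z) k) holomorphic_on - {0}"
proof -
  have "((\<lambda>b. u b k) \<circ> (\<lambda>b. b / z)) holomorphic_on - {0}"
    by (rule holomorphic_on_compose_gen[OF _ assms(1)]) (use assms(2) in \<open>auto intro!: holomorphic_intros\<close>)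
  then show ?thesis by (simp add: o_def)
qed

lemma mS_Lfun: "u \<in> Lfun \<Longrightarrow> mS u \<in> Lfun"
  by (auto simp: Lfun_def mS_def fin_vecs_def intro!: dilate_holo)

lemma mep_Lfun: "u \<in> Lfun \<Longrightarrow> mep i u \<in> Lfun"
  by (auto simp: Lfun_def mep_def fin_vecs_def intro!: holomorphic_intros dilate_holo)

lemma mZ_Lfun: "u \<in> Lfun \<Longrightarrow> mZ u \<in> Lfun"
  using mep_Lfun[of u] by (auto simp: Lfun_def mZ_def fin_vecs_def intro!: holomorphic_intros)

lemma mEu_Lfun:
  assumes "u \<in> Lfun" shows "mEu u \<in> Lfun"
proof -
  have d: "deriv (\<lambda>y. u y k) b = 0" if "k \<ge> n" for k b
    using assms that by (simp add: Lfun_def fin_vecs_def)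
  have h: "(\<lambda>b. u b k) holomorphic_on - {0}" for k
    using assms by (simp add: Lfun_def)
  have "(\<lambda>b. bidiag n ev (u b) k) holomorphic_on - {0}" for k
    unfolding bidiag_def by (cases "k < n"; cases "k = 0") (auto intro!: holomorphic_intros h)
  then have "(\<lambda>b. b * deriv (\<lambda>y. u y k) b + bidiag n ev (u b) k) holomorphic_on - {0}" for k
    by (intro holomorphic_intros h open_cstar)
  then have "(\<lambda>b. mEu u b k) holomorphic_on - {0}" for k
    by (rule holomorphic_transform) (simp add: mEu_def)
  then show ?thesis using d by (auto simp: Lfun_def mEu_def fin_vecs_def bidiag_def)
qed

lemma mXi_Lfun: "u \<in> Lfun \<Longrightarrow> mXi u \<in> Lfun"
  using mEu_Lfun[of u] mZ_Lfun[of u]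
  by (auto simp: Lfun_def mXi_def fin_vecs_def intro!: holomorphic_intros)

lemma mX_mlin: "mX (mlin x u y v) = mlin x (mX u) y (mX v)"
  by (intro ext) (simp add: mX_def mlin_def algebra_simps)

lemma mS_mlin: "mS (mlin x u y v) = mlin x (mS u) y (mS v)"
  by (intro ext) (simp add: mS_def mlin_def algebra_simps)

lemma mep_mlin: "mep i (mlin x u y v) = mlin x (mep i u) y (mep i v)"
  by (intro ext) (simp add: mep_def mlin_def algebra_simps sum.distrib sum_distrib_left)

lemma mZ_mlin: "mZ (mlin x u y v) = mlin x (mZ u) y (mZ v)"
  by (intro ext) (simp add: mZ_def mep_mlin, simp add: mZ_def mlin_def algebra_simps sum.distrib sum_distrib_left)

lemma mEu_mlin:
  assumes "u \<in> Lfun" "v \<in> Lfun"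
  shows "mEu (mlin x u y v) = mlin x (mEu u) y (mEu v)"
proof (intro ext)
  fix b k
  have "deriv (\<lambda>b. mlin x u y v b k) b = x * deriv (\<lambda>b. u b k) b + y * deriv (\<lambda>b. v b k) b"
    if "b \<noteq> 0"
    unfolding mlin_def
    by (rule DERIV_imp_deriv) (auto intro!: derivative_eq_intros Lfun_deriv assms that)
  moreover have "bidiag n ev (mlin x u y v b) k = x * bidiag n ev (u b) k + y * bidiag n ev (v b) k"
    by (simp add: bidiag_def mlin_def algebra_simps)
  ultimately show "mEu (mlin x u y v) b k = mlin x (mEu u) y (mEu v) b k"
    by (simp add: mEu_def mlin_def[of x "mEu u"] algebra_simps)
qed

lemma mXi_mlin:
  "\<lbrakk>u \<in> Lfun; v \<in> Lfun\<rbrakk> \<Longrightarrow> mXi (mlin x u y v) = mlin x (mXi u) y (mXi v)"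
  by (intro ext) (simp add: mXi_def mEu_mlin mZ_mlin, simp add: mXi_def mlin_def algebra_simps add_divide_distrib)

fun gop :: "gen \<Rightarrow> mfun \<Rightarrow> mfun" where
  "gop Gx = mX"
| "gop Gxi = mXi"
| "gop Gs = mS"

text \<open>The action of words and of the free algebra, before the relations are known to act by \<open>0\<close>.\<close>

definition wop :: "gen list \<Rightarrow> mfun \<Rightarrow> mfun" where
  "wop w u = foldr gop w u"

definition mop :: "falg \<Rightarrow> mfun \<Rightarrow> mfun" where
  "mop a u = (\<lambda>b k. \<Sum>w\<in>Poly_Mapping.keys a. Poly_Mapping.lookup a w * wop (letters w) u b k)"

lemma gop_Lfun: "u \<in> Lfun \<Longrightarrow> gop g u \<in> Lfun"
  by (cases g) (auto simp: mX_Lfun mXi_Lfun mS_Lfun)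

lemma gop_mlin: "\<lbrakk>u \<in> Lfun; v \<in> Lfun\<rbrakk> \<Longrightarrow> gop g (mlin x u y v) = mlin x (gop g u) y (gop g v)"
  by (cases g) (auto simp: mX_mlin mXi_mlin mS_mlin)

lemma wop_Lfun: "u \<in> Lfun \<Longrightarrow> wop w u \<in> Lfun"
  unfolding wop_def by (induction w) (auto intro: gop_Lfun)

lemma wop_mlin: "\<lbrakk>u \<in> Lfun; v \<in> Lfun\<rbrakk> \<Longrightarrow> wop w (mlin x u y v) = mlin x (wop w u) y (wop w v)"
proof (induction w)
  case (Cons g w)
  then show ?case using gop_mlin wop_Lfun[of u w] wop_Lfun[of v w] by (simp add: wop_def)
qed (simp add: wop_def)

lemma mop_superset:
  assumes "finite A" "Poly_Mapping.keys a \<subseteq> A"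
  shows "mop a u b k = (\<Sum>w\<in>A. Poly_Mapping.lookup a w * wop (letters w) u b k)"
  unfolding mop_def
  by (rule sum.mono_neutral_left) (use assms in \<open>auto simp: in_keys_iff\<close>)

lemma mop_single: "mop (Poly_Mapping.single w z) u = (\<lambda>b k. z * wop (letters w) u b k)"
  by (intro ext) (subst mop_superset[of "{w}"], auto)

lemma mop_0 [simp]: "mop 0 u = (\<lambda>b k. 0)"
  by (simp add: mop_def)

lemma mop_add: "mop (a + b) u = mlin 1 (mop a u) 1 (mop b u)"
proof (intro ext)
  fix y k
  let ?A = "Poly_Mapping.keys a \<union> Poly_Mapping.keys b"
  have "Poly_Mapping.keys (a + b) \<subseteq> ?A" by (rule keys_add)
  then show "mop (a + b) u y k = mlin 1 (mop a u) 1 (mop b u) y k"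
    by (simp add: mop_superset[of ?A] mlin_def lookup_add sum.distrib algebra_simps)
qed

lemma mop_uminus: "mop (- a) u = mlin (- 1) (mop a u) 0 (mop a u)"
  by (intro ext) (simp add: mop_def mlin_def sum_negf)

lemma mop_diff: "mop (a - b) u = mlin 1 (mop a u) (- 1) (mop b u)"
  using mop_add[of a "- b" u] by (simp add: mop_uminus mlin_def)

lemma mop_sum: "mop (\<Sum>i\<in>A. f i) u = (\<lambda>b k. \<Sum>i\<in>A. mop (f i) u b k)"
proof (cases "finite A")
  case True
  then show ?thesis by (induction A) (simp_all add: mop_add mlin_def)
qed simp

lemma mop_Lfun: "u \<in> Lfun \<Longrightarrow> mop a u \<in> Lfun"
proof (induction a rule: falg_induct)
  case (single w z)
  have "mlin z (wop (letters w) u) 0 (wop (letters w) u) \<in> Lfun"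
    using single by (intro mlin_Lfun wop_Lfun)
  then show ?case by (simp add: mop_single mlin_def)
qed (simp add: mop_add mlin_Lfun)

lemma mop_mlin: "\<lbrakk>u \<in> Lfun; v \<in> Lfun\<rbrakk> \<Longrightarrow> mop a (mlin x u y v) = mlin x (mop a u) y (mop a v)"
  by (intro ext) (simp add: mop_def wop_mlin, simp add: mlin_def sum.distrib sum_distrib_left algebra_simps)

lemma mop_mult:
  assumes u: "u \<in> Lfun"
  shows "mop (a * b) u = mop a (mop b u)"
proof (induction a rule: falg_induct)
  case (single w z)
  show ?case
  proof (induction b rule: falg_induct)
    case (single w' z')
    have "wop (letters w) (mlin z' (wop (letters w') u) 0 (wop (letters w') u))
       = mlin z' (wop (letters w) (wop (letters w') u)) 0 (wop (letters w) (wop (letters w') u))"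
      by (rule wop_mlin) (simp_all add: wop_Lfun u)
    then show ?case
      by (simp add: mult_single mop_single plus_gword_def wop_def mlin_def mult.assoc)
  next
    case (add b b')
    then show ?case
      by (simp add: distrib_left mop_add mop_mlin mop_Lfun u)
  qed
next
  case (add a a')
  then show ?case by (simp add: distrib_right mop_add)
qed

lemma mop_gens:
  "mop genx u = mX u" "mop genxi u = mXi u" "mop gens u = mS u"
  "mop (scal z) u = (\<lambda>b k. z * u b k)" "mop 1 u = u"
  unfolding scal_1[symmetric]
  by (simp_all add: genx_def genxi_def gens_def scal_def mop_single wop_def zero_gword_def)

lemma mop_gens_power: "u \<in> Lfun \<Longrightarrow> mop (gens ^ m) u = (\<lambda>b k. u (b / q ^ m) k)"
proof (induction m)
  case (Suc m)
  then show ?case by (simp add: mop_mult mop_gens mS_def)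
qed (simp add: mop_gens)

lemma mop_eps: "u \<in> Lfun \<Longrightarrow> mop (eps n i) u = mep i u"
  by (intro ext) (simp add: eps_def mop_mult mop_gens mop_sum mop_gens_power mop_Lfun mep_def)

lemma mop_zel: "u \<in> Lfun \<Longrightarrow> mop (zel n c) u = mZ u"
  by (intro ext) (simp add: zel_def mop_mult mop_gens mop_sum mop_eps mop_Lfun mZ_def)

lemma mop_eu:
  assumes "u \<in> Lfun" shows "mop (eu n c) u = mEu u"
proof (intro ext)
  fix b k
  have "mZ u 0 k = 0" "mEu u 0 k = 0"
    using mZ_Lfun[OF assms] mEu_Lfun[OF assms] by (auto simp: Lfun_def)
  then show "mop (eu n c) u b k = mEu u b k"
    using assms
    by (cases "b = 0")
       (simp_all add: eu_def mop_diff mop_mult mop_gens mop_zel mlin_def mX_def mXi_def)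
qed

lemma c_per_Suc: "i < n \<Longrightarrow> c_per n c (int i + 1) = c (Suc i)"
  by (simp add: c_per_def)

lemma c_per_nat: "i < n \<Longrightarrow> c_per n c (int i) = (if i = 0 then 0 else c i)"
proof (cases "i = 0")
  case True
  have "(- 1 :: int) mod int n = int n - 1" using n2 by (simp add: zmod_minus1)
  then show ?thesis using True n2 cn by (simp add: c_per_def nat_diff_distrib)
next
  case False
  assume "i < n"
  have "int i - 1 = int (i - 1)" using False by simp
  then show ?thesis using False \<open>i < n\<close>
    by (simp add: c_per_def nat_mod_distrib del: of_nat_diff)
qed

text \<open>This is \<open>\<epsilon>\<^sub>i x = x \<epsilon>\<^sub>i\<^sub>-\<^sub>1\<close>.\<close>

lemma mep_mX: "i \<ge> 1 \<Longrightarrow> mep i (mX u) b k = b * mep (i - 1) u b k"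
proof -
  assume i: "i \<ge> 1"
  have "q ^ (m * i) * (b / q ^ m * u (b / q ^ m) k) = b * (q ^ (m * (i - 1)) * u (b / q ^ m) k)" for m
  proof -
    have "q ^ (m * i) = q ^ (m * (i - 1)) * q ^ m"
      using i by (simp add: power_add[symmetric] algebra_simps diff_mult_distrib2)
    then show ?thesis by simp
  qed
  then show ?thesis by (simp add: mep_def mX_def sum_distrib_left)
qed

text \<open>As \<open>[eu, x] = x\<close> for the operators, \<open>\<xi> x - x \<xi> = x\<^sup>-\<^sup>1 (x + x eu + z x) - (eu + z)\<close>, which is
  \<open>1 + x\<^sup>-\<^sup>1 z x - z\<close>; and \<open>x\<^sup>-\<^sup>1 z x\<close> is \<open>z\<close> with the index of the idempotents shifted by one.\<close>

lemma mop_commutator: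
  assumes u: "u \<in> Lfun"
  shows "mop (genxi * genx - genx * genxi
     - (1 + (\<Sum>i<n. scal (c_per n c (int i + 1) - c_per n c (int i)) * eps n i))) u = (\<lambda>b k. 0)"
proof (intro ext)
  fix b k
  note L = u mX_Lfun[OF u] mXi_Lfun[OF u] mop_Lfun[OF u]
  have 0: "v 0 k = 0" if "v \<in> Lfun" for v using that by (simp add: Lfun_def)
  have z: "(\<Sum>i<n. (c_per n c (int i + 1) - c_per n c (int i)) * mep i u b k)
       = (\<Sum>i<n. c (Suc i) * mep i u b k) - mZ u b k"
  proof -
    have "(\<Sum>i<n. c_per n c (int i) * mep i u b k) = (\<Sum>i\<in>{1..n-1}. c i * mep i u b k)"
      by (rule sum.mono_neutral_cong_right) (use n2 in \<open>auto simp: c_per_nat\<close>)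
    moreover have "(\<Sum>i<n. c_per n c (int i + 1) * mep i u b k) = (\<Sum>i<n. c (Suc i) * mep i u b k)"
      by (rule sum.cong) (auto simp: c_per_Suc)
    ultimately show ?thesis
      by (simp add: left_diff_distrib sum_subtractf mZ_def)
  qed
  have zX: "mZ (mX u) b k = b * (\<Sum>i<n. c (Suc i) * mep i u b k)"
  proof -
    have "mZ (mX u) b k = b * (\<Sum>i\<in>{1..n-1}. c i * mep (i - 1) u b k)"
      by (simp add: mZ_def mep_mX sum_distrib_left mult.left_commute)
    also have "(\<Sum>i\<in>{1..n-1}. c i * mep (i - 1) u b k) = (\<Sum>i<n. c (Suc i) * mep i u b k)"
      by (rule sum.reindex_bij_witness_not_neutral[where S' = "{}" and T' = "{n - 1}" and i = Suc and j = "\<lambda>i. i - 1"])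
         (use n2 cn in auto)
    finally show ?thesis .
  qed
  have e: "mEu (mX u) b k = b * u b k + b * mEu u b k" if "b \<noteq> 0"
  proof -
    have "deriv (\<lambda>b. mX u b k) b = u b k + b * deriv (\<lambda>b. u b k) b"
      unfolding mX_def
      by (rule DERIV_imp_deriv) (auto intro!: derivative_eq_intros Lfun_deriv u that)
    then show ?thesis using that by (simp add: mEu_def bidiag_def, simp add: mX_def algebra_simps)
  qed
  show "mop (genxi * genx - genx * genxi
     - (1 + (\<Sum>i<n. scal (c_per n c (int i + 1) - c_per n c (int i)) * eps n i))) u b k = 0"
  proof (cases "b = 0")
    case True
    then show ?thesis using 0[OF mop_Lfun[OF u]] by simp
  next
    case False
    have "mXi (mX u) b k - mX (mXi u) b k = u b k + ((\<Sum>i<n. c (Suc i) * mep i u b k) - mZ u b k)"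
      using False by (simp add: mXi_def[of "mX u"] e zX mX_def[of "mXi u"] mXi_def[of u] field_simps)
    then show ?thesis
      using L by (simp add: mop_diff mop_add mop_mult mop_sum mop_gens mop_eps mlin_def z)
  qed
qed

text \<open>The operators \<open>eu\<close> and \<open>z\<close> commute with the rotation \<open>b \<mapsto> q b\<close>, so \<open>s \<xi> s\<^sup>-\<^sup>1\<close> differs from \<open>\<xi>\<close> only
  through the factor \<open>x\<^sup>-\<^sup>1\<close>.  The inverse of \<open>s\<close> is written as \<open>s\<^sup>n\<^sup>-\<^sup>1\<close>.\<close>

lemma mop_rel_Xi:
  assumes u: "u \<in> Lfun"
  shows "mop (gens * genxi * gens ^ (n - 1) - scal q * genxi) u = (\<lambda>b k. 0)"
proof (intro ext)
  fix b k
  define v where "v = (\<lambda>b k. u (b / q ^ (n - 1)) k)"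
  have qi: "1 / q ^ (n - 1) = q"
  proof -
    have "q ^ (n - 1) * q = q ^ n" using n2 by (metis One_nat_def Suc_pred n0 power_Suc2)
    then show ?thesis by (simp add: field_simps)
  qed
  have v: "v = (\<lambda>b k. u (b * q) k)" unfolding v_def
    by (intro ext) (metis qi times_divide_eq_right mult.right_neutral)
  have vL: "v \<in> Lfun" unfolding v_def using mop_Lfun[OF u, of "gens ^ (n - 1)"] by (simp add: mop_gens_power u)
  have "mop (gens * genxi * gens ^ (n - 1)) u b k = mXi v (b / q) k"
  proof -
    have "mop (gens ^ (n - 1)) u = v" unfolding v_def by (rule mop_gens_power[OF u])
    then show ?thesis unfolding mult.assoc mop_mult[OF u] by (simp only: mop_gens mS_def)
  qed
  also have "\<dots> = q * mXi u b k"
  proof -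
    have "mep i v (b / q) k = mep i u b k" for i
      by (simp add: mep_def v field_simps)
    then have z: "mZ v (b / q) k = mZ u b k" by (simp add: mZ_def)
    have "deriv (\<lambda>b. v b k) (b / q) = q * deriv (\<lambda>b. u b k) b" if "b \<noteq> 0"
    proof (rule DERIV_imp_deriv)
      have "((\<lambda>b. u b k) has_field_derivative deriv (\<lambda>b. u b k) b) (at ((b / q) * q))"
        using Lfun_deriv[OF u that, of k] by simp
      then have "((\<lambda>b. u (b * q) k) has_field_derivative deriv (\<lambda>b. u b k) b * q) (at (b / q))"
        by (rule DERIV_chain2) (auto intro!: derivative_eq_intros)
      then show "((\<lambda>b. v b k) has_field_derivative q * deriv (\<lambda>b. u b k) b) (at (b / q))"
        by (simp add: v mult.commute)
    qed
    then have "mEu v (b / q) k = mEu u b k"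
      by (simp add: mEu_def v)
    then show ?thesis by (simp add: mXi_def z)
  qed
  finally show "mop (gens * genxi * gens ^ (n - 1) - scal q * genxi) u b k = 0"
    using u by (simp add: mop_diff mop_mult mop_gens mlin_def mXi_Lfun)
qed

lemma mop_rel_X:
  assumes u: "u \<in> Lfun"
  shows "mop (gens * genx * gens ^ (n - 1) - scal (inverse q) * genx) u = (\<lambda>b k. 0)"
proof (intro ext)
  fix b k
  have "b / q / q ^ (n - 1) = b / q ^ n" using n2
    by (simp add: power_Suc[symmetric] del: power_Suc)
  then have e: "b / q / q ^ (n - 1) = b" by simp
  have "mop (gens * genx * gens ^ (n - 1)) u b k = b / q * u (b / q / q ^ (n - 1)) k"
    unfolding mult.assoc mop_mult[OF u] mop_gens_power[OF u] mop_gens by (simp only: mS_def mX_def)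
  then show "mop (gens * genx * gens ^ (n - 1) - scal (inverse q) * genx) u b k = 0"
    unfolding e using u by (simp add: mop_diff mop_mult[OF u, of "scal _"] mop_gens mlin_def mX_def divide_inverse mult.commute)
qed

text \<open>The elements of the free algebra that act by \<open>0\<close> form an ideal, and it contains the relations.\<close>

lemma mop_ideal:
  assumes "a \<in> cher_ideal n c" "u \<in> Lfun"
  shows "mop a u = (\<lambda>b k. 0)"
proof -
  define K where "K = {a. \<forall>u\<in>Lfun. mop a u = (\<lambda>b k. 0)}"
  have zero: "mop r (\<lambda>b k. 0) = (\<lambda>b k. 0)" for r
    using mop_mlin[OF zero_Lfun zero_Lfun, of r 0 0] by (simp add: mlin_def)
  have K: "ideal K type_ring"
    unfolding ideal_type_ring_iff
    by (auto simp: K_def mop_add mop_mult mlin_def zero mop_Lfun)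
  have "cher_rels n c \<subseteq> K"
  proof -
    have "gens ^ n - 1 \<in> K"
      by (simp add: K_def mop_diff mop_gens mop_gens_power mlin_def)
    moreover have "gens * genxi * gens ^ (n - 1) - scal q * genxi \<in> K"
      unfolding K_def using mop_rel_Xi by blast
    moreover have "gens * genx * gens ^ (n - 1) - scal (inverse q) * genx \<in> K"
      unfolding K_def using mop_rel_X by blast
    moreover have "genxi * genx - genx * genxi
        - (1 + (\<Sum>i<n. scal (c_per n c (int i + 1) - c_per n c (int i)) * eps n i)) \<in> K"
      unfolding K_def using mop_commutator by blast
    ultimately show ?thesis
      unfolding cher_rels_def by (simp only: insert_subset empty_subsetI simp_thms)
  qed
  then have "cher_ideal n c \<subseteq> K"
    unfolding cher_ideal_def falg_ring_type
    by (intro ring.genideal_minimal[OF ring_type_ring K])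
  then show ?thesis using assms by (auto simp: K_def)
qed

end

lemma scal_left_commute: "a * (scal z * b) = scal z * (a * b)"
  by (metis mult.assoc scal_commute)

section \<open>Evaluation of polynomials in the free algebra\<close>

text \<open>The element \<open>p(z)\<close> of the free algebra, for \<open>z\<close> in the free algebra.\<close>

definition fev :: "falg \<Rightarrow> complex poly \<Rightarrow> falg" where
  "fev z p = (\<Sum>i\<le>degree p. scal (coeff p i) * z ^ i)"

lemma fev_degree_le: "degree p \<le> N \<Longrightarrow> fev z p = (\<Sum>i\<le>N. scal (coeff p i) * z ^ i)"
  unfolding fev_def by (rule sum.mono_neutral_left) (auto simp: coeff_eq_0)

lemma fev_0 [simp]: "fev z 0 = 0"
  by (simp add: fev_def)

lemma fev_pCons: "fev z (pCons x p) = scal x + z * fev z p"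
proof -
  have "fev z (pCons x p) = (\<Sum>i\<le>Suc (degree p). scal (coeff (pCons x p) i) * z ^ i)"
    by (rule fev_degree_le) (rule degree_pCons_le)
  also have "\<dots> = scal x + (\<Sum>i\<le>degree p. scal (coeff p i) * z ^ Suc i)"
    unfolding sum.atMost_Suc_shift by simp
  also have "(\<Sum>i\<le>degree p. scal (coeff p i) * z ^ Suc i) = z * fev z p"
    unfolding fev_def sum_distrib_left
    by (rule sum.cong) (simp, metis mult.assoc power_Suc scal_commute)
  finally show ?thesis .
qed

lemma fev_1 [simp]: "fev z 1 = 1"
  by (simp add: fev_def)

lemma fev_add: "fev z (p + p') = fev z p + fev z p'"
proof -
  let ?N = "max (degree p) (degree p')"
  have "degree (p + p') \<le> ?N" by (rule degree_add_le_max)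
  then show ?thesis
    by (simp add: fev_degree_le[of _ ?N] scal_add sum.distrib algebra_simps)
qed

lemma fev_smult: "fev z (Polynomial.smult x p) = scal x * fev z p"
proof -
  have "degree (Polynomial.smult x p) \<le> degree p" by (rule degree_smult_le)
  then show ?thesis
    by (simp add: fev_degree_le[of _ "degree p"] sum_distrib_left scal_mult mult.assoc)
qed

lemma fev_mult: "fev z (p * p') = fev z p * fev z p'"
  by (induction p) (simp_all add: fev_pCons fev_add fev_smult algebra_simps)

lemma fev_sum: "fev z (\<Sum>i\<in>A. f i) = (\<Sum>i\<in>A. fev z (f i))"
  by (induction A rule: infinite_finite_induct) (simp_all add: fev_add)

lemma fev_monom: "fev z (monom x i) = scal x * z ^ i"
proof -
  have "degree (monom x i) \<le> i" by (rule degree_monom_le)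
  then show ?thesis
    by (subst fev_degree_le[of _ i]) (auto simp: coeff_monom if_distrib[of scal] if_distrib[of "\<lambda>x. x * _"] cong: if_cong)
qed

section \<open>The coinvariant algebra\<close>

text \<open>The class of a polynomial in the coinvariant algebra.\<close>

abbreviation pcl :: "nat \<Rightarrow> complex poly \<Rightarrow> complex poly set" where
  "pcl n p \<equiv> coinv_ideal n +>\<^bsub>poly_ring\<^esub> p"

lemma poly_ring_type: "poly_ring = type_ring"
  by (simp add: poly_ring_def)

lemma cgenideal_poly: "PIdl\<^bsub>poly_ring\<^esub> f = {p. f dvd p}"
  by (auto simp: cgenideal_def poly_ring_type dvd_def mult.commute)

lemma dvd_ideal: "ideal {p::complex poly. f dvd p} type_ring"
  unfolding ideal_type_ring_iff by auto

lemma coinv_ideal_eq: "coinv_ideal n = {p. monom 1 n dvd p}"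
  by (simp add: coinv_ideal_def cgenideal_poly)

lemma coinv_ideal_ideal: "ideal (coinv_ideal n) type_ring"
  unfolding coinv_ideal_eq by (rule dvd_ideal)

lemma pcl_eq_iff: "pcl n p = pcl n p' \<longleftrightarrow> monom 1 n dvd p - p'"
  unfolding poly_ring_type type_coset_eq_iff[OF coinv_ideal_ideal] by (simp add: coinv_ideal_eq)

lemma coinv_carrier: "carrier (coinv_module n) = range (pcl n)"
  unfolding coinv_module_def Let_def coinv_alg_def poly_ring_type
  by (simp add: type_quot_carrier[OF coinv_ideal_ideal])

lemma coinv_add: "pcl n p \<oplus>\<^bsub>coinv_module n\<^esub> pcl n p' = pcl n (p + p')"
  unfolding coinv_module_def Let_def coinv_alg_def poly_ring_type
  by (simp add: type_quot_ops[OF coinv_ideal_ideal])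

lemma s_poly_diff: "s_poly n k (p - p') = s_poly n k p - s_poly n k p'"
  by (simp add: s_poly_def pcompose_diff)

lemma s_poly_mult: "s_poly n k (p * p') = s_poly n k p * s_poly n k p'"
  by (simp add: s_poly_def pcompose_mult)

lemma s_poly_1 [simp]: "s_poly n k 1 = 1"
  by (simp add: s_poly_def one_pCons)

lemma s_poly_0 [simp]: "s_poly n k 0 = 0"
  by (simp add: s_poly_def)

lemma s_poly_pCons: "s_poly n k (pCons x p) = pCons x (Polynomial.smult (rootq n ^ k) (s_poly n k p))"
  by (simp add: s_poly_def pcompose_pCons)

lemma s_poly_monom: "s_poly n k (monom 1 m) = Polynomial.smult (rootq n ^ (k * m)) (monom 1 m)"
  by (induction m) (simp_all add: monom_Suc s_poly_pCons power_add algebra_simps)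

lemma coinv_smult: "a \<odot>\<^bsub>coinv_module n\<^esub> pcl n p = pcl n (\<Sum>k<n. a k * s_poly n k p)"
proof -
  have "pcl n (\<Sum>k<n. a k * s_poly n k p') = pcl n (\<Sum>k<n. a k * s_poly n k p)" if "p' \<in> pcl n p" for p'
  proof -
    have "monom 1 n dvd p' - p"
      using that unfolding poly_ring_type type_coset_mem[OF coinv_ideal_ideal] by (simp add: coinv_ideal_eq)
    then obtain r where r: "p' - p = monom 1 n * r" by (auto elim: dvdE)
    have "monom 1 n dvd s_poly n k (p' - p)" for k
      unfolding r s_poly_mult s_poly_monom by (simp add: dvd_smult)
    then have "monom 1 n dvd (\<Sum>k<n. a k * s_poly n k (p' - p))"
      by (intro dvd_sum dvd_mult)
    then show ?thesis unfolding pcl_eq_iff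
      by (simp add: s_poly_diff right_diff_distrib sum_subtractf)
  qed
  moreover have "p \<in> pcl n p"
    unfolding poly_ring_type type_coset_mem[OF coinv_ideal_ideal] by (simp add: coinv_ideal_eq)
  moreover have "a \<odot>\<^bsub>coinv_module n\<^esub> pcl n p = (\<Union>g\<in>pcl n p. pcl n (\<Sum>k<n. a k * s_poly n k g))"
    by (simp add: coinv_module_def Let_def)
  ultimately show ?thesis by (metis (no_types, lifting) SUP_eq_const empty_iff)
qed

section \<open>The standard module as a space of functions\<close>

context cyclic_cher
begin

sublocale D: tensor_setup "Cher n c" "skew_ring n" "skew_incl n c" "coinv_module n"
proof (rule tensor_setup.intro)
  show "ring (Cher n c)" by (rule Cher_ring)
  show "skew_incl n c b \<in> carrier (Cher n c)" for b by (simp add: skew_incl_def)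
  show "m \<oplus>\<^bsub>coinv_module n\<^esub> m' \<in> carrier (coinv_module n)"
    if "m \<in> carrier (coinv_module n)" "m' \<in> carrier (coinv_module n)" for m m'
    using that by (auto simp: coinv_carrier coinv_add)
  show "b \<odot>\<^bsub>coinv_module n\<^esub> m \<in> carrier (coinv_module n)"
    if "m \<in> carrier (coinv_module n)" for b m
    using that by (auto simp: coinv_carrier coinv_smult)
qed

lemma Delta_T: "Delta n c = D.T"
  by (simp add: Delta_def)

lemma pure_tensor_pt: "pure_tensor n c h g = D.pt h g"
  by (simp add: pure_tensor_def)

sublocale P: cher_module n c "Delta n c"
  unfolding Delta_T by (rule cher_module.intro, rule D.T_left_module) (simp add: coinv_carrier)

abbreviation "dact \<equiv> act n c (Delta n c)"

text \<open>The generator \<open>1 \<otimes> 1\<close> of the standard module: \<open>s\<close> fixes it and \<open>\<xi>\<^sup>n\<close> kills it.\<close>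

definition u0 :: delta_elt where "u0 = D.pt (cl n c 1) (pcl n 1)"

lemma pcl_carrier [simp]: "pcl n p \<in> carrier (coinv_module n)"
  by (simp add: coinv_carrier)

lemma u0_carrier [simp]: "u0 \<in> carrier (Delta n c)"
  unfolding u0_def Delta_T by (rule D.pt_carrier) simp_all

lemma skew_incl_fev: "skew_incl n c a = cl n c (\<Sum>k<n. fev genxi (a k) * gens ^ k)"
  by (simp add: skew_incl_def fev_def)

lemma pt_u0: "D.pt (cl n c a) (pcl n p) = dact (a * fev genxi p) u0"
proof -
  let ?b = "\<lambda>k::nat. if k = 0 then p else 0"
  have b: "?b \<in> carrier (skew_ring n)" using n0 by (simp add: skew_ring_def)
  have s: "(\<Sum>k<n. fev genxi (?b k) * gens ^ k) = fev genxi p"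
    using n0 by (subst sum.remove[of _ 0]) (auto intro!: sum.neutral)
  have t: "(\<Sum>k<n. ?b k * s_poly n k 1) = p"
    using n0 by (subst sum.remove[of _ 0]) (auto intro!: sum.neutral)
  have "D.pt (cl n c a \<otimes>\<^bsub>Cher n c\<^esub> skew_incl n c ?b) (pcl n 1) = D.pt (cl n c a) (?b \<odot>\<^bsub>coinv_module n\<^esub> pcl n 1)"
    by (rule D.pt_balanced) (use b in simp_all)
  then have "D.pt (cl n c a) (pcl n p) = D.pt (cl n c (a * fev genxi p)) (pcl n 1)"
    by (simp add: coinv_smult skew_incl_fev s t cl_ops n0)
  also have "\<dots> = dact (a * fev genxi p) u0"
    unfolding act_def Delta_T u0_def by (subst D.pt_smult) (simp_all add: cl_ops)
  finally show ?thesis .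
qed

lemma gens_u0: "dact gens u0 = u0"
proof -
  let ?b = "\<lambda>k::nat. if k = 1 then 1 else (0::complex poly)"
  have b: "?b \<in> carrier (skew_ring n)" using n2 by (simp add: skew_ring_def)
  have s: "(\<Sum>k<n. fev genxi (?b k) * gens ^ k) = gens"
    using n2 by (subst sum.remove[of _ 1]) (auto intro!: sum.neutral)
  have t: "(\<Sum>k<n. ?b k * s_poly n k 1) = 1"
    using n2 by (subst sum.remove[of _ 1]) (auto intro!: sum.neutral)
  have "D.pt (cl n c 1 \<otimes>\<^bsub>Cher n c\<^esub> skew_incl n c ?b) (pcl n 1) = D.pt (cl n c 1) (?b \<odot>\<^bsub>coinv_module n\<^esub> pcl n 1)"
    by (rule D.pt_balanced) (use b in simp_all)
  then have "D.pt (cl n c gens) (pcl n 1) = u0"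
    by (simp only: coinv_smult skew_incl_fev s t cl_ops mult_1 u0_def)
  then show ?thesis by (simp add: pt_u0)
qed

lemma genxi_n_u0: "dact (genxi ^ n) u0 = \<zero>\<^bsub>Delta n c\<^esub>"
proof -
  have "pcl n (monom 1 n) = pcl n 0" by (simp add: pcl_eq_iff)
  then have "dact (1 * fev genxi (monom 1 n)) u0 = dact (1 * fev genxi 0) u0"
    unfolding pt_u0[symmetric] by simp
  then show ?thesis by (simp add: fev_monom P.act_0)
qed

subsection \<open>Commutation relations\<close>

lemma cl_mult_cong: "\<lbrakk>cl n c a = cl n c a'; cl n c b = cl n c b'\<rbrakk> \<Longrightarrow> cl n c (a * b) = cl n c (a' * b')"
  by (simp add: cl_ops(2)[symmetric])

lemma cl_add_cong: "\<lbrakk>cl n c a = cl n c a'; cl n c b = cl n c b'\<rbrakk> \<Longrightarrow> cl n c (a + b) = cl n c (a' + b')"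
  by (simp add: cl_ops(1)[symmetric])

lemma cl_rel: "a - b \<in> cher_rels n c \<Longrightarrow> cl n c a = cl n c b"
  using cher_rels_in_ideal by (auto simp: cl_eq_iff)

lemma cl_gens_n: "cl n c (gens ^ n) = cl n c 1"
  by (rule cl_rel) (simp add: cher_rels_def)

text \<open>Passes from the relation \<open>s y s\<^sup>n\<^sup>-\<^sup>1 = z y\<close> to the commutation rule \<open>s y = z y s\<close>.\<close>

lemma cl_gens_move:
  assumes "cl n c (gens * y * gens ^ (n - 1)) = cl n c (scal z * y)"
  shows "cl n c (gens * y) = cl n c (scal z * y * gens)"
proof -
  have "gens ^ (n - 1) * gens = gens ^ n"
    using n2 by (metis One_nat_def Suc_pred n0 power_Suc2)
  then have "cl n c (gens * y * gens ^ (n - 1) * gens) = cl n c (gens * y * gens ^ n)"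
    by (simp add: mult.assoc)
  also have "\<dots> = cl n c (gens * y * 1)" by (rule cl_mult_cong[OF refl cl_gens_n])
  finally show ?thesis using cl_mult_cong[OF assms refl, of gens] by simp
qed

lemma cl_gens_genxi: "cl n c (gens * genxi) = cl n c (scal q * genxi * gens)"
  by (rule cl_gens_move, rule cl_rel) (simp only: cher_rels_def insert_iff simp_thms)

lemma cl_gens_genx: "cl n c (gens * genx) = cl n c (scal (inverse q) * genx * gens)"
  by (rule cl_gens_move, rule cl_rel) (simp only: cher_rels_def insert_iff simp_thms)

definition "comm_elt = 1 + (\<Sum>i<n. scal (c_per n c (int i + 1) - c_per n c (int i)) * eps n i)"

lemma cl_commutator: "cl n c (genxi * genx) = cl n c (genx * genxi + comm_elt)"
proof (rule cl_rel)
  have "genxi * genx - (genx * genxi + comm_elt) = (genxi * genx - genx * genxi) - comm_elt" by simp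
  then show "genxi * genx - (genx * genxi + comm_elt) \<in> cher_rels n c"
    by (simp only: cher_rels_def comm_elt_def insert_iff simp_thms)
qed

lemma cl_gens_y_power:
  assumes "cl n c (gens * y) = cl n c (scal z * y * gens)"
  shows "cl n c (gens * y ^ i) = cl n c (scal (z ^ i) * y ^ i * gens)"
proof (induction i)
  case (Suc i)
  have "cl n c (gens * y ^ Suc i) = cl n c ((gens * y) * y ^ i)" by (simp add: mult.assoc)
  also have "\<dots> = cl n c ((scal z * y * gens) * y ^ i)" by (rule cl_mult_cong[OF assms refl])
  also have "\<dots> = cl n c ((scal z * y) * (gens * y ^ i))" by (simp add: mult.assoc)
  also have "\<dots> = cl n c ((scal z * y) * (scal (z ^ i) * y ^ i * gens))" by (rule cl_mult_cong[OF refl Suc.IH])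
  also have "(scal z * y) * (scal (z ^ i) * y ^ i * gens) = scal (z ^ Suc i) * y ^ Suc i * gens"
    by (simp add: scal_mult mult.assoc scal_left_commute[of y])
  finally show ?case .
qed simp

lemma cl_gens_power_y:
  assumes "cl n c (gens * y) = cl n c (scal z * y * gens)"
  shows "cl n c (gens ^ k * y) = cl n c (scal (z ^ k) * y * gens ^ k)"
proof (induction k)
  case (Suc k)
  have "cl n c (gens ^ Suc k * y) = cl n c (gens * (gens ^ k * y))" by (simp add: mult.assoc)
  also have "\<dots> = cl n c (gens * (scal (z ^ k) * y * gens ^ k))" by (rule cl_mult_cong[OF refl Suc.IH])
  also have "gens * (scal (z ^ k) * y * gens ^ k) = scal (z ^ k) * ((gens * y) * gens ^ k)"
    by (metis mult.assoc scal_commute)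
  also have "cl n c \<dots> = cl n c (scal (z ^ k) * ((scal z * y * gens) * gens ^ k))"
    by (intro cl_mult_cong refl assms)
  also have "scal (z ^ k) * ((scal z * y * gens) * gens ^ k) = scal (z ^ Suc k) * y * gens ^ Suc k"
    by (simp add: scal_mult power_commutes mult.assoc) (metis mult.assoc scal_commute)
  finally show ?case .
qed simp

lemma cl_gens_power_fev:
  "cl n c (gens ^ k * fev genxi p) = cl n c (fev genxi (s_poly n k p) * gens ^ k)"
proof (induction p)
  case (pCons x p)
  have "cl n c (gens ^ k * fev genxi (pCons x p)) = cl n c (scal x * gens ^ k + (gens ^ k * genxi) * fev genxi p)"
    by (simp add: fev_pCons distrib_left scal_commute mult.assoc)
  also have "\<dots> = cl n c (scal x * gens ^ k + (scal (q ^ k) * genxi * gens ^ k) * fev genxi p)"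
    by (intro cl_add_cong cl_mult_cong refl cl_gens_power_y cl_gens_genxi)
  also have "\<dots> = cl n c (scal x * gens ^ k + (scal (q ^ k) * genxi) * (gens ^ k * fev genxi p))"
    by (simp add: mult.assoc)
  also have "\<dots> = cl n c (scal x * gens ^ k + (scal (q ^ k) * genxi) * (fev genxi (s_poly n k p) * gens ^ k))"
    by (intro cl_add_cong cl_mult_cong refl pCons.IH)
  also have "scal x * gens ^ k + (scal (q ^ k) * genxi) * (fev genxi (s_poly n k p) * gens ^ k)
      = fev genxi (s_poly n k (pCons x p)) * gens ^ k"
    by (simp add: s_poly_pCons fev_pCons fev_smult distrib_right) (metis mult.assoc scal_commute)
  finally show ?case .
qed simp

lemma dact_cong: "cl n c a = cl n c b \<Longrightarrow> act n c M a m = act n c M b m"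
  by (simp add: act_def)

lemma mop_cong:
  assumes "cl n c a = cl n c b" "u \<in> Lfun" shows "mop a u = mop b u"
proof -
  have "mop (a - b) u = (\<lambda>b k. 0)" using assms by (intro mop_ideal) (simp_all add: cl_eq_iff)
  then show ?thesis by (simp add: mop_diff mlin_def fun_eq_iff)
qed

subsection \<open>The embedding into functions\<close>

text \<open>The function \<open>b \<mapsto> b\<^sup>-\<^sup>k e\<^sub>k\<close>, which will be the image of \<open>\<xi>\<^sup>k u0\<close>.  It is \<open>0\<close> for \<open>k = n\<close>, in
  accordance with \<open>\<xi>\<^sup>n u0 = 0\<close>.\<close>

definition be :: "nat \<Rightarrow> mfun" where
  "be k = (\<lambda>b j. if b \<noteq> 0 \<and> j = k \<and> k < n then 1 / b ^ k else 0)"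

lemma be_Lfun: "be k \<in> Lfun"
proof -
  have "(\<lambda>b. be k b j) holomorphic_on - {0}" for j
  proof (cases "j = k \<and> k < n")
    case True
    have "(\<lambda>b. 1 / b ^ k) holomorphic_on - {0}" by (auto intro!: holomorphic_intros)
    then show ?thesis by (rule holomorphic_transform) (use True in \<open>simp add: be_def\<close>)
  next
    case False
    then have "(\<lambda>b. be k b j) = (\<lambda>b. 0)" by (auto simp: be_def fun_eq_iff)
    then show ?thesis by simp
  qed
  then show ?thesis by (auto simp: Lfun_def be_def fin_vecs_def)
qed

lemma mS_be_power: "mop (gens ^ k) (be 0) = be 0"
  using mop_gens_power[OF be_Lfun, of k 0] by (auto simp: be_def fun_eq_iff)

text \<open>On \<open>b\<^sup>-\<^sup>k\<close> the rotation \<open>s\<close> is \<open>q\<^sup>k\<close>, so exactly the idempotent \<open>\<epsilon>\<^sub>i\<close> with \<open>i + k\<close> divisible by \<open>n\<close>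
  acts as the identity.\<close>

lemma mZ_be: "k < n \<Longrightarrow> mZ (be k) b j = c (n - k) * be k b j"
proof -
  assume k: "k < n"
  have e: "mep i (be k) b j = (if n dvd i + k then be k b j else 0)" for i
  proof -
    have "q ^ (m * i) * be k (b / q ^ m) j = (q ^ (i + k)) ^ m * be k b j" for m
      by (simp add: be_def power_divide power_add power_mult[symmetric] algebra_simps)
    then have "mep i (be k) b j = 1 / of_nat n * ((\<Sum>m<n. (q ^ (i + k)) ^ m) * be k b j)"
      by (simp add: mep_def sum_distrib_right)
    then show ?thesis using n0 by (simp add: rootq_orthogonality[OF n0])
  qed
  have "n dvd i + k \<longleftrightarrow> i = n - k" if "i \<in> {1..n-1}" for i
  proof
    assume "n dvd i + k"
    then obtain l where l: "i + k = n * l" by (auto elim: dvdE)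
    have "l = 1"
    proof (rule ccontr)
      assume "l \<noteq> 1"
      then have "l = 0 \<or> l \<ge> 2" by auto
      then show False
      proof
        assume "2 \<le> l"
        then have "n * 2 \<le> n * l" by (rule mult_le_mono2)
        moreover have "i < n" using that n2 by auto
        ultimately show False using l k by linarith
      qed (use l that in auto)
    qed
    then show "i = n - k" using l by simp
  qed (use k in simp)
  then have "mZ (be k) b j = (\<Sum>i\<in>{1..n-1}. if i = n - k then c i * be k b j else 0)"
    unfolding mZ_def by (intro sum.cong) (auto simp: e)
  also have "\<dots> = c (n - k) * be k b j" using k cn by (cases "k = 0") auto
  finally show ?thesis .
qed

text \<open>Here \<open>b d/db\<close> contributes \<open>- k\<close>, the diagonal of \<open>A\<close> contributes \<open>k - c\<^sub>n\<^sub>-\<^sub>k\<close> and \<open>z\<close> contributes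
  \<open>c\<^sub>n\<^sub>-\<^sub>k\<close>.  They cancel, and the subdiagonal of \<open>A\<close> is left.  This is where the form of \<open>A\<close> comes from.\<close>

lemma mXi_be:
  assumes k: "k < n"
  shows "mXi (be k) = be (Suc k)"
proof (intro ext)
  fix b j
  show "mXi (be k) b j = be (Suc k) b j"
  proof (cases "b = 0")
    case False
    have "deriv (\<lambda>y. be k y j) b = (if j = k then - of_nat k / b ^ Suc k else 0)"
    proof (rule DERIV_imp_deriv)
      have "((\<lambda>y. 1 / y) has_field_derivative - 1 / (b * b)) (at b)"
        using False by (auto intro!: derivative_eq_intros)
      then have d: "((\<lambda>y. (1 / y) ^ k) has_field_derivative of_nat k * (- 1 / (b * b) * (1 / b) ^ (k - Suc 0))) (at b)"
        by (rule DERIV_power)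
      have "((\<lambda>y. 1 / y ^ k) has_field_derivative - of_nat k / b ^ Suc k) (at b)"
      proof -
        have e: "of_nat k * (- 1 / (b * b) * (1 / b) ^ (k - Suc 0)) = - of_nat k / b ^ Suc k"
          using False by (cases k) (auto simp: field_simps)
        show ?thesis using d unfolding e by (simp add: power_divide)
      qed
      then have "((\<lambda>y. if j = k then 1 / y ^ k else 0) has_field_derivative (if j = k then - of_nat k / b ^ Suc k else 0)) (at b)"
        by auto
      then show "((\<lambda>y. be k y j) has_field_derivative (if j = k then - of_nat k / b ^ Suc k else 0)) (at b)"
        by (rule has_field_derivative_transform_within_open[OF _ open_cstar]) (use False k in \<open>auto simp: be_def\<close>)
    qed
    then have "mXi (be k) b j = ((if j = k then - of_nat k / b ^ k else 0) + bidiag n ev (be k b) j + c (n - k) * be k b j) / b"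
      using False by (simp add: mXi_def mEu_def mZ_be k)
    also have "\<dots> = be (Suc k) b j"
      using False k by (cases "j = k"; cases "j = Suc k") (auto simp: bidiag_def be_def ev_def field_simps)
    finally show ?thesis .
  qed (simp add: mXi_def be_def)
qed

lemma mop_genxi_be: "k \<le> n \<Longrightarrow> mop (genxi ^ k) (be 0) = be k"
proof (induction k)
  case (Suc k)
  then show ?case by (simp add: mop_mult be_Lfun mop_gens mXi_be)
qed (simp add: mop_gens)

lemma be_n: "be n = (\<lambda>b k. 0)"
  by (simp add: be_def)

lemma mop_genx_power: "u \<in> Lfun \<Longrightarrow> mop (genx ^ i) u = (\<lambda>b k. b ^ i * u b k)"
  by (induction i) (simp_all add: mop_mult mop_gens fun_eq_iff mX_def mult.assoc)

lemma mop_fev_genx: "u \<in> Lfun \<Longrightarrow> mop (fev genx p) u = (\<lambda>b k. poly p b * u b k)"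
  by (simp add: fev_def mop_sum mop_mult mop_gens mop_genx_power poly_altdef sum_distrib_right mult.assoc)

lemma zero_mop: "mop a (\<lambda>b k. 0) = (\<lambda>b k. 0)"
  using mop_mlin[OF zero_Lfun zero_Lfun, of a 0 0] by (simp add: mlin_def)

lemma mop_coinv_ideal:
  assumes "monom 1 n dvd p" shows "mop (fev genxi p) (be 0) = (\<lambda>b k. 0)"
proof -
  obtain r where "p = r * monom 1 n" using assms by (auto elim: dvdE simp: mult.commute)
  then show ?thesis
    by (simp add: fev_mult mop_mult be_Lfun fev_monom mop_genxi_be be_n zero_mop)
qed

text \<open>The additive group of functions, as target of the universal property of the tensor product.\<close>

definition Lgrp :: "mfun monoid" where
  "Lgrp = \<lparr>carrier = Lfun, mult = (\<lambda>u v. mlin 1 u 1 v), one = (\<lambda>b k. 0)\<rparr>"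

lemma Lgrp_comm_group: "comm_group Lgrp"
proof (rule comm_groupI)
  fix u assume u: "u \<in> carrier Lgrp"
  then have "mlin (- 1) u 0 u \<in> Lfun" by (intro mlin_Lfun) (simp_all add: Lgrp_def)
  then show "\<exists>y\<in>carrier Lgrp. y \<otimes>\<^bsub>Lgrp\<^esub> u = \<one>\<^bsub>Lgrp\<^esub>"
    by (intro bexI[of _ "mlin (- 1) u 0 u"]) (simp_all add: Lgrp_def mlin_def)
qed (auto simp: Lgrp_def mlin_Lfun zero_Lfun, auto simp: mlin_def algebra_simps)

text \<open>The map \<open>a \<otimes> p \<mapsto> a p(\<xi>) e\<^sub>0\<close> is well defined in \<open>a\<close> because the relations act by \<open>0\<close>, in \<open>p\<close> because
  \<open>\<xi>\<^sup>n e\<^sub>0 = 0\<close>, and balanced because \<open>s\<close> fixes the constant function \<open>e\<^sub>0\<close>.\<close>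

lemma Phi_exists:
  "\<exists>h. h \<in> hom (add_monoid (Delta n c)) Lgrp \<and>
    (\<forall>a p. h (D.pt (cl n c a) (pcl n p)) = mop a (mop (fev genxi p) (be 0)))"
proof -
  \<comment> \<open>Arbitrary representatives of the two tensor factors.\<close>
  define ra where "ra h = (SOME a. h = cl n c a)" for h
  define rp where "rp g = (SOME p. g = pcl n p)" for g
  have ra: "cl n c (ra (cl n c a)) = cl n c a" for a
    unfolding ra_def by (rule someI2[of _ a]) auto
  have rp: "pcl n (rp (pcl n p)) = pcl n p" for p
    unfolding rp_def by (rule someI2[of _ p]) auto
  define f where "f h g = mop (ra h) (mop (fev genxi (rp g)) (be 0))" for h g
  have f: "f (cl n c a) (pcl n p) = mop a (mop (fev genxi p) (be 0))" for a p
  proof -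
    have "monom 1 n dvd rp (pcl n p) - p" using rp[of p] by (simp add: pcl_eq_iff)
    then have "mop (fev genxi (rp (pcl n p) - p)) (be 0) = (\<lambda>b k. 0)" by (rule mop_coinv_ideal)
    then have "mop (fev genxi (rp (pcl n p))) (be 0) = mop (fev genxi p) (be 0)"
      using mop_add[of "fev genxi (rp (pcl n p) - p)" "fev genxi p" "be 0"]
      by (simp add: fev_add[symmetric] mlin_def)
    then show ?thesis unfolding f_def using mop_cong[OF ra mop_Lfun[OF be_Lfun]] by simp
  qed
  have bal: "f (cl n c a \<otimes>\<^bsub>Cher n c\<^esub> skew_incl n c b) (pcl n p) = f (cl n c a) (b \<odot>\<^bsub>coinv_module n\<^esub> pcl n p)"
    for a b p
  proof -
    have "mop (fev genxi (b k) * gens ^ k) (mop (fev genxi p) (be 0))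
        = mop (fev genxi (b k * s_poly n k p)) (be 0)" for k
    proof -
      have "mop (gens ^ k) (mop (fev genxi p) (be 0)) = mop (fev genxi (s_poly n k p)) (be 0)"
        using mop_cong[OF cl_gens_power_fev be_Lfun, of k p]
        by (simp add: mop_mult be_Lfun mop_Lfun mS_be_power)
      then show ?thesis by (simp add: mop_mult be_Lfun mop_Lfun fev_mult)
    qed
    then have "mop (\<Sum>k<n. fev genxi (b k) * gens ^ k) (mop (fev genxi p) (be 0))
        = mop (fev genxi (\<Sum>k<n. b k * s_poly n k p)) (be 0)"
      by (simp add: mop_sum fev_sum)
    then show ?thesis
      by (simp add: skew_incl_fev cl_ops f coinv_smult mop_mult mop_Lfun be_Lfun)
  qed
  obtain h where "h \<in> hom (add_monoid D.T) Lgrp"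
    "\<And>r m. \<lbrakk>r \<in> carrier (Cher n c); m \<in> carrier (coinv_module n)\<rbrakk> \<Longrightarrow> h (D.pt r m) = f r m"
  proof (rule D.T_universal[OF Lgrp_comm_group, of f])
    show "f r m \<in> carrier Lgrp" if "r \<in> carrier (Cher n c)" "m \<in> carrier (coinv_module n)" for r m
      using that by (auto simp: Cher_carrier coinv_carrier f Lgrp_def mop_Lfun be_Lfun)
    show "f (r \<oplus>\<^bsub>Cher n c\<^esub> r') m = f r m \<otimes>\<^bsub>Lgrp\<^esub> f r' m"
      if "r \<in> carrier (Cher n c)" "r' \<in> carrier (Cher n c)" "m \<in> carrier (coinv_module n)" for r r' m
      using that by (auto simp: Cher_carrier coinv_carrier cl_ops f Lgrp_def mop_add)
    show "f r (m \<oplus>\<^bsub>coinv_module n\<^esub> m') = f r m \<otimes>\<^bsub>Lgrp\<^esub> f r m'"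
      if "r \<in> carrier (Cher n c)" "m \<in> carrier (coinv_module n)" "m' \<in> carrier (coinv_module n)" for r m m'
      using that by (auto simp: Cher_carrier coinv_carrier coinv_add f Lgrp_def fev_add mop_add mop_mlin mop_Lfun be_Lfun)
    show "f (r \<otimes>\<^bsub>Cher n c\<^esub> skew_incl n c b) m = f r (b \<odot>\<^bsub>coinv_module n\<^esub> m)"
      if "r \<in> carrier (Cher n c)" "b \<in> carrier (skew_ring n)" "m \<in> carrier (coinv_module n)" for r b m
      using that bal by (auto simp: Cher_carrier coinv_carrier)
  qed blast
  then show ?thesis unfolding Delta_T by (intro exI[of _ h]) (simp add: f)
qed

definition Phi :: "delta_elt \<Rightarrow> mfun" where
  "Phi = (SOME h. h \<in> hom (add_monoid (Delta n c)) Lgrp \<and>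
    (\<forall>a p. h (D.pt (cl n c a) (pcl n p)) = mop a (mop (fev genxi p) (be 0))))"

lemma Phi_hom: "Phi \<in> hom (add_monoid (Delta n c)) Lgrp"
  and Phi_pt: "Phi (D.pt (cl n c a) (pcl n p)) = mop a (mop (fev genxi p) (be 0))"
  using someI_ex[OF Phi_exists] unfolding Phi_def[symmetric] by blast+

lemma Phi_Lfun: "v \<in> carrier (Delta n c) \<Longrightarrow> Phi v \<in> Lfun"
  using Phi_hom by (auto simp: hom_def Lgrp_def)

lemma Phi_add: "\<lbrakk>v \<in> carrier (Delta n c); w \<in> carrier (Delta n c)\<rbrakk> \<Longrightarrow>
    Phi (v \<oplus>\<^bsub>Delta n c\<^esub> w) = mlin 1 (Phi v) 1 (Phi w)"
  using Phi_hom by (auto simp: hom_def Lgrp_def)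

lemma Phi_u0_act: "Phi (dact a u0) = mop a (be 0)"
  using Phi_pt[of a 1] by (simp add: pt_u0 mop_gens)

lemma dact_diff: "dact (a - b) u0 = dact a u0 \<ominus>\<^bsub>Delta n c\<^esub> dact b u0"
proof -
  have c: "dact a u0 \<in> carrier (Delta n c)" "dact b u0 \<in> carrier (Delta n c)" "dact (a - b) u0 \<in> carrier (Delta n c)"
    by (simp_all add: P.act_closed)
  have "dact (a - b) u0 \<oplus>\<^bsub>Delta n c\<^esub> dact b u0 = dact a u0"
    using P.act_add[OF u0_carrier, of "a - b" b] by simp
  then show ?thesis
    using c P.M.add.inv_solve_right'[of "dact (a - b) u0" "dact a u0" "dact b u0"]
    by (simp add: a_minus_def a_inv_def)
qed

lemma Delta_cyclic:
  assumes "v \<in> carrier (Delta n c)" obtains a where "v = dact a u0"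
proof -
  have "\<exists>a. v = dact a u0"
    using assms unfolding Delta_T
  proof (induction v rule: D.T_induct)
    case (diff x y)
    then show ?case using dact_diff unfolding Delta_T by metis
  next
    case (pure r m)
    then obtain a p where "r = cl n c a" "m = pcl n p" by (auto simp: Cher_carrier coinv_carrier)
    then show ?case using pt_u0[of a p] unfolding Delta_T by blast
  qed (simp add: coinv_carrier)
  then show ?thesis using that by blast
qed

lemma Phi_act:
  assumes "v \<in> carrier (Delta n c)"
  shows "Phi (dact a v) = mop a (Phi v)"
proof -
  obtain b where b: "v = dact b u0" using Delta_cyclic[OF assms] .
  show ?thesis
    unfolding b P.act_mult[OF u0_carrier, symmetric] Phi_u0_act by (rule mop_mult[OF be_Lfun])
qed

lemma Phi_zero: "Phi \<zero>\<^bsub>Delta n c\<^esub> = (\<lambda>b k. 0)"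
  using Phi_u0_act[of 0] P.act_0[OF u0_carrier] by simp

subsection \<open>Normal forms\<close>

text \<open>The normal form \<open>\<Sum> p\<^sub>k(x) \<xi>\<^sup>k\<close> of an element of \<open>\<Delta>\<close>, with \<open>k < n\<close>.\<close>

definition nf :: "(nat \<Rightarrow> complex poly) \<Rightarrow> falg" where
  "nf p = (\<Sum>k<n. fev genx (p k) * genxi ^ k)"

definition mon :: "complex \<Rightarrow> nat \<Rightarrow> nat \<Rightarrow> falg" where
  "mon z i k = scal z * genx ^ i * genxi ^ k"

definition NF :: "delta_elt set" where "NF = {dact (nf p) u0 | p. True}"

lemma nf_add: "nf p + nf p' = nf (\<lambda>k. p k + p' k)"
  by (simp add: nf_def fev_add distrib_right sum.distrib)

lemma NF_add: "\<lbrakk>dact a u0 \<in> NF; dact b u0 \<in> NF\<rbrakk> \<Longrightarrow> dact (a + b) u0 \<in> NF"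
  unfolding NF_def using P.act_add[OF u0_carrier] nf_add by (smt (verit, best) mem_Collect_eq)

lemma NF_0: "dact 0 u0 \<in> NF"
proof -
  have "nf (\<lambda>k. 0) = 0" by (simp add: nf_def)
  then show ?thesis unfolding NF_def by (intro CollectI exI[of _ "\<lambda>k. 0"]) simp
qed

lemma NF_sum: "(\<And>i. i \<in> A \<Longrightarrow> dact (f i) u0 \<in> NF) \<Longrightarrow> dact (\<Sum>i\<in>A. f i) u0 \<in> NF"
  by (induction A rule: infinite_finite_induct) (auto simp: NF_0 NF_add)

lemma mon_NF: "k < n \<Longrightarrow> dact (mon z i k) u0 \<in> NF"
proof -
  assume k: "k < n"
  have "nf (\<lambda>j. if j = k then monom z i else 0) = mon z i k"
    unfolding nf_def mon_def using k by (subst sum.remove[of _ k]) (auto simp: fev_monom intro!: sum.neutral)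
  then show ?thesis unfolding NF_def by (intro CollectI exI[of _ "\<lambda>j. if j = k then monom z i else 0"]) simp
qed

lemma nf_mon: "nf p = (\<Sum>k<n. \<Sum>i\<le>degree (p k). mon (coeff (p k) i) i k)"
  by (simp add: nf_def fev_def mon_def sum_distrib_right)

text \<open>The elements of the free algebra that preserve the span \<open>NF\<close> of the normal forms.  They form a
  subalgebra, so to obtain all of \<open>\<Delta> = NF\<close> it suffices to treat the generators.\<close>

definition stab :: "falg set" where
  "stab = {a. \<forall>p. dact (a * nf p) u0 \<in> NF}"

lemma stabI:
  assumes "\<And>z i k. k < n \<Longrightarrow> dact (a * mon z i k) u0 \<in> NF"
  shows "a \<in> stab"
  unfolding stab_def nf_mon using assms by (auto simp: sum_distrib_left intro!: NF_sum)

lemma stab_add: "\<lbrakk>a \<in> stab; b \<in> stab\<rbrakk> \<Longrightarrow> a + b \<in> stab"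
  by (auto simp: stab_def distrib_right intro: NF_add)

lemma stab_NF: "\<lbrakk>a \<in> stab; dact b u0 \<in> NF\<rbrakk> \<Longrightarrow> dact (a * b) u0 \<in> NF"
proof -
  assume a: "a \<in> stab" and "dact b u0 \<in> NF"
  then obtain p where "dact b u0 = dact (nf p) u0" by (auto simp: NF_def)
  then have "dact (a * b) u0 = dact (a * nf p) u0" by (simp add: P.act_mult)
  then show ?thesis using a by (simp add: stab_def)
qed

lemma stab_mult:
  assumes "a \<in> stab" "b \<in> stab" shows "a * b \<in> stab"
  unfolding stab_def
proof (intro CollectI allI)
  fix p
  have "dact (b * nf p) u0 \<in> NF" using assms(2) by (simp add: stab_def)
  from stab_NF[OF assms(1) this] show "dact (a * b * nf p) u0 \<in> NF" by (simp add: mult.assoc)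
qed

lemma stab_scal: "scal z \<in> stab"
proof (rule stabI)
  fix w i k assume "k < n"
  have "scal z * mon w i k = mon (z * w) i k" by (simp add: mon_def scal_mult mult.assoc)
  then show "dact (scal z * mon w i k) u0 \<in> NF" using mon_NF[OF \<open>k < n\<close>] by simp
qed

lemma stab_genx: "genx \<in> stab"
proof (rule stabI)
  fix z i k assume "k < n"
  have "genx * mon z i k = mon z (Suc i) k"
    by (simp add: mon_def mult.assoc scal_left_commute[of genx])
  then show "dact (genx * mon z i k) u0 \<in> NF" using mon_NF[OF \<open>k < n\<close>] by simp
qed

lemma stab_gens: "gens \<in> stab"
proof (rule stabI)
  fix z i k assume "k < n"
  have "cl n c (gens * mon z i k) = cl n c (scal z * (gens * genx ^ i) * genxi ^ k)"
    by (simp add: mon_def mult.assoc scal_left_commute[of gens])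
  also have "\<dots> = cl n c (scal z * (scal (inverse q ^ i) * genx ^ i * gens) * genxi ^ k)"
    by (intro cl_mult_cong refl cl_gens_y_power cl_gens_genx)
  also have "\<dots> = cl n c (scal z * scal (inverse q ^ i) * genx ^ i * (gens * genxi ^ k))"
    by (simp add: mult.assoc)
  also have "\<dots> = cl n c (scal z * scal (inverse q ^ i) * genx ^ i * (scal (q ^ k) * genxi ^ k * gens))"
    by (intro cl_mult_cong refl cl_gens_y_power cl_gens_genxi)
  also have "scal z * scal (inverse q ^ i) * genx ^ i * (scal (q ^ k) * genxi ^ k * gens)
      = mon (z * inverse q ^ i * q ^ k) i k * gens"
    by (simp add: mon_def scal_mult mult.assoc scal_left_commute[of "genx ^ i"])
  finally have "dact (gens * mon z i k) u0 = dact (mon (z * inverse q ^ i * q ^ k) i k * gens) u0"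
    by (rule dact_cong)
  also have "\<dots> = dact (mon (z * inverse q ^ i * q ^ k) i k) u0"
    by (simp add: P.act_mult gens_u0)
  finally show "dact (gens * mon z i k) u0 \<in> NF" using mon_NF[OF \<open>k < n\<close>] by simp
qed

lemma stab_1: "1 \<in> stab"
  using stab_scal[of 1] by simp

lemma stab_0: "0 \<in> stab"
  using stab_scal[of 0] by simp

lemma stab_sum: "(\<And>i. i \<in> A \<Longrightarrow> f i \<in> stab) \<Longrightarrow> (\<Sum>i\<in>A. f i) \<in> stab"
  by (induction A rule: infinite_finite_induct) (auto simp: stab_0 stab_add)

lemma stab_power: "a \<in> stab \<Longrightarrow> a ^ m \<in> stab"
  by (induction m) (auto simp: stab_1 stab_mult)

lemma stab_comm_elt: "comm_elt \<in> stab"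
  unfolding comm_elt_def eps_def
  by (intro stab_add stab_1 stab_sum stab_mult stab_scal stab_power stab_gens)

text \<open>Moving \<open>\<xi>\<close> to the right through \<open>x\<^sup>i\<close> produces powers of \<open>x\<close> and elements of the group algebra of
  \<open>\<langle>s\<rangle>\<close>, whose action on \<open>NF\<close> is known; at the end \<open>\<xi>\<^sup>n u0 = 0\<close> is used.\<close>

lemma stab_genxi: "genxi \<in> stab"
proof (rule stabI)
  fix z i k assume k: "k < n"
  show "dact (genxi * mon z i k) u0 \<in> NF"
  proof (induction i)
    case 0
    have e: "genxi * mon z 0 k = scal z * genxi ^ Suc k"
      by (simp add: mon_def scal_left_commute[of genxi])
    show ?case
    proof (cases "Suc k < n")
      case True
      then show ?thesis using mon_NF[OF True, of z 0] unfolding e by (simp add: mon_def)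
    next
      case False
      then have "Suc k = n" using k by simp
      then have "dact (genxi * mon z 0 k) u0 = \<zero>\<^bsub>Delta n c\<^esub>"
        by (simp only: e P.act_mult[OF u0_carrier] genxi_n_u0 P.act_zero)
      then show ?thesis using NF_0 by (simp add: P.act_0)
    qed
  next
    case (Suc i)
    have m: "mon z (Suc i) k = genx * mon z i k"
      by (simp add: mon_def mult.assoc scal_left_commute[of genx])
    have "cl n c (genxi * mon z (Suc i) k) = cl n c ((genxi * genx) * mon z i k)"
      unfolding m by (simp add: mult.assoc)
    also have "\<dots> = cl n c ((genx * genxi + comm_elt) * mon z i k)"
      by (intro cl_mult_cong cl_commutator refl)
    finally have "dact (genxi * mon z (Suc i) k) u0 = dact (genx * (genxi * mon z i k) + comm_elt * mon z i k) u0"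
      by (intro dact_cong) (simp add: distrib_right mult.assoc)
    then show ?case
      using NF_add[OF stab_NF[OF stab_genx Suc] stab_NF[OF stab_comm_elt mon_NF[OF k]]] by simp
  qed
qed

lemma stab_UNIV: "a \<in> stab"
proof (induction a rule: falg_induct)
  case (single w z)
  have "Poly_Mapping.single (Word l) 1 \<in> stab" for l
  proof (induction l)
    case Nil
    then show ?case using stab_1 by (metis single_one zero_gword_def)
  next
    case (Cons g l)
    have "Poly_Mapping.single (Word (g # l)) 1 = Poly_Mapping.single (Word [g]) 1 * (Poly_Mapping.single (Word l) 1 :: falg)"
      by (simp add: mult_single plus_gword_def)
    moreover have "Poly_Mapping.single (Word [g]) 1 \<in> stab"
      using stab_genx stab_genxi stab_gens by (cases g) (simp_all add: genx_def genxi_def gens_def)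
    ultimately show ?case using stab_mult Cons by simp
  qed
  from stab_mult[OF stab_scal this, of z "letters w"] show ?case
    by (simp add: scal_def mult_single)
next
  case (add a b)
  then show ?case by (rule stab_add)
qed

lemma Delta_nf:
  assumes "v \<in> carrier (Delta n c)" obtains p where "v = dact (nf p) u0"
proof -
  obtain a where a: "v = dact a u0" using Delta_cyclic[OF assms] .
  have "dact (mon 1 0 0) u0 \<in> NF" using mon_NF n0 by simp
  from stab_NF[OF stab_UNIV this, of a] have "v \<in> NF" by (simp add: a mon_def)
  then show ?thesis using that by (auto simp: NF_def)
qed

lemma Phi_nf: "Phi (dact (nf p) u0) = (\<lambda>b k. if b \<noteq> 0 \<and> k < n then poly (p k) b / b ^ k else 0)"
proof (intro ext)
  fix b j
  have "Phi (dact (nf p) u0) b j = (\<Sum>k<n. poly (p k) b * be k b j)"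
    by (simp add: Phi_u0_act nf_def mop_sum mop_mult be_Lfun mop_genxi_be mop_fev_genx)
  also have "\<dots> = (\<Sum>k<n. if k = j then (if b = 0 then 0 else poly (p j) b / b ^ j) else 0)"
    by (rule sum.cong) (auto simp: be_def)
  finally show "Phi (dact (nf p) u0) b j = (if b \<noteq> 0 \<and> j < n then poly (p j) b / b ^ j else 0)"
    by auto
qed

lemma poly_zero_cstar: "(\<And>b. b \<noteq> 0 \<Longrightarrow> poly p b = 0) \<Longrightarrow> p = (0::complex poly)"
proof (rule ccontr)
  assume 0: "\<And>b. b \<noteq> 0 \<Longrightarrow> poly p b = 0" and p: "p \<noteq> 0"
  have "finite {x. poly p x = 0}" by (rule poly_roots_finite[OF p])
  then have "finite (- {0::complex})" by (rule finite_subset[rotated]) (use 0 in auto)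
  then have "finite (insert 0 (- {0::complex}))" by simp
  moreover have "insert 0 (- {0::complex}) = UNIV" by auto
  ultimately have "finite (UNIV :: complex set)" by simp
  then show False by (simp add: infinite_UNIV_char_0)
qed

text \<open>On normal forms \<open>Phi\<close> is injective because the polynomials \<open>p\<^sub>k\<close> can be read off the coordinates.\<close>

lemma Phi_inj:
  assumes v: "v \<in> carrier (Delta n c)" and w: "w \<in> carrier (Delta n c)" and eq: "Phi v = Phi w"
  shows "v = w"
proof -
  obtain a b where ab: "v = dact a u0" "w = dact b u0" using Delta_cyclic v w by metis
  have d: "dact (a - b) u0 \<in> carrier (Delta n c)" by (simp add: P.act_closed)
  obtain p where p: "dact (a - b) u0 = dact (nf p) u0" using Delta_nf[OF d] .
  have "Phi (dact (a - b) u0) = (\<lambda>b k. 0)"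
    using eq by (simp add: ab Phi_u0_act mop_diff mlin_def)
  then have z: "(\<lambda>b k. if b \<noteq> 0 \<and> k < n then poly (p k) b / b ^ k else 0) = (\<lambda>b k. 0)"
    by (simp add: p Phi_nf)
  have "p k = 0" if "k < n" for k
  proof (rule poly_zero_cstar)
    fix b :: complex assume "b \<noteq> 0"
    then show "poly (p k) b = 0" using fun_cong[OF fun_cong[OF z, of b], of k] that by simp
  qed
  then have "nf p = 0" by (simp add: nf_def)
  then have "dact (a - b) u0 = \<zero>\<^bsub>Delta n c\<^esub>" using p by (simp add: P.act_0)
  then show ?thesis
    using P.act_add[OF u0_carrier, of "a - b" b] by (simp add: ab P.act_closed)
qed

end

section \<open>The grading of the standard module\<close>

definition unit_vec :: "nat \<Rightarrow> nat \<Rightarrow> complex" where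
  "unit_vec l = (\<lambda>k. if k = l then 1 else 0)"

lemma unit_vec_fin_vecs: "l < n \<Longrightarrow> unit_vec l \<in> fin_vecs n"
  by (simp add: unit_vec_def fin_vecs_def)

lemma bexp_expand:
  assumes y: "y \<in> fin_vecs n"
  shows "bexp n a z y k = (\<Sum>l<n. y l * bexp n a z (unit_vec l) k)"
proof -
  have "bexp n a z (\<lambda>k. \<Sum>l\<in>A. y l * unit_vec l k) k = (\<Sum>l\<in>A. y l * bexp n a z (unit_vec l) k)"
    if "finite A" for A k
    using that
  proof (induction A)
    case empty
    have "bexp n a z (\<lambda>k. 0) = (\<lambda>k. 0)" by (rule lin_op_zero[OF lin_op_bexp])
    then show ?case by simp
  next
    case (insert l A)
    have "bexp n a z (lincomb (y l) (unit_vec l) 1 (\<lambda>k. \<Sum>l\<in>A. y l * unit_vec l k))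
       = lincomb (y l) (bexp n a z (unit_vec l)) 1 (bexp n a z (\<lambda>k. \<Sum>l\<in>A. y l * unit_vec l k))"
      by (rule bexp_lincomb)
    then show ?case using insert by (simp add: lincomb_def fun_eq_iff)
  qed
  from this[of "{..<n}" k] show ?thesis
  proof -
    assume 1: "bexp n a z (\<lambda>k. \<Sum>l<n. y l * unit_vec l k) k = (\<Sum>l<n. y l * bexp n a z (unit_vec l) k)" if "finite {..<n}"
    have "(\<lambda>k. \<Sum>l<n. y l * unit_vec l k) = y"
    proof
      fix k
      have "(\<Sum>l<n. y l * unit_vec l k) = (\<Sum>l<n. if l = k then y k else 0)"
        by (rule sum.cong) (auto simp: unit_vec_def)
      also have "\<dots> = y k" using y by (auto simp: fin_vecs_def)
      finally show "(\<Sum>l<n. y l * unit_vec l k) = y k" .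
    qed
    then show ?thesis using 1 by simp
  qed
qed

context cyclic_cher
begin

text \<open>The homogeneous function \<open>b\<^sup>d y\<close> of degree \<open>d\<close>.\<close>

definition hv :: "int \<Rightarrow> (nat \<Rightarrow> complex) \<Rightarrow> mfun" where
  "hv d y = (\<lambda>b k. if b = 0 then 0 else b powi d * y k)"

definition HV :: "int \<Rightarrow> mfun set" where "HV d = hv d ` fin_vecs n"

lemma hv_Lfun:
  assumes "y \<in> fin_vecs n" shows "hv d y \<in> Lfun"
proof -
  have "(\<lambda>b. hv d y b k) holomorphic_on - {0}" for k
  proof -
    have "(\<lambda>b. b powi d * y k) holomorphic_on - {0}" by (auto intro!: holomorphic_intros)
    then show ?thesis by (rule holomorphic_transform) (simp add: hv_def)
  qed
  then show ?thesis using assms by (auto simp: Lfun_def hv_def fin_vecs_def)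
qed

lemma HV_mlin: "\<lbrakk>u \<in> HV d; v \<in> HV d\<rbrakk> \<Longrightarrow> mlin x u y v \<in> HV d"
proof -
  assume "u \<in> HV d" "v \<in> HV d"
  then obtain a b where ab: "u = hv d a" "v = hv d b" "a \<in> fin_vecs n" "b \<in> fin_vecs n"
    by (auto simp: HV_def)
  have "mlin x u y v = hv d (lincomb x a y b)"
    by (auto simp: ab mlin_def hv_def lincomb_def fun_eq_iff algebra_simps)
  moreover have "lincomb x a y b \<in> fin_vecs n" using ab by (simp add: fin_vecs_def lincomb_def)
  ultimately show ?thesis by (auto simp: HV_def)
qed

lemma zero_HV: "(\<lambda>b k. 0) \<in> HV d"
  unfolding HV_def by (rule image_eqI[of _ _ "\<lambda>k. 0"]) (auto simp: hv_def fin_vecs_def)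

lemma mX_hv: "mX (hv d y) = hv (d + 1) y"
  by (auto simp: mX_def hv_def fun_eq_iff power_int_add)

lemma mS_hv: "mS (hv d y) = hv d (\<lambda>k. q powi (- d) * y k)"
  by (auto simp: mS_def hv_def fun_eq_iff power_int_divide_distrib power_int_minus field_simps)

lemma mEu_hv: "y \<in> fin_vecs n \<Longrightarrow> mEu (hv d y) = hv d (bidiag n (\<lambda>k. of_int d + ev k) y)"
proof (intro ext)
  fix b k assume y: "y \<in> fin_vecs n"
  show "mEu (hv d y) b k = hv d (bidiag n (\<lambda>k. of_int d + ev k) y) b k"
  proof (cases "b = 0")
    case False
    have "deriv (\<lambda>b. hv d y b k) b = of_int d * b powi (d - 1) * y k"
    proof (rule DERIV_imp_deriv)
      have "((\<lambda>b. b powi d * y k) has_field_derivative of_int d * b powi (d - 1) * y k) (at b)"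
        using False by (auto intro!: derivative_eq_intros)
      then show "((\<lambda>b. hv d y b k) has_field_derivative of_int d * b powi (d - 1) * y k) (at b)"
        by (rule has_field_derivative_transform_within_open[OF _ open_cstar]) (use False in \<open>auto simp: hv_def\<close>)
    qed
    moreover have "b * b powi (d - 1) = b powi d" using False by (simp add: power_int_diff)
    ultimately have "b * deriv (\<lambda>b. hv d y b k) b = b powi d * (of_int d * y k)"
      by (simp add: mult.left_commute mult.assoc[symmetric])
    moreover have "bidiag n ev (hv d y b) k = b powi d * bidiag n ev y k"
      using False by (simp add: bidiag_def hv_def algebra_simps)
    ultimately show ?thesis using False unfolding bidiag_shift[OF y]
      by (simp add: mEu_def, simp add: hv_def distrib_left)
  qed (simp add: mEu_def hv_def)
qed

lemma hv_scale: "hv d (\<lambda>k. x * y k) b k = x * hv d y b k"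
  by (simp add: hv_def)

lemma mep_hv: "\<exists>x. mep i (hv d y) = hv d (\<lambda>k. x * y k)"
proof (intro exI ext)
  fix b k
  have "hv d y (b / q ^ m) k = (1 / q ^ m) powi d * hv d y b k" for m
    by (simp add: hv_def power_int_divide_distrib)
  then show "mep i (hv d y) b k = hv d (\<lambda>k. (1 / of_nat n * (\<Sum>m<n. q ^ (m * i) * (1 / q ^ m) powi d)) * y k) b k"
    unfolding hv_scale mep_def by (simp add: sum_distrib_right mult.assoc)
qed

lemma mZ_hv: "\<exists>x. mZ (hv d y) = hv d (\<lambda>k. x * y k)"
proof -
  have "\<forall>i. \<exists>x. mep i (hv d y) = hv d (\<lambda>k. x * y k)" using mep_hv by blast
  from choice[OF this] obtain x where x: "\<And>i. mep i (hv d y) = hv d (\<lambda>k. x i * y k)" by blast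
  have "mZ (hv d y) = hv d (\<lambda>k. (\<Sum>i\<in>{1..n-1}. c i * x i) * y k)"
    by (intro ext) (simp only: mZ_def x hv_scale, simp only: sum_distrib_right mult.assoc)
  then show ?thesis by blast
qed

text \<open>Each generator shifts the degree of functions by its degree in the algebra.  Thus \<open>Phi\<close> is graded, and
  the homogeneous components of \<open>\<Delta>\<close> are recognized from their images.\<close>

lemma gop_HV:
  assumes "u \<in> HV d" shows "gop g u \<in> HV (d + gdeg g)"
proof -
  obtain y where y: "u = hv d y" "y \<in> fin_vecs n" using assms by (auto simp: HV_def)
  show ?thesis
  proof (cases g)
    case Gxi
    obtain x where x: "mZ u = hv d (\<lambda>k. x * y k)" using mZ_hv y by blast
    have "mXi u = hv (d - 1) (lincomb 1 (bidiag n (\<lambda>k. of_int d + ev k) y) x y)"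
    proof -
      have "mEu u = hv d (bidiag n (\<lambda>k. of_int d + ev k) y)" using mEu_hv y by simp
      then show ?thesis
        by (intro ext, simp add: mXi_def x, simp add: hv_def lincomb_def power_int_diff field_simps)
    qed
    moreover have "lincomb 1 (bidiag n (\<lambda>k. of_int d + ev k) y) x y \<in> fin_vecs n"
      using y bidiag_fin_vecs[of n "\<lambda>k. of_int d + ev k" y] by (simp add: fin_vecs_def lincomb_def)
    ultimately show ?thesis using Gxi by (auto simp: HV_def)
  next
    case Gs
    have "(\<lambda>k. q powi (- d) * y k) \<in> fin_vecs n" using y by (simp add: fin_vecs_def)
    then show ?thesis using Gs by (simp add: y mS_hv HV_def)
  qed (use y in \<open>auto simp: mX_hv HV_def\<close>)
qed

lemma wop_HV: "u \<in> HV d \<Longrightarrow> wop w u \<in> HV (d + sum_list (map gdeg w))"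
proof (induction w)
  case (Cons g w)
  then show ?case using gop_HV[of "wop w u" "d + sum_list (map gdeg w)" g] by (simp add: wop_def algebra_simps)
qed (simp add: wop_def)

lemma mop_HV:
  assumes "\<forall>w\<in>Poly_Mapping.keys a. sum_list (map gdeg (letters w)) = e" "u \<in> HV d"
  shows "mop a u \<in> HV (d + e)"
proof -
  have "(\<lambda>b k. \<Sum>w\<in>A. Poly_Mapping.lookup a w * wop (letters w) u b k) \<in> HV (d + e)"
    if "finite A" "A \<subseteq> Poly_Mapping.keys a" for A
    using that
  proof (induction A)
    case (insert w A)
    have "mlin (Poly_Mapping.lookup a w) (wop (letters w) u) 1
        (\<lambda>b k. \<Sum>w\<in>A. Poly_Mapping.lookup a w * wop (letters w) u b k) \<in> HV (d + e)"
      using insert wop_HV[OF assms(2), of "letters w"] assms(1) by (intro HV_mlin) auto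
    then show ?case using insert by (simp add: mlin_def)
  qed (simp add: zero_HV)
  from this[OF finite_keys order_refl] show ?thesis by (simp add: mop_def)
qed

lemma be_hv: "k < n \<Longrightarrow> be k = hv (- int k) (unit_vec k)"
  by (auto simp: be_def hv_def unit_vec_def fun_eq_iff power_int_minus field_simps)

lemma Phi_mon: "k < n \<Longrightarrow> Phi (dact (mon z i k) u0) = hv (int i - int k) (\<lambda>l. z * unit_vec k l)"
  by (simp add: Phi_u0_act mon_def mop_mult mop_Lfun be_Lfun mop_gens mop_genxi_be mop_genx_power)
    (auto simp: be_def unit_vec_def hv_def fun_eq_iff power_int_diff field_simps)

text \<open>The degree \<open>d\<close> part of \<open>\<Delta>\<close>, seen through \<open>Phi\<close>; \<open>Delta_deg_eq\<close> identifies it with the component of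
  the grading of the tensor product.\<close>

definition Dhom :: "int \<Rightarrow> delta_elt set" where
  "Dhom d = {v \<in> carrier (Delta n c). Phi v \<in> HV d}"

lemma Dhom_mon: "k < n \<Longrightarrow> dact (mon z i k) u0 \<in> Dhom (int i - int k)"
  by (auto simp: Dhom_def P.act_closed Phi_mon HV_def fin_vecs_def unit_vec_def)

text \<open>Coordinate \<open>k\<close> of \<open>Phi v\<close> is a polynomial divided by \<open>b\<^sup>k\<close>, whereas \<open>b\<^sup>d\<^sup>+\<^sup>k y\<^sub>k\<close> is polynomial for \<open>d + k < 0\<close>
  only when \<open>y\<^sub>k = 0\<close>.\<close>

lemma Dhom_coords:
  assumes v: "v \<in> carrier (Delta n c)" and y: "Phi v = hv d y" and k: "k < n" "d + int k < 0"
  shows "y k = 0"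
proof -
  obtain p where p: "v = dact (nf p) u0" using Delta_nf[OF v] .
  define m where "m = nat (- (d + int k))"
  have m: "0 < m" "d + int k = - int m" using k by (simp_all add: m_def)
  have "poly (monom 1 m * p k - [:y k:]) b = 0" if b: "b \<noteq> 0" for b
  proof -
    have "poly (p k) b / b ^ k = b powi d * y k"
      using fun_cong[OF fun_cong[OF y[unfolded p Phi_nf], of b], of k] b k by (simp add: hv_def)
    then have "poly (p k) b = b powi (d + int k) * y k"
      using b by (simp add: power_int_add field_simps)
    then show ?thesis using b unfolding m(2) by (simp add: poly_monom power_int_minus)
  qed
  then have "monom 1 m * p k - [:y k:] = 0" by (rule poly_zero_cstar)
  then have "poly (monom 1 m * p k) 0 = poly [:y k:] 0" by simp
  then show ?thesis using m(1) by (simp add: poly_monom zero_power)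
qed

text \<open>The multiple \<open>z x\<^sup>d\<^sup>+\<^sup>k \<xi>\<^sup>k\<close> of the monomial of degree \<open>d\<close> with index \<open>k\<close>, or \<open>0\<close> if there is none.\<close>

definition hmon :: "int \<Rightarrow> nat \<Rightarrow> complex \<Rightarrow> falg" where
  "hmon d k z = (if 0 \<le> d + int k then mon z (nat (d + int k)) k else 0)"

lemma Phi_hmon:
  assumes "k < n"
  shows "Phi (dact (hmon d k z) u0) = hv d (\<lambda>l. (if 0 \<le> d + int k then z else 0) * unit_vec k l)"
  using assms by (auto simp: hmon_def Phi_mon P.act_0 Phi_zero hv_def fun_eq_iff)

lemma Dhom_hmon: "k < n \<Longrightarrow> dact (hmon d k z) u0 \<in> Dhom d"
  by (auto simp: Dhom_def P.act_closed Phi_hmon HV_def fin_vecs_def unit_vec_def)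

lemma Phi_sum: "Phi (dact (\<Sum>i\<in>A. f i) u0) = (\<lambda>b k. \<Sum>i\<in>A. Phi (dact (f i) u0) b k)"
  by (simp add: Phi_u0_act mop_sum)

lemma Dhom_expand:
  assumes v: "v \<in> carrier (Delta n c)" and y: "Phi v = hv d y" "y \<in> fin_vecs n"
  shows "v = dact (\<Sum>k<n. hmon d k (y k)) u0"
proof (rule Phi_inj[OF v])
  show "dact (\<Sum>k<n. hmon d k (y k)) u0 \<in> carrier (Delta n c)" by (simp add: P.act_closed)
  show "Phi v = Phi (dact (\<Sum>k<n. hmon d k (y k)) u0)"
  proof (intro ext)
    fix b l
    have "Phi (dact (\<Sum>k<n. hmon d k (y k)) u0) b l = (\<Sum>k<n. if k = l then hv d y b l else 0)"
      unfolding Phi_sum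
      by (rule sum.cong) (use Dhom_coords[OF v y(1)] in \<open>auto simp: Phi_hmon hv_def unit_vec_def not_le\<close>)
    then show "Phi v b l = Phi (dact (\<Sum>k<n. hmon d k (y k)) u0) b l"
      using y by (auto simp: hv_def fin_vecs_def)
  qed
qed

lemma Dhom_zero: "\<zero>\<^bsub>Delta n c\<^esub> \<in> Dhom d"
  by (simp add: Dhom_def Phi_zero zero_HV)

lemma Dhom_add: "\<lbrakk>v \<in> Dhom d; w \<in> Dhom d\<rbrakk> \<Longrightarrow> v \<oplus>\<^bsub>Delta n c\<^esub> w \<in> Dhom d"
  by (auto simp: Dhom_def Phi_add HV_mlin)

lemma Dhom_scal: "v \<in> Dhom d \<Longrightarrow> dact (scal z) v \<in> Dhom d"
proof -
  assume v: "v \<in> Dhom d"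
  have "mlin z (Phi v) 0 (Phi v) \<in> HV d" using v by (intro HV_mlin) (auto simp: Dhom_def)
  then show ?thesis using v by (auto simp: Dhom_def P.act_closed Phi_act mop_gens mlin_def)
qed

lemma Dhom_below: "\<lbrakk>v \<in> Dhom d; d \<le> - int n\<rbrakk> \<Longrightarrow> v = \<zero>\<^bsub>Delta n c\<^esub>"
proof -
  assume v: "v \<in> Dhom d" and d: "d \<le> - int n"
  obtain y where y: "Phi v = hv d y" "y \<in> fin_vecs n" using v by (auto simp: Dhom_def HV_def)
  have "y k = 0" for k
    using Dhom_coords[of v d y k] v y d by (cases "k < n") (auto simp: Dhom_def fin_vecs_def)
  then have "Phi v = Phi \<zero>\<^bsub>Delta n c\<^esub>" by (auto simp: y Phi_zero hv_def fun_eq_iff)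
  then show ?thesis using v by (intro Phi_inj) (auto simp: Dhom_def)
qed

lemma Dhom_genxi: "v \<in> Dhom d \<Longrightarrow> dact (genxi ^ K) v \<in> Dhom (d - int K)"
proof (induction K)
  case (Suc K)
  then have v: "v \<in> carrier (Delta n c)" and w: "dact (genxi ^ K) v \<in> Dhom (d - int K)" by (auto simp: Dhom_def)
  have "gop Gxi (Phi (dact (genxi ^ K) v)) \<in> HV ((d - int K) + gdeg Gxi)"
    using w by (intro gop_HV) (simp add: Dhom_def)
  then show ?case using v
    by (simp add: P.act_mult Dhom_def P.act_closed Phi_act mop_gens algebra_simps)
qed (simp add: Dhom_def P.act_1)

text \<open>The operator \<open>\<xi>\<close> lowers degrees, and there is nothing below degree \<open>1 - n\<close>.\<close>

lemma genxi_nilpotent: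
  assumes "v \<in> carrier (Delta n c)"
  shows "\<exists>K. dact (genxi ^ K) v = \<zero>\<^bsub>Delta n c\<^esub>"
proof -
  define Nil where "Nil = {a. \<exists>K. \<forall>L\<ge>K. dact (genxi ^ L * a) u0 = \<zero>\<^bsub>Delta n c\<^esub>}"
  have "a + b \<in> Nil" if ab: "a \<in> Nil" "b \<in> Nil" for a b
  proof -
    obtain K K' where "\<forall>L\<ge>K. dact (genxi ^ L * a) u0 = \<zero>\<^bsub>Delta n c\<^esub>"
      "\<forall>L\<ge>K'. dact (genxi ^ L * b) u0 = \<zero>\<^bsub>Delta n c\<^esub>" using ab by (auto simp: Nil_def)
    then show ?thesis unfolding Nil_def
      by (intro CollectI exI[of _ "max K K'"]) (simp add: distrib_left P.act_add)
  qed
  moreover have "0 \<in> Nil" by (simp add: Nil_def P.act_0)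
  ultimately have sum: "(\<Sum>i\<in>A. f i) \<in> Nil" if "\<And>i. i \<in> A \<Longrightarrow> f i \<in> Nil" for A and f :: "nat \<Rightarrow> falg"
    using that by (induction A rule: infinite_finite_induct) auto
  have "mon z i k \<in> Nil" if "k < n" for z i k
    unfolding Nil_def
  proof (intro CollectI exI[of _ "i + n"] allI impI)
    fix L assume "i + n \<le> L"
    then show "dact (genxi ^ L * mon z i k) u0 = \<zero>\<^bsub>Delta n c\<^esub>"
      using Dhom_below[OF Dhom_genxi[OF Dhom_mon[OF that]], of i L z] by (simp add: P.act_mult)
  qed
  then have "nf p \<in> Nil" for p unfolding nf_mon by (intro sum) auto
  moreover obtain p where "v = dact (nf p) u0" using Delta_nf[OF assms] .
  ultimately have "\<exists>K. \<forall>L\<ge>K. dact (genxi ^ L) v = \<zero>\<^bsub>Delta n c\<^esub>" by (auto simp: Nil_def P.act_mult)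
  then show ?thesis by blast
qed

lemma Delta_cat_O: "Delta n c \<in> cat_O n c"
proof -
  have "fin_gen (Cher n c) (Delta n c)"
    unfolding fin_gen_def
  proof (intro exI[of _ "{u0}"] conjI allI impI)
    fix N assume N: "submodule N (Cher n c) (Delta n c) \<and> {u0} \<subseteq> N"
    then interpret N: submodule N "Cher n c" "Delta n c" by simp
    have "carrier (Delta n c) \<subseteq> N"
    proof
      fix v assume "v \<in> carrier (Delta n c)"
      then obtain a where "v = dact a u0" by (rule Delta_cyclic)
      then show "v \<in> N" using N by (simp add: act_def N.smult_closed)
    qed
    then show "N = carrier (Delta n c)" using N.subset by auto
  qed auto
  then show ?thesis
    using genxi_nilpotent P.left_module by (simp add: cat_O_def)
qed

lemma mon_single: "mon z i k = Poly_Mapping.single (Word (replicate i Gx @ replicate k Gxi)) z"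
proof -
  have "genx ^ i = Poly_Mapping.single (Word (replicate i Gx)) 1" for i
    by (induction i) (simp_all add: genx_def mult_single plus_gword_def zero_gword_def[symmetric])
  moreover have "genxi ^ k = Poly_Mapping.single (Word (replicate k Gxi)) 1" for k
    by (induction k) (simp_all add: genxi_def mult_single plus_gword_def zero_gword_def[symmetric])
  ultimately show ?thesis
    by (simp add: mon_def scal_def mult_single plus_gword_def zero_gword_def)
qed

text \<open>One inclusion holds since homogeneous pure tensors have homogeneous images, the other one since the
  monomials \<open>x\<^sup>d\<^sup>+\<^sup>k \<xi>\<^sup>k u0\<close> span \<open>Dhom d\<close> and are pure tensors of degree \<open>d\<close>.\<close>

lemma Delta_deg_eq: "Delta_deg n c d = Dhom d"
proof
  let ?G = "{pure_tensor n c h g | h g a b. h \<in> Cher_deg n c a \<and> g \<in> coinv_deg n b \<and> a + b = d}"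
  have G: "?G \<subseteq> Dhom d"
  proof clarify
    fix h g a b assume "h \<in> Cher_deg n c a" "g \<in> coinv_deg n b" and d: "d = a + b"
    then obtain r p where r: "h = cl n c r" "\<forall>w\<in>Poly_Mapping.keys r. sum_list (map gdeg (letters w)) = a"
      and p: "g = pcl n p" "\<forall>i. coeff p i \<noteq> 0 \<longrightarrow> - int i = b"
      by (auto simp: Cher_deg_def coinv_deg_def)
    have be0: "be 0 \<in> HV 0" using be_hv[of 0] n0 unit_vec_fin_vecs[of 0 n] by (auto simp: HV_def)
    have "(\<lambda>y k. \<Sum>i\<in>A. coeff p i * mop (genxi ^ i) (be 0) y k) \<in> HV b" if "finite A" for A
      using that
    proof (induction A)
      case (insert i A)
      show ?case
      proof (cases "coeff p i = 0")
        case False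
        have "\<forall>w\<in>Poly_Mapping.keys (genxi ^ i). sum_list (map gdeg (letters w)) = b"
          using p(2) False mon_single[of 1 0 i] by (simp add: mon_def sum_list_replicate)
        then have "mop (genxi ^ i) (be 0) \<in> HV (0 + b)" using be0 by (rule mop_HV)
        then have "mlin (coeff p i) (mop (genxi ^ i) (be 0)) 1
          (\<lambda>y k. \<Sum>i\<in>A. coeff p i * mop (genxi ^ i) (be 0) y k) \<in> HV b"
          using insert by (intro HV_mlin) auto
        then show ?thesis using insert by (simp add: mlin_def)
      qed (use insert in simp)
    qed (simp add: zero_HV)
    from this[of "{..degree p}"] have "mop (fev genxi p) (be 0) \<in> HV b"
      by (simp add: fev_def mop_sum mop_mult be_Lfun mop_gens)
    then have "mop r (mop (fev genxi p) (be 0)) \<in> HV (b + a)" by (rule mop_HV[OF r(2)])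
    then show "pure_tensor n c h g \<in> Dhom (a + b)"
      by (simp add: pure_tensor_pt r(1) p(1) Phi_pt Dhom_def add.commute) (simp add: pt_u0 P.act_closed)
  qed
  have neg: "inv\<^bsub>add_monoid (Delta n c)\<^esub> v \<in> Dhom d" if "v \<in> Dhom d" for v
  proof -
    have v: "v \<in> carrier (Delta n c)" using that by (simp add: Dhom_def)
    have "dact (scal (- 1)) v \<oplus>\<^bsub>Delta n c\<^esub> v = \<zero>\<^bsub>Delta n c\<^esub>"
      using P.act_add[OF v, of "scal (- 1)" "scal 1"] v
      by (simp add: P.act_1 scal_add[symmetric] P.act_0 del: scal_1)
         (metis P.act_1 scal_1)
    then have "inv\<^bsub>add_monoid (Delta n c)\<^esub> v = dact (scal (- 1)) v"
      using P.M.minus_equality[of "dact (scal (- 1)) v" v] v by (simp add: P.act_closed a_inv_def)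
    then show ?thesis using Dhom_scal[OF that] by simp
  qed
  show "Delta_deg n c d \<subseteq> Dhom d"
  proof
    fix v assume "v \<in> Delta_deg n c d"
    then show "v \<in> Dhom d"
      unfolding Delta_deg_def
    proof (induction rule: generate.induct)
      case one
      then show ?case using Dhom_zero by simp
    next
      case (incl h)
      then show ?case using G by blast
    next
      case (inv h)
      then show ?case using G neg by blast
    next
      case (eng h1 h2)
      then show ?case using Dhom_add by simp
    qed
  qed
  show "Dhom d \<subseteq> Delta_deg n c d"
  proof
    fix v assume v: "v \<in> Dhom d"
    then obtain y where y: "Phi v = hv d y" "y \<in> fin_vecs n" by (auto simp: Dhom_def HV_def)
    have z: "dact 0 u0 \<in> Delta_deg n c d"
      using generate.one[of "add_monoid (Delta n c)"] by (simp add: Delta_deg_def P.act_0)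
    have hm: "dact (hmon d k x) u0 \<in> Delta_deg n c d" for k x
    proof (cases "0 \<le> d + int k")
      case True
      let ?m = "mon x (nat (d + int k)) k"
      have "cl n c ?m \<in> Cher_deg n c d"
        unfolding Cher_deg_def using True by (intro imageI) (simp add: mon_single sum_list_replicate)
      moreover have "pcl n 1 \<in> coinv_deg n 0"
        unfolding coinv_deg_def by (intro imageI) auto
      ultimately have "pure_tensor n c (cl n c ?m) (pcl n 1) \<in> ?G" by force
      then have "pure_tensor n c (cl n c ?m) (pcl n 1) \<in> Delta_deg n c d"
        unfolding Delta_deg_def by (rule generate.incl)
      then show ?thesis using True by (simp add: hmon_def pure_tensor_pt pt_u0)
    qed (simp add: hmon_def z)
    have "dact (\<Sum>k\<in>A. hmon d k (y k)) u0 \<in> Delta_deg n c d" if "finite A" for A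
      using that
    proof (induction A)
      case (insert k A)
      have "dact (hmon d k (y k)) u0 \<otimes>\<^bsub>add_monoid (Delta n c)\<^esub> dact (\<Sum>k\<in>A. hmon d k (y k)) u0 \<in> Delta_deg n c d"
        using insert hm unfolding Delta_deg_def by (intro generate.eng) auto
      then show ?case using insert by (simp add: P.act_add)
    qed (simp add: z)
    from this[of "{..<n}"] show "v \<in> Delta_deg n c d"
      using Dhom_expand[OF _ y] v by (simp add: Dhom_def)
  qed
qed

end

section \<open>The operator eta\<close>

context cyclic_cher
begin

definition om :: complex where "om = 2 * of_real pi * \<i> / of_nat n"

lemma exp_om: "exp (of_int d * om) = q powi d"
  unfolding rootq_def om_def by (simp add: exp_power_int)

text \<open>The matrix \<open>B = exp(2\<pi>i/n A)\<close> applied pointwise.\<close>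

definition mExp :: "mfun \<Rightarrow> mfun" where
  "mExp u = (\<lambda>b. bexp n ev om (u b))"

text \<open>The entries of \<open>B\<close>.\<close>

definition Ent :: "nat \<Rightarrow> nat \<Rightarrow> complex" where
  "Ent k l = bexp n ev om (unit_vec l) k"

lemma mExp_Ent: "u \<in> Lfun \<Longrightarrow> mExp u b k = (\<Sum>l<n. Ent k l * u b l)"
  unfolding mExp_def Ent_def by (subst bexp_expand) (auto simp: Lfun_def mult.commute)

lemma mExp_Lfun: "u \<in> Lfun \<Longrightarrow> mExp u \<in> Lfun"
proof -
  assume u: "u \<in> Lfun"
  have "(\<lambda>b. mExp u b k) holomorphic_on - {0}" for k
    unfolding mExp_Ent[OF u] using u by (auto simp: Lfun_def intro!: holomorphic_intros)
  moreover have "mExp u 0 = (\<lambda>k. 0)"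
    using u lin_op_zero[OF lin_op_bexp] by (simp add: mExp_def Lfun_def)
  ultimately show ?thesis using u by (simp add: Lfun_def mExp_def bexp_fin_vecs)
qed

lemma mExp_mlin: "mExp (mlin x u y v) = mlin x (mExp u) y (mExp v)"
proof -
  have "mlin x u y v b = lincomb x (u b) y (v b)" for b by (simp add: mlin_def lincomb_def)
  then show ?thesis by (simp add: mExp_def bexp_lincomb) (simp add: mlin_def lincomb_def)
qed

lemma mep_mExp: "u \<in> Lfun \<Longrightarrow> mep i (mExp u) = mExp (mep i u)"
proof (intro ext)
  fix b k assume u: "u \<in> Lfun"
  have "mExp (mep i u) b k = (\<Sum>l<n. \<Sum>m<n. 1 / of_nat n * (q ^ (m * i) * (Ent k l * u (b / q ^ m) l)))"
    by (simp add: mExp_Ent u mep_Lfun) (simp add: mep_def sum_distrib_left mult_ac)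
  also have "\<dots> = (\<Sum>m<n. \<Sum>l<n. 1 / of_nat n * (q ^ (m * i) * (Ent k l * u (b / q ^ m) l)))"
    by (rule sum.swap)
  also have "\<dots> = mep i (mExp u) b k"
    by (simp only: mep_def mExp_Ent[OF u] sum_distrib_left)
  finally show "mep i (mExp u) b k = mExp (mep i u) b k" by simp
qed

lemma mZ_mExp: "u \<in> Lfun \<Longrightarrow> mZ (mExp u) = mExp (mZ u)"
proof (intro ext)
  fix b k assume u: "u \<in> Lfun"
  have "mExp (mZ u) b k = (\<Sum>l<n. \<Sum>i\<in>{1..n-1}. c i * (Ent k l * mep i u b l))"
    by (simp add: mExp_Ent u mZ_Lfun) (simp add: mZ_def sum_distrib_left mult_ac)
  also have "\<dots> = (\<Sum>i\<in>{1..n-1}. \<Sum>l<n. c i * (Ent k l * mep i u b l))"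
    by (rule sum.swap)
  also have "\<dots> = mZ (mExp u) b k"
    by (simp only: mZ_def mep_mExp[OF u] mExp_Ent[OF mep_Lfun[OF u]] sum_distrib_left)
  finally show "mZ (mExp u) b k = mExp (mZ u) b k" by simp
qed

text \<open>The constant matrix \<open>B\<close> commutes with \<open>b d/db\<close>, and with \<open>A\<close> as it is a power series in \<open>A\<close>.\<close>

lemma mEu_mExp: "u \<in> Lfun \<Longrightarrow> mEu (mExp u) = mExp (mEu u)"
proof (intro ext)
  fix b k assume u: "u \<in> Lfun"
  show "mEu (mExp u) b k = mExp (mEu u) b k"
  proof (cases "b = 0")
    case True
    then show ?thesis using mExp_Lfun[OF mEu_Lfun[OF u]] by (simp add: mEu_def Lfun_def)
  next
    case False
    have "deriv (\<lambda>b. mExp u b k) b = (\<Sum>l<n. Ent k l * deriv (\<lambda>b. u b l) b)"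
      unfolding mExp_Ent[OF u]
      by (rule DERIV_imp_deriv, rule DERIV_sum, rule DERIV_cmult, rule Lfun_deriv[OF u False])
    moreover have "mEu u b = lincomb b (\<lambda>l. deriv (\<lambda>b. u b l) b) 1 (bidiag n ev (u b))"
      using False by (simp add: mEu_def lincomb_def fun_eq_iff)
    moreover have "(\<lambda>l. deriv (\<lambda>b. u b l) b) \<in> fin_vecs n"
      using u by (simp add: fin_vecs_def Lfun_def)
    ultimately show ?thesis
      using False unfolding mEu_def[of "mExp u"] mExp_def[of "mEu u"]
      by (simp add: bexp_lincomb bidiag_bexp[symmetric])
         (simp add: lincomb_def mExp_def bexp_expand[of "\<lambda>l. deriv (\<lambda>b. u b l) b"] Ent_def mult.commute)
  qed
qed

lemma gop_mExp: "u \<in> Lfun \<Longrightarrow> gop g (mExp u) = mExp (gop g u)"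
proof (cases g)
  case Gx
  assume u: "u \<in> Lfun"
  have X: "mX u b = lincomb b (u b) 0 (u b)" for b u by (simp add: mX_def lincomb_def fun_eq_iff)
  show ?thesis using Gx by (intro ext) (simp only: gop.simps mExp_def X bexp_lincomb)
next
  case Gxi
  assume u: "u \<in> Lfun"
  have X: "mXi u b = lincomb (1 / b) (mEu u b) (1 / b) (mZ u b)" for b u
    by (simp add: mXi_def lincomb_def fun_eq_iff add_divide_distrib)
  have "mXi (mExp u) b = bexp n ev om (mXi u b)" for b
    unfolding X mZ_mExp[OF u] mEu_mExp[OF u] bexp_lincomb by (simp only: mExp_def)
  then show ?thesis using Gxi by (auto simp: mExp_def)
next
  case Gs
  have X: "mS u b = u (b / q)" for b u by (simp add: mS_def fun_eq_iff)
  show ?thesis using Gs by (intro ext) (simp only: gop.simps mExp_def X)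
qed

lemma mop_mExp:
  assumes "u \<in> Lfun" shows "mop a (mExp u) = mExp (mop a u)"
proof -
  have w: "wop w (mExp u) = mExp (wop w u)" for w
    using assms gop_mExp wop_Lfun[OF assms] by (induction w) (auto simp: wop_def)
  show ?thesis
  proof (induction a rule: falg_induct)
    case (single w z)
    have "mop (Poly_Mapping.single w z) v = mlin z (wop (letters w) v) 0 (wop (letters w) v)" for v
      by (simp add: mop_single mlin_def)
    then show ?case by (simp add: w mExp_mlin)
  next
    case (add a b)
    then show ?case by (simp add: mop_add mExp_mlin)
  qed
qed

text \<open>The image of \<open>Phi\<close> consists of the functions whose coordinate \<open>k\<close> has at most a pole of order \<open>k\<close> at
  \<open>0\<close>.  It is stable under \<open>B\<close>, because \<open>B\<close> is lower triangular and the allowed order grows with \<open>k\<close>.\<close>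

lemma etaop_exists:
  assumes "v \<in> carrier (Delta n c)"
  shows "\<exists>w\<in>carrier (Delta n c). Phi w = mExp (Phi v)"
proof -
  obtain p where p: "v = dact (nf p) u0" using Delta_nf[OF assms] .
  \<comment> \<open>The factor \<open>b\<^sup>k\<^sup>-\<^sup>l\<close> brings coordinate \<open>l\<close> to the denominator \<open>b\<^sup>k\<close>.\<close>
  define p' where "p' k = (\<Sum>l\<le>k. Polynomial.smult (Ent k l) (monom 1 (k - l) * p l))" for k
  have "Phi (dact (nf p') u0) b k = mExp (Phi v) b k" for b k
  proof (cases "b \<noteq> 0 \<and> k < n")
    case True
    have up: "Ent k l = 0" if "k < l" "l < n" for l
      unfolding Ent_def using bexp_lower_triangular(2)[of l n "unit_vec l" k] that True
      by (auto simp: unit_vec_def)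
    have "mExp (Phi v) b k = (\<Sum>l<n. Ent k l * (poly (p l) b / b ^ l))"
      unfolding mExp_Ent[OF Phi_Lfun[OF assms]] using True by (intro sum.cong) (auto simp: p Phi_nf)
    also have "\<dots> = (\<Sum>l\<le>k. Ent k l * (poly (p l) b / b ^ l))"
      using True up by (intro sum.mono_neutral_right) auto
    also have "\<dots> = poly (p' k) b / b ^ k"
      unfolding p'_def poly_sum sum_divide_distrib using True
      by (intro sum.cong) (auto simp: poly_monom power_diff)
    finally show ?thesis using True by (simp add: Phi_nf)
  next
    case False
    have "mExp (Phi v) \<in> Lfun" using Phi_Lfun[OF assms] by (rule mExp_Lfun)
    then have "mExp (Phi v) b k = 0" using False by (auto simp: Lfun_def fin_vecs_def)
    then show ?thesis using False by (auto simp: Phi_nf)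
  qed
  then show ?thesis by (intro bexI[of _ "dact (nf p') u0"]) (auto simp: P.act_closed fun_eq_iff)
qed

text \<open>The operator on \<open>\<Delta>\<close> that corresponds to \<open>B\<close>, undefined outside \<open>\<Delta>\<close> as module homomorphisms
  are here extensional functions.\<close>

definition etaop :: "delta_elt \<Rightarrow> delta_elt" where
  "etaop v = (if v \<in> carrier (Delta n c) then SOME w. w \<in> carrier (Delta n c) \<and> Phi w = mExp (Phi v) else undefined)"

lemma etaop:
  assumes "v \<in> carrier (Delta n c)"
  shows "etaop v \<in> carrier (Delta n c)" "Phi (etaop v) = mExp (Phi v)"
proof -
  have "\<exists>w. w \<in> carrier (Delta n c) \<and> Phi w = mExp (Phi v)" using etaop_exists[OF assms] by blast
  from someI_ex[OF this] assms
  show "etaop v \<in> carrier (Delta n c)" "Phi (etaop v) = mExp (Phi v)" by (simp_all add: etaop_def)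
qed

lemma etaop_add:
  "\<lbrakk>v \<in> carrier (Delta n c); w \<in> carrier (Delta n c)\<rbrakk> \<Longrightarrow>
    etaop (v \<oplus>\<^bsub>Delta n c\<^esub> w) = etaop v \<oplus>\<^bsub>Delta n c\<^esub> etaop w"
  by (rule Phi_inj) (simp_all add: etaop Phi_add mExp_mlin)

lemma etaop_act:
  "v \<in> carrier (Delta n c) \<Longrightarrow> etaop (dact a v) = dact a (etaop v)"
  by (rule Phi_inj) (simp_all add: etaop Phi_act P.act_closed mop_mExp Phi_Lfun)

lemma etaop_End: "etaop \<in> mod_hom (Cher n c) (Delta n c) (Delta n c)"
  unfolding mod_hom_def
proof (intro CollectI conjI ballI)
  show "etaop \<in> carrier (Delta n c) \<rightarrow>\<^sub>E carrier (Delta n c)"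
    using etaop(1) by (auto simp: PiE_def extensional_def etaop_def)
  fix h v assume "h \<in> carrier (Cher n c)" "v \<in> carrier (Delta n c)"
  then show "etaop (h \<odot>\<^bsub>Delta n c\<^esub> v) = h \<odot>\<^bsub>Delta n c\<^esub> etaop v"
    using etaop_act by (auto simp: Cher_carrier act_def)
qed (rule etaop_add)

lemma mop_scal_eu_power:
  assumes "y \<in> fin_vecs n"
  shows "mop (scal (1 / fact j) * (scal z * eu n c) ^ j) (hv d y)
    = hv d (\<lambda>k. z ^ j / fact j * (bidiag n (\<lambda>k. of_int d + ev k) ^^ j) y k)"
proof -
  let ?A = "bidiag n (\<lambda>k. of_int d + ev k)"
  have fin: "(?A ^^ j) y \<in> fin_vecs n" for j
    using assms by (cases j) (auto simp: bidiag_fin_vecs)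
  have "mop ((scal z * eu n c) ^ j) (hv d y) = hv d (\<lambda>k. z ^ j * (?A ^^ j) y k)"
  proof (induction j)
    case (Suc j)
    define w where "w = (\<lambda>k. z ^ j * (?A ^^ j) y k)"
    have w: "w \<in> fin_vecs n" using fin[of j] by (simp add: w_def fin_vecs_def)
    have "mop ((scal z * eu n c) ^ j) (hv d y) = hv d w" using Suc by (simp add: w_def)
    then have "mop ((scal z * eu n c) ^ Suc j) (hv d y) = mop (scal z) (mop (eu n c) (hv d w))"
      by (simp add: mop_mult hv_Lfun assms w mop_Lfun)
    also have "\<dots> = hv d (\<lambda>k. z * ?A w k)"
      by (simp add: mop_gens mop_eu hv_Lfun w mEu_hv) (auto simp: hv_def fun_eq_iff)
    also have "(\<lambda>k. z * ?A w k) = (\<lambda>k. z ^ Suc j * (?A ^^ Suc j) y k)"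
      by (rule ext) (simp add: w_def bidiag_def algebra_simps)
    finally show ?case .
  qed (auto simp: mop_gens hv_def fun_eq_iff)
  then show ?thesis
    by (simp add: mop_mult hv_Lfun assms mop_gens) (auto simp: hv_def fun_eq_iff)
qed

text \<open>The terms of the series \<open>exp(2\<pi>i/n eu) v\<close>.\<close>

definition dterm :: "delta_elt \<Rightarrow> nat \<Rightarrow> delta_elt" where
  "dterm v j = dact (scal (1 / fact j) * (scal (2 * of_real pi * \<i> / of_nat n) * eu n c) ^ j) v"

lemma Phi_dterm:
  assumes "v \<in> carrier (Delta n c)" "Phi v = hv d y" "y \<in> fin_vecs n"
  shows "Phi (dterm v j) = hv d (\<lambda>k. om ^ j / fact j * (bidiag n (\<lambda>k. of_int d + ev k) ^^ j) y k)"
  unfolding dterm_def om_def[symmetric] using assms by (simp add: Phi_act mop_scal_eu_power)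

lemma dterm_Dhom: "v \<in> Dhom d \<Longrightarrow> dterm v j \<in> Dhom d"
proof -
  assume v: "v \<in> Dhom d"
  then obtain y where y: "Phi v = hv d y" "y \<in> fin_vecs n" by (auto simp: Dhom_def HV_def)
  have "(bidiag n (\<lambda>k. of_int d + ev k) ^^ j) y \<in> fin_vecs n"
    using y by (cases j) (auto simp: bidiag_fin_vecs)
  then have "(\<lambda>k. om ^ j / fact j * (bidiag n (\<lambda>k. of_int d + ev k) ^^ j) y k) \<in> fin_vecs n"
    by (simp add: fin_vecs_def)
  then show ?thesis
    using v Phi_dterm[OF _ y] by (auto simp: Dhom_def HV_def) (simp add: dterm_def P.act_closed)
qed

lemma mExp_hv: "mExp (hv d y) = hv d (bexp n ev om y)"
proof
  fix b
  have "hv d y b = lincomb (if b = 0 then 0 else b powi d) y 0 y"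
    by (auto simp: hv_def lincomb_def)
  then show "mExp (hv d y) b = hv d (bexp n ev om y) b"
    unfolding mExp_def by (simp add: bexp_lincomb) (auto simp: hv_def lincomb_def)
qed

text \<open>The sum of that series for \<open>v\<close> of degree \<open>d\<close>, namely \<open>q\<^sup>d B v\<close>.\<close>

definition eulim :: "int \<Rightarrow> delta_elt \<Rightarrow> delta_elt" where
  "eulim d v = dact (scal (exp (of_int d * om))) (etaop v)"

lemma Phi_eulim:
  assumes "v \<in> carrier (Delta n c)" "Phi v = hv d y" "y \<in> fin_vecs n"
  shows "Phi (eulim d v) = hv d (bexp n (\<lambda>k. of_int d + ev k) om y)"
proof -
  show ?thesis
    unfolding bexp_shift[OF assms(3)] eulim_def using assms
    by (simp add: Phi_act etaop mop_gens mExp_hv) (auto simp: hv_def fun_eq_iff)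
qed

lemma eulim_Dhom: "v \<in> Dhom d \<Longrightarrow> eulim d v \<in> Dhom d"
proof -
  assume v: "v \<in> Dhom d"
  then obtain y where y: "Phi v = hv d y" "y \<in> fin_vecs n" by (auto simp: Dhom_def HV_def)
  then show ?thesis
    using v Phi_eulim[OF _ y] bexp_fin_vecs[OF y(2)]
    by (auto simp: Dhom_def HV_def) (simp add: eulim_def P.act_closed etaop)
qed

text \<open>On degree \<open>d\<close> the generator \<open>s\<close> is \<open>q\<^sup>-\<^sup>d\<close>, which cancels the scalar in \<open>exp(2\<pi>i/n (d + A))\<close>.\<close>

lemma gens_eulim:
  assumes "v \<in> Dhom d" shows "dact gens (eulim d v) = etaop v"
proof (rule Phi_inj)
  have v: "v \<in> carrier (Delta n c)" using assms by (simp add: Dhom_def)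
  obtain y where y: "Phi v = hv d y" "y \<in> fin_vecs n" using assms by (auto simp: Dhom_def HV_def)
  have e: "eulim d v \<in> carrier (Delta n c)" using eulim_Dhom[OF assms] by (simp add: Dhom_def)
  show "dact gens (eulim d v) \<in> carrier (Delta n c)" "etaop v \<in> carrier (Delta n c)"
    using v e by (simp_all add: P.act_closed etaop)
  have "Phi (etaop v) = hv d (bexp n ev om y)" by (simp add: etaop v y mExp_hv)
  moreover have "Phi (dact gens (eulim d v)) = hv d (\<lambda>k. q powi (- d) * bexp n (\<lambda>k. of_int d + ev k) om y k)"
    by (simp add: Phi_act e Phi_eulim[OF v y] mop_gens mS_hv)
  ultimately show "Phi (dact gens (eulim d v)) = Phi (etaop v)"
    unfolding bexp_shift[OF y(2)] exp_om by (simp add: power_int_minus mult.assoc[symmetric])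
qed

lemma Dhom_linear_functional:
  fixes lam :: "delta_elt \<Rightarrow> complex"
  assumes add: "\<forall>u\<in>Dhom d. \<forall>v\<in>Dhom d. lam (u \<oplus>\<^bsub>Delta n c\<^esub> v) = lam u + lam v"
    and scale: "\<forall>a. \<forall>v\<in>Dhom d. lam (dact (scal a) v) = a * lam v"
    and v: "v \<in> carrier (Delta n c)" and y: "Phi v = hv d y" "y \<in> fin_vecs n"
  shows "lam v = (\<Sum>k<n. y k * lam (dact (hmon d k 1) u0))"
proof -
  have "dact (\<Sum>k\<in>A. hmon d k (y k)) u0 \<in> Dhom d \<and>
    lam (dact (\<Sum>k\<in>A. hmon d k (y k)) u0) = (\<Sum>k\<in>A. y k * lam (dact (hmon d k 1) u0))"
    if "finite A" "A \<subseteq> {..<n}" for A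
    using that
  proof (induction A)
    case empty
    have "lam \<zero>\<^bsub>Delta n c\<^esub> = 0 * lam \<zero>\<^bsub>Delta n c\<^esub>"
      using scale[rule_format, OF Dhom_zero, of 0] by (simp add: P.act_0)
    then show ?case using Dhom_zero by (simp add: P.act_0)
  next
    case (insert k A)
    have k: "k < n" using insert by auto
    have "hmon d k (y k) = scal (y k) * hmon d k 1" by (simp add: hmon_def mon_def mult.assoc)
    then have "lam (dact (hmon d k (y k)) u0) = y k * lam (dact (hmon d k 1) u0)"
      using scale Dhom_hmon[OF k] by (simp add: P.act_mult)
    then show ?case using insert add Dhom_hmon[OF k] Dhom_add by (simp add: P.act_add)
  qed
  from this[of "{..<n}"] show ?thesis using Dhom_expand[OF v y] by simp
qed

text \<open>A linear functional on \<open>Dhom d\<close> is a linear combination of coordinates, and coordinatewise the series is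
  the one that defines the matrix exponential.\<close>

lemma eulim_fd_sums:
  assumes v: "v \<in> Dhom d"
  shows "fd_sums n c (Delta n c) (Dhom d) (dterm v) (eulim d v)"
  unfolding fd_sums_def
proof (intro conjI allI impI)
  show "range (dterm v) \<subseteq> Dhom d" using dterm_Dhom[OF v] by auto
  show "eulim d v \<in> Dhom d" by (rule eulim_Dhom[OF v])
  fix lam :: "delta_elt \<Rightarrow> complex"
  assume lam: "(\<forall>u\<in>Dhom d. \<forall>v\<in>Dhom d. lam (u \<oplus>\<^bsub>Delta n c\<^esub> v) = lam u + lam v) \<and>
    (\<forall>a. \<forall>v\<in>Dhom d. lam (dact (scal a) v) = a * lam v)"
  note lin = Dhom_linear_functional[OF conjunct1[OF lam] conjunct2[OF lam]]
  have vc: "v \<in> carrier (Delta n c)" using v by (simp add: Dhom_def)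
  obtain y where y: "Phi v = hv d y" "y \<in> fin_vecs n" using v by (auto simp: Dhom_def HV_def)
  let ?A = "bidiag n (\<lambda>k. of_int d + ev k)"
  have fin: "(?A ^^ j) y \<in> fin_vecs n" for j
    using y by (cases j) (auto simp: bidiag_fin_vecs)
  have 1: "lam (dterm v j) = (\<Sum>k<n. (om ^ j / fact j * (?A ^^ j) y k) * lam (dact (hmon d k 1) u0))" for j
  proof (rule lin)
    show "dterm v j \<in> carrier (Delta n c)" using dterm_Dhom[OF v] by (simp add: Dhom_def)
    show "Phi (dterm v j) = hv d (\<lambda>k. om ^ j / fact j * (?A ^^ j) y k)" by (rule Phi_dterm[OF vc y])
    show "(\<lambda>k. om ^ j / fact j * (?A ^^ j) y k) \<in> fin_vecs n" using fin[of j] by (simp add: fin_vecs_def)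
  qed
  have 2: "lam (eulim d v) = (\<Sum>k<n. bexp n (\<lambda>k. of_int d + ev k) om y k * lam (dact (hmon d k 1) u0))"
    by (rule lin) (use eulim_Dhom[OF v] Phi_eulim[OF vc y] bexp_fin_vecs[OF y(2)] in \<open>auto simp: Dhom_def\<close>)
  show "(\<lambda>k. lam (dterm v k)) sums lam (eulim d v)"
    unfolding 1 2 bexp_def
    by (intro sums_sum sums_mult2 summable_sums bexp_summable)
qed

text \<open>The coordinates of the value at \<open>b = 1\<close> are linear functionals that determine a homogeneous element.\<close>

lemma fd_sums_unique:
  assumes "fd_sums n c (Delta n c) (Dhom d) f w" "fd_sums n c (Delta n c) (Dhom d) f w'"
  shows "w = w'"
proof (rule Phi_inj)
  have ww: "w \<in> Dhom d" "w' \<in> Dhom d" using assms by (auto simp: fd_sums_def)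
  then show "w \<in> carrier (Delta n c)" "w' \<in> carrier (Delta n c)" by (auto simp: Dhom_def)
  obtain y y' where y: "Phi w = hv d y" "Phi w' = hv d y'" using ww by (auto simp: Dhom_def HV_def)
  have "y k = y' k" for k
  proof -
    define lam where "lam v = Phi v 1 k" for v
    have l: "(\<forall>u\<in>Dhom d. \<forall>v\<in>Dhom d. lam (u \<oplus>\<^bsub>Delta n c\<^esub> v) = lam u + lam v) \<and>
      (\<forall>a. \<forall>v\<in>Dhom d. lam (dact (scal a) v) = a * lam v)"
      by (auto simp: lam_def Dhom_def Phi_add mlin_def Phi_act mop_gens)
    have "(\<lambda>j. lam (f j)) sums lam w" "(\<lambda>j. lam (f j)) sums lam w'"
      using assms l unfolding fd_sums_def by blast+
    then have "lam w = lam w'" by (rule sums_unique2)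
    then show ?thesis by (simp add: lam_def y hv_def)
  qed
  then show "Phi w = Phi w'" by (simp add: y fun_eq_iff hv_def)
qed

lemma additive_eq_on_homogeneous:
  assumes f: "\<And>u v. \<lbrakk>u \<in> carrier (Delta n c); v \<in> carrier (Delta n c)\<rbrakk> \<Longrightarrow>
      f (u \<oplus>\<^bsub>Delta n c\<^esub> v) = f u \<oplus>\<^bsub>Delta n c\<^esub> f v"
    and g: "\<And>u v. \<lbrakk>u \<in> carrier (Delta n c); v \<in> carrier (Delta n c)\<rbrakk> \<Longrightarrow>
      g (u \<oplus>\<^bsub>Delta n c\<^esub> v) = g u \<oplus>\<^bsub>Delta n c\<^esub> g v"
    and eq: "\<And>d v. v \<in> Dhom d \<Longrightarrow> f v = g v"
    and v: "v \<in> carrier (Delta n c)"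
  shows "f v = g v"
proof -
  define Q where "Q = {a. f (dact a u0) = g (dact a u0)}"
  have "a + b \<in> Q" if "a \<in> Q" "b \<in> Q" for a b
    using that by (simp add: Q_def P.act_add f g P.act_closed)
  moreover have "0 \<in> Q" using eq[OF Dhom_zero] by (simp add: Q_def P.act_0)
  ultimately have sum: "(\<Sum>i\<in>A. h i) \<in> Q" if "\<And>i. i \<in> A \<Longrightarrow> h i \<in> Q" for A and h :: "nat \<Rightarrow> falg"
    using that by (induction A rule: infinite_finite_induct) auto
  have "mon z i k \<in> Q" if "k < n" for z i k
    using eq[OF Dhom_mon[OF that]] by (simp add: Q_def)
  then have "nf p \<in> Q" for p unfolding nf_mon by (intro sum) auto
  moreover obtain p where "v = dact (nf p) u0" using Delta_nf[OF v] .
  ultimately show ?thesis by (simp add: Q_def)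
qed

text \<open>On homogeneous elements the defining conditions of \<open>\<eta>\<close> leave no choice but \<open>s\<close> applied to the sum of
  the series, which is \<open>B\<close>; additivity extends this to \<open>\<Delta>\<close>.\<close>

theorem eta_eq_etaop: "eta n c = etaop"
proof -
  let ?P = "Delta n c"
  define good where "good f \<longleftrightarrow> f \<in> carrier ?P \<rightarrow>\<^sub>E carrier ?P \<and>
       (\<forall>u\<in>carrier ?P. \<forall>v\<in>carrier ?P. f (u \<oplus>\<^bsub>?P\<^esub> v) = f u \<oplus>\<^bsub>?P\<^esub> f v) \<and>
       (\<forall>a. \<forall>v\<in>carrier ?P. f (dact (scal a) v) = dact (scal a) (f v)) \<and>
       (\<forall>d. \<forall>v\<in>Dhom d. \<exists>w. fd_sums n c ?P (Dhom d) (dterm v) w \<and> f v = dact gens w)" for f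
  have g: "good etaop"
    unfolding good_def
  proof (intro conjI allI ballI)
    show "etaop \<in> carrier ?P \<rightarrow>\<^sub>E carrier ?P" using etaop_End by (simp add: mod_hom_def)
    fix d v assume "v \<in> Dhom d"
    then show "\<exists>w. fd_sums n c ?P (Dhom d) (dterm v) w \<and> etaop v = dact gens w"
      using eulim_fd_sums gens_eulim by (intro exI[of _ "eulim d v"]) auto
  qed (simp_all add: etaop_add etaop_act)
  moreover have "f = etaop" if f: "good f" for f
  proof (rule PiE_ext)
    show "f \<in> carrier ?P \<rightarrow>\<^sub>E carrier ?P" "etaop \<in> carrier ?P \<rightarrow>\<^sub>E carrier ?P"
      using f g by (simp_all only: good_def)
    fix v assume v: "v \<in> carrier ?P"
    show "f v = etaop v"
    proof (rule additive_eq_on_homogeneous[OF _ etaop_add _ v])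
      fix d v assume v: "v \<in> Dhom d"
      then obtain w where w: "fd_sums n c ?P (Dhom d) (dterm v) w" "f v = dact gens w"
        using f unfolding good_def by blast
      have "w = eulim d v" by (rule fd_sums_unique[OF w(1) eulim_fd_sums[OF v]])
      then show "f v = etaop v" using w gens_eulim[OF v] by simp
    qed (use f in \<open>auto simp: good_def\<close>)
  qed
  ultimately have "(THE f. good f) = etaop" by (rule the_equality)
  then show ?thesis
    unfolding eta_def Let_def Delta_deg_eq good_def dterm_def .
qed

end

section \<open>Localization of the standard module\<close>

text \<open>An operation defined as a union over representatives has the value that all representatives give.\<close>

lemma UN_pair_const:
  assumes "A \<noteq> {}" "\<And>x y. (x, y) \<in> A \<Longrightarrow> f x y = C"
  shows "(\<Union>(x, y)\<in>A. f x y) = C"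
  using assms by fastforce

lemma quotient_times_UNIV: "(A \<times> UNIV) // r = {r `` {(m, k)} | m k. m \<in> A}"
  unfolding quotient_def by blast

context cyclic_cher
begin

abbreviation "Dreg \<equiv> Mreg n c (Delta n c)"

text \<open>The functions whose coordinates are Laurent polynomials.  They are the localization of \<open>\<Delta>\<close>: the
  fraction \<open>x\<^sup>-\<^sup>k m\<close> is the function \<open>evf m k\<close>, and \<open>Frac u\<close> is the set of all ways to write
  \<open>u\<close> as a fraction.\<close>

definition Rfun :: "mfun set" where
  "Rfun = {u \<in> Lfun. \<exists>K p. \<forall>b k. b \<noteq> 0 \<longrightarrow> k < n \<longrightarrow> u b k = poly (p k) b / b ^ K}"

definition evf :: "delta_elt \<Rightarrow> nat \<Rightarrow> mfun" where
  "evf m k = (\<lambda>b j. Phi m b j / b ^ k)"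

text \<open>The derivation \<open>\<xi> - x\<^sup>-\<^sup>1 z = x\<^sup>-\<^sup>1 eu\<close> of the Dunkl embedding, which is \<open>d/db + A/b\<close>.\<close>

definition mD :: "mfun \<Rightarrow> mfun" where
  "mD u = (\<lambda>b k. mEu u b k / b)"

definition Frac :: "mfun \<Rightarrow> (delta_elt \<times> nat) set" where
  "Frac u = {(m, k). m \<in> carrier (Delta n c) \<and> evf m k = u}"

definition rat :: "nat \<Rightarrow> (nat \<Rightarrow> complex poly) \<Rightarrow> mfun" where
  "rat K p = (\<lambda>b k. if b \<noteq> 0 \<and> k < n then poly (p k) b / b ^ K else 0)"

lemma rat_Rfun: "rat K p \<in> Rfun"
proof -
  have "(\<lambda>b. rat K p b k) holomorphic_on - {0}" for k
  proof (cases "k < n")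
    case True
    have "(\<lambda>b. poly (p k) b / b ^ K) holomorphic_on - {0}"
      by (auto intro!: holomorphic_intros)
    then show ?thesis by (rule holomorphic_transform) (use True in \<open>simp add: rat_def\<close>)
  qed (simp add: rat_def)
  then have "rat K p \<in> Lfun" by (simp add: Lfun_def rat_def fin_vecs_def)
  then show ?thesis unfolding Rfun_def by (intro CollectI conjI exI[of _ K] exI[of _ p]) (auto simp: rat_def)
qed

lemma Rfun_rat:
  assumes "u \<in> Rfun" obtains K p where "u = rat K p"
proof -
  obtain K p where p: "\<forall>b k. b \<noteq> 0 \<longrightarrow> k < n \<longrightarrow> u b k = poly (p k) b / b ^ K" and u: "u \<in> Lfun"
    using assms by (auto simp: Rfun_def)
  have "u = rat K p"
    using p u by (intro ext) (auto simp: rat_def Lfun_def fin_vecs_def)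
  then show ?thesis using that by blast
qed

lemma Rfun_Lfun: "u \<in> Rfun \<Longrightarrow> u \<in> Lfun"
  by (simp add: Rfun_def)

lemma Rfun_vec: "u \<in> Rfun \<Longrightarrow> u b \<in> fin_vecs n"
  by (simp add: Rfun_def Lfun_def)

lemma Phi_0 [simp]: "v \<in> carrier (Delta n c) \<Longrightarrow> Phi v 0 = (\<lambda>k. 0)"
  using Phi_Lfun by (simp add: Lfun_def)

lemma evf_Rfun: "m \<in> carrier (Delta n c) \<Longrightarrow> evf m k \<in> Rfun"
proof -
  assume m: "m \<in> carrier (Delta n c)"
  obtain p where p: "m = dact (nf p) u0" using Delta_nf[OF m] .
  have "evf m k = rat (n + k) (\<lambda>j. monom 1 (n - j) * p j)"
    by (intro ext) (auto simp: evf_def p Phi_nf rat_def poly_monom power_diff power_add)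
  then show ?thesis by (simp add: rat_Rfun)
qed

text \<open>In coordinate \<open>j\<close> the numerator is multiplied by \<open>b\<^sup>j\<close> to make up for the pole that \<open>Phi\<close> puts there.\<close>

lemma evf_surj:
  assumes "u \<in> Rfun" obtains m k where "m \<in> carrier (Delta n c)" "evf m k = u"
proof -
  obtain K p where u: "u = rat K p" using Rfun_rat[OF assms] .
  have "evf (dact (nf (\<lambda>j. monom 1 j * p j)) u0) K = u"
    by (intro ext) (auto simp: evf_def u Phi_nf rat_def poly_monom)
  then show ?thesis using that P.act_closed[OF u0_carrier] by blast
qed

lemma Rfun_cases:
  assumes "u \<in> Rfun" obtains m k where "m \<in> carrier (Delta n c)" "u = evf m k"
  using evf_surj[OF assms] by metis

lemma Phi_genx_power: "m \<in> carrier (Delta n c) \<Longrightarrow> Phi (dact (genx ^ i) m) = (\<lambda>b k. b ^ i * Phi m b k)"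
  by (simp add: Phi_act mop_genx_power Phi_Lfun)

lemma loc_rel_iff:
  "((m, k), (m', k')) \<in> loc_rel n c (Delta n c) \<longleftrightarrow>
    m \<in> carrier (Delta n c) \<and> m' \<in> carrier (Delta n c) \<and> evf m k = evf m' k'"
proof -
  have "(\<exists>l. dact (genx ^ (l + k')) m = dact (genx ^ (l + k)) m') \<longleftrightarrow> evf m k = evf m' k'"
    if m: "m \<in> carrier (Delta n c)" "m' \<in> carrier (Delta n c)"
  proof
    assume "\<exists>l. dact (genx ^ (l + k')) m = dact (genx ^ (l + k)) m'"
    then obtain l where l: "dact (genx ^ (l + k')) m = dact (genx ^ (l + k)) m'" by blast
    show "evf m k = evf m' k'"
    proof (intro ext)
      fix b j
      have "b ^ (l + k') * Phi m b j = b ^ (l + k) * Phi m' b j"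
        using arg_cong[OF l, of Phi] m by (simp add: Phi_genx_power fun_eq_iff)
      then show "evf m k b j = evf m' k' b j"
        using m by (cases "b = 0") (auto simp: evf_def power_add field_simps)
    qed
  next
    assume e: "evf m k = evf m' k'"
    have "dact (genx ^ (0 + k')) m = dact (genx ^ (0 + k)) m'"
    proof (rule Phi_inj)
      show "Phi (dact (genx ^ (0 + k')) m) = Phi (dact (genx ^ (0 + k)) m')"
      proof (intro ext)
        fix b j
        show "Phi (dact (genx ^ (0 + k')) m) b j = Phi (dact (genx ^ (0 + k)) m') b j"
          using fun_cong[OF fun_cong[OF e, of b], of j] m
          by (cases "b = 0") (auto simp: Phi_genx_power evf_def field_simps)
      qed
    qed (use m in \<open>auto intro: P.act_closed\<close>)
    then show "\<exists>l. dact (genx ^ (l + k')) m = dact (genx ^ (l + k)) m'" by blast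
  qed
  then show ?thesis by (auto simp: loc_rel_def)
qed

lemma frac_Frac: "m \<in> carrier (Delta n c) \<Longrightarrow> frac n c (Delta n c) m k = Frac (evf m k)"
  by (auto simp: frac_def Frac_def loc_rel_iff)

lemma Frac_memD: "(m, k) \<in> Frac u \<Longrightarrow> m \<in> carrier (Delta n c) \<and> evf m k = u"
  by (simp add: Frac_def)

lemma Frac_nonempty: "u \<in> Rfun \<Longrightarrow> Frac u \<noteq> {}"
proof -
  assume "u \<in> Rfun"
  then obtain m k where "m \<in> carrier (Delta n c)" "evf m k = u" by (rule evf_surj)
  then have "(m, k) \<in> Frac u" by (simp add: Frac_def)
  then show ?thesis by blast
qed

lemma Frac_inj: "\<lbrakk>u \<in> Rfun; v \<in> Rfun; Frac u = Frac v\<rbrakk> \<Longrightarrow> u = v"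
proof -
  assume u: "u \<in> Rfun" and eq: "Frac u = Frac v"
  obtain m k where mk: "(m, k) \<in> Frac u" using Frac_nonempty[OF u] by fast
  then have "(m, k) \<in> Frac v" unfolding eq .
  from Frac_memD[OF mk] Frac_memD[OF this] show "u = v" by metis
qed

lemma Dreg_carrier: "carrier Dreg = Frac ` Rfun"
proof -
  have "carrier Dreg = {frac n c (Delta n c) m k | m k. m \<in> carrier (Delta n c)}"
    unfolding frac_def quotient_times_UNIV[symmetric] by (simp add: Mreg_def)
  also have "\<dots> = Frac ` Rfun"
  proof (intro subset_antisym subsetI)
    fix x assume "x \<in> {frac n c (Delta n c) m k | m k. m \<in> carrier (Delta n c)}"
    then obtain m k where "x = Frac (evf m k)" "m \<in> carrier (Delta n c)" using frac_Frac by blast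
    then show "x \<in> Frac ` Rfun" using evf_Rfun by blast
  next
    fix x assume "x \<in> Frac ` Rfun"
    then obtain u where u: "u \<in> Rfun" "x = Frac u" by blast
    then obtain m k where m: "m \<in> carrier (Delta n c)" "u = evf m k" by (blast elim: Rfun_cases)
    then have "x = frac n c (Delta n c) m k" using u(2) by (simp add: frac_Frac)
    then show "x \<in> {frac n c (Delta n c) m k | m k. m \<in> carrier (Delta n c)}" using m(1) by blast
  qed
  finally show ?thesis .
qed

lemma evf_add:
  "\<lbrakk>m \<in> carrier (Delta n c); m' \<in> carrier (Delta n c)\<rbrakk> \<Longrightarrow>
    evf (dact (genx ^ k') m \<oplus>\<^bsub>Delta n c\<^esub> dact (genx ^ k) m') (k + k') = mlin 1 (evf m k) 1 (evf m' k')"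
proof (intro ext)
  fix b j assume m: "m \<in> carrier (Delta n c)" "m' \<in> carrier (Delta n c)"
  show "evf (dact (genx ^ k') m \<oplus>\<^bsub>Delta n c\<^esub> dact (genx ^ k) m') (k + k') b j = mlin 1 (evf m k) 1 (evf m' k') b j"
  proof (cases "b = 0")
    case False
    have "b ^ k' * x / b ^ (k + k') = x / b ^ k" "b ^ k * x / b ^ (k + k') = x / b ^ k'" for x
      using False by (simp_all add: power_add)
    then show ?thesis using m
      by (simp add: evf_def Phi_add P.act_closed Phi_genx_power mlin_def add_divide_distrib)
  qed (use m in \<open>simp add: evf_def mlin_def P.act_closed\<close>)
qed

lemma evf_scal: "m \<in> carrier (Delta n c) \<Longrightarrow> evf (dact (scal z) m) k = mlin z (evf m k) 0 (evf m k)"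
  by (intro ext) (simp add: evf_def Phi_act mop_gens mlin_def)

lemma evf_genx: "m \<in> carrier (Delta n c) \<Longrightarrow> evf (dact genx m) k = mX (evf m k)"
  by (intro ext) (simp add: evf_def Phi_act mop_gens mX_def)

lemma evf_gens: "m \<in> carrier (Delta n c) \<Longrightarrow> evf (dact (scal (q ^ k) * gens) m) k = mS (evf m k)"
  by (intro ext) (simp add: evf_def Phi_act mop_mult Phi_Lfun mop_gens mS_def power_divide)

lemma evf_D:
  assumes m: "m \<in> carrier (Delta n c)"
  shows "evf (dact (genx * genxi - zel n c - scal (of_nat k)) m) (k + 1) = mD (evf m k)"
proof (intro ext)
  fix b j
  have P: "Phi (dact (genx * genxi - zel n c - scal (of_nat k)) m) b j = mEu (Phi m) b j - of_nat k * Phi m b j"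
    using m by (simp add: eu_def[symmetric] Phi_act mop_diff mop_eu Phi_Lfun mop_gens mlin_def)
  show "evf (dact (genx * genxi - zel n c - scal (of_nat k)) m) (k + 1) b j = mD (evf m k) b j"
  proof (cases "b = 0")
    case False
    have "((\<lambda>b. Phi m b j / b ^ k) has_field_derivative
       (deriv (\<lambda>b. Phi m b j) b * b ^ k - Phi m b j * (of_nat k * b ^ (k - 1))) / (b ^ k * b ^ k)) (at b)"
      using False by (intro DERIV_divide Lfun_deriv Phi_Lfun m) (auto intro!: derivative_eq_intros)
    then have "deriv (\<lambda>b. evf m k b j) b
      = (deriv (\<lambda>b. Phi m b j) b * b ^ k - Phi m b j * (of_nat k * b ^ (k - 1))) / (b ^ k * b ^ k)"
      unfolding evf_def by (rule DERIV_imp_deriv)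
    also have "\<dots> = deriv (\<lambda>b. Phi m b j) b / b ^ k - of_nat k * Phi m b j / b ^ (k + 1)"
      using False by (cases k) (auto simp: field_simps)
    finally have d: "deriv (\<lambda>b. evf m k b j) b = deriv (\<lambda>b. Phi m b j) b / b ^ k - of_nat k * Phi m b j / b ^ (k + 1)" .
    have bd: "bidiag n ev (evf m k b) j = bidiag n ev (Phi m b) j / b ^ k"
      by (simp add: bidiag_def evf_def add_divide_distrib)
    have "evf (dact (genx * genxi - zel n c - scal (of_nat k)) m) (k + 1) b j
        = (mEu (Phi m) b j - of_nat k * Phi m b j) / b ^ (k + 1)"
      unfolding evf_def P ..
    also have "\<dots> = mD (evf m k) b j"
    proof -
      have "(b * D + A - K) / (p * b) = (b * (D / p - K / (p * b)) + A / p) / b" if "p \<noteq> 0" for D A K p :: complex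
        using that False by (simp add: divide_simps)
      from this[of "b ^ k" "deriv (\<lambda>b. Phi m b j) b" "bidiag n ev (Phi m b) j" "of_nat k * Phi m b j"]
      show ?thesis using False by (simp add: mD_def mEu_def d bd power_add mult.commute)
    qed
    finally show ?thesis .
  qed (simp add: evf_def mD_def)
qed

text \<open>The operations of the localization transform numerator and denominator of a fraction.  They are computed
  by their effect \<open>H\<close> on functions.\<close>

lemma frac_UN:
  assumes u: "u \<in> Rfun"
    and g: "\<And>m k. m \<in> carrier (Delta n c) \<Longrightarrow> g m k \<in> carrier (Delta n c) \<and> evf (g m k) (h k) = H (evf m k)"
  shows "(\<Union>(m, k)\<in>Frac u. frac n c (Delta n c) (g m k) (h k)) = Frac (H u)" "H u \<in> Rfun"
proof -
  show "(\<Union>(m, k)\<in>Frac u. frac n c (Delta n c) (g m k) (h k)) = Frac (H u)"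
    by (rule UN_pair_const[OF Frac_nonempty[OF u]], drule Frac_memD) (auto simp: frac_Frac g)
  obtain m k where "m \<in> carrier (Delta n c)" "u = evf m k" using Rfun_cases[OF u] .
  then show "H u \<in> Rfun" using g[of m k] evf_Rfun[of "g m k" "h k"] by simp
qed

lemma
  assumes u: "u \<in> Rfun"
  shows Dreg_smult: "z \<odot>\<^bsub>Dreg\<^esub> Frac u = Frac (mlin z u 0 u)" and Rfun_scale: "mlin z u 0 u \<in> Rfun"
  using frac_UN[OF u, where g = "\<lambda>m k. dact (scal z) m" and h = "\<lambda>k. k" and H = "\<lambda>u. mlin z u 0 u"]
  by (simp_all add: Mreg_def evf_scal P.act_closed)

lemma
  assumes u: "u \<in> Rfun"
  shows Dreg_opx: "opx Dreg (Frac u) = Frac (mX u)" and Rfun_mX: "mX u \<in> Rfun"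
  using frac_UN[OF u, where g = "\<lambda>m k. dact genx m" and h = "\<lambda>k. k" and H = mX]
  by (simp_all add: Mreg_def evf_genx P.act_closed)

lemma
  assumes u: "u \<in> Rfun"
  shows Dreg_ops: "ops Dreg (Frac u) = Frac (mS u)" and Rfun_mS: "mS u \<in> Rfun"
  using frac_UN[OF u, where g = "\<lambda>m k. dact (scal (q ^ k) * gens) m" and h = "\<lambda>k. k" and H = mS]
  by (simp_all add: Mreg_def evf_gens P.act_closed)

lemma
  assumes u: "u \<in> Rfun"
  shows Dreg_opd: "opd Dreg (Frac u) = Frac (mD u)" and Rfun_mD: "mD u \<in> Rfun"
  using frac_UN[OF u, where g = "\<lambda>m k. dact (genx * genxi - zel n c - scal (of_nat k)) m"
      and h = "\<lambda>k. k + 1" and H = mD]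
  by (simp_all only: Mreg_def evf_D P.act_closed dmod.simps simp_thms)

lemma Rfun_mlin: "\<lbrakk>u \<in> Rfun; v \<in> Rfun\<rbrakk> \<Longrightarrow> mlin x u y v \<in> Rfun"
proof -
  have a: "mlin 1 u 1 v \<in> Rfun" if "u \<in> Rfun" "v \<in> Rfun" for u v
    using that by (auto elim!: Rfun_cases simp: evf_add[symmetric] evf_Rfun P.act_closed)
  assume "u \<in> Rfun" "v \<in> Rfun"
  from a[OF Rfun_scale[OF this(1), of x] Rfun_scale[OF this(2), of y]] show ?thesis by (simp add: mlin_def)
qed

lemma Rfun_zero: "(\<lambda>b k. 0) \<in> Rfun"
proof -
  have "rat 0 (\<lambda>k. 0) = (\<lambda>b k. 0)" by (auto simp: rat_def fun_eq_iff)
  then show ?thesis using rat_Rfun[of 0 "\<lambda>k. 0"] by simp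
qed

lemma Dreg_zero: "\<zero>\<^bsub>Dreg\<^esub> = Frac (\<lambda>b k. 0)"
proof -
  have "evf \<zero>\<^bsub>Delta n c\<^esub> 0 = (\<lambda>b k. 0)" by (simp add: evf_def Phi_zero)
  then show ?thesis by (simp add: Mreg_def frac_Frac)
qed

lemma Dreg_add:
  assumes "u \<in> Rfun" "v \<in> Rfun"
  shows "Frac u \<oplus>\<^bsub>Dreg\<^esub> Frac v = Frac (mlin 1 u 1 v)"
proof -
  have "Frac u \<oplus>\<^bsub>Dreg\<^esub> Frac v = (\<Union>(m, k)\<in>Frac u. \<Union>(m', k')\<in>Frac v.
        frac n c (Delta n c) (dact (genx ^ k') m \<oplus>\<^bsub>Delta n c\<^esub> dact (genx ^ k) m') (k + k'))"
    by (simp add: Mreg_def)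
  also have "\<dots> = Frac (mlin 1 u 1 v)"
    by (rule UN_pair_const[OF Frac_nonempty[OF assms(1)]], rule UN_pair_const[OF Frac_nonempty[OF assms(2)]])
       ((drule Frac_memD)+, auto simp: frac_Frac P.act_closed evf_add)
  finally show ?thesis .
qed

lemma mlin_plus: "mlin 1 u 1 v = u + v" "mlin 1 u (- 1) v = u - v"
  by (simp_all add: mlin_def fun_eq_iff)

lemma
  shows Dreg_abelian_group: "abelian_group Dreg"
    and Dreg_finsum: "(\<And>i. i < r \<Longrightarrow> u i \<in> Rfun) \<Longrightarrow>
      (\<Oplus>\<^bsub>Dreg\<^esub>i\<in>{..<r::nat}. Frac (u i)) = Frac (\<lambda>b k. \<Sum>i<r. u i b k) \<and> (\<lambda>b k. \<Sum>i<r. u i b k) \<in> Rfun"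
proof -
  have z: "(\<lambda>b k. 0) = (0 :: mfun)" by (simp add: fun_eq_iff)
  have d: "u - v \<in> Rfun" if "u \<in> Rfun" "v \<in> Rfun" for u v
    using Rfun_mlin[OF that, of 1 "- 1"] by (simp add: mlin_plus)
  have add: "Frac u \<oplus>\<^bsub>Dreg\<^esub> Frac v = Frac (u + v)" if "u \<in> Rfun" "v \<in> Rfun" for u v
    using Dreg_add[OF that] by (simp add: mlin_plus)
  note ab = abelian_group_image[OF Dreg_carrier Dreg_zero[unfolded z] add Rfun_zero[unfolded z] d]
  show "abelian_group Dreg" by (rule ab(1))
  have "(\<lambda>b k. \<Sum>i<r. u i b k) = (\<Sum>i<r. u i)" by (simp add: fun_eq_iff sum_fun_apply)
  then show "(\<Oplus>\<^bsub>Dreg\<^esub>i\<in>{..<r}. Frac (u i)) = Frac (\<lambda>b k. \<Sum>i<r. u i b k) \<and> (\<lambda>b k. \<Sum>i<r. u i b k) \<in> Rfun"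
    if r: "\<And>i. i < r \<Longrightarrow> u i \<in> Rfun"
  proof -
    have "(\<Oplus>\<^bsub>Dreg\<^esub>i\<in>{..<r}. Frac (u i)) = Frac (\<Sum>i<r. u i) \<and> (\<Sum>i<r. u i) \<in> Rfun"
      by (rule ab(2)) (use r in auto)
    then show ?thesis by (simp only: \<open>(\<lambda>b k. \<Sum>i<r. u i b k) = (\<Sum>i<r. u i)\<close>)
  qed
qed

subsection \<open>Fibres\<close>

text \<open>The element of the fibre at \<open>b\<close> with value \<open>y\<close>.  Evaluation at \<open>b\<close> thus identifies the fibre with
  \<open>\<complex>\<^sup>n\<close>.\<close>

definition Fib :: "complex \<Rightarrow> (nat \<Rightarrow> complex) \<Rightarrow> (delta_elt \<times> nat) set set" where
  "Fib b y = {Frac u | u. u \<in> Rfun \<and> u b = y}"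

text \<open>A Laurent polynomial that vanishes at \<open>b\<close> is divisible by \<open>x - b\<close>.\<close>

lemma fib_Fib:
  assumes b: "b \<noteq> 0" and u: "u \<in> Rfun"
  shows "fib Dreg b (Frac u) = Fib b (u b)"
proof
  have fib: "fib Dreg b (Frac u) = {Frac (mlin 1 (mlin 1 (mX w) (- b) w) 1 u) | w. w \<in> Rfun}"
  proof -
    have "opx Dreg (Frac w) \<oplus>\<^bsub>Dreg\<^esub> (- b) \<odot>\<^bsub>Dreg\<^esub> Frac w \<oplus>\<^bsub>Dreg\<^esub> Frac u = Frac (mlin 1 (mlin 1 (mX w) (- b) w) 1 u)"
      if "w \<in> Rfun" for w
      using that u by (simp add: Dreg_opx Dreg_smult Dreg_add Rfun_mX Rfun_mlin) (simp add: mlin_def)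
    then show ?thesis
      unfolding fib_def a_r_coset_def r_coset_def Dreg_carrier by auto
  qed
  show "fib Dreg b (Frac u) \<subseteq> Fib b (u b)"
  proof
    fix x assume "x \<in> fib Dreg b (Frac u)"
    then obtain w where w: "w \<in> Rfun" "x = Frac (mlin 1 (mlin 1 (mX w) (- b) w) 1 u)" unfolding fib by blast
    have "mlin 1 (mlin 1 (mX w) (- b) w) 1 u \<in> Rfun" using u w by (intro Rfun_mlin Rfun_mX)
    moreover have "mlin 1 (mlin 1 (mX w) (- b) w) 1 u b = u b" by (simp add: mlin_def mX_def)
    ultimately show "x \<in> Fib b (u b)" unfolding Fib_def w(2) by blast
  qed
  show "Fib b (u b) \<subseteq> fib Dreg b (Frac u)"
  proof
    fix x assume "x \<in> Fib b (u b)"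
    then obtain v where v: "x = Frac v" "v \<in> Rfun" "v b = u b" by (auto simp: Fib_def)
    obtain K p where p: "mlin 1 v (- 1) u = rat K p"
      using Rfun_rat[OF Rfun_mlin[OF v(2) u]] by metis
    have "\<exists>r. p k = [:- b, 1:] * r" if "k < n" for k
    proof -
      have "rat K p b k = 0" unfolding p[symmetric] using v(3) by (simp add: mlin_def)
      then have "poly (p k) b = 0" using that b by (simp add: rat_def)
      then show ?thesis unfolding poly_eq_0_iff_dvd dvd_def .
    qed
    then obtain r where r: "\<And>k. k < n \<Longrightarrow> p k = [:- b, 1:] * r k" by metis
    have "v = mlin 1 (mlin 1 (mX (rat K r)) (- b) (rat K r)) 1 u"
    proof (intro ext)
      fix y k
      have "v y k = rat K p y k + u y k" unfolding p[symmetric] by (simp add: mlin_def)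
      also have "rat K p y k = y * rat K r y k - b * rat K r y k"
        by (auto simp: rat_def r field_simps)
      finally show "v y k = mlin 1 (mlin 1 (mX (rat K r)) (- b) (rat K r)) 1 u y k"
        by (simp add: mlin_def mX_def)
    qed
    then show "x \<in> fib Dreg b (Frac u)" unfolding fib v(1) using rat_Rfun by blast
  qed
qed

text \<open>Constant functions trivialize the bundle.\<close>

definition constf :: "(nat \<Rightarrow> complex) \<Rightarrow> mfun" where
  "constf y = (\<lambda>b k. if b = 0 then 0 else y k)"

lemma constf_Rfun: "y \<in> fin_vecs n \<Longrightarrow> constf y \<in> Rfun"
proof -
  assume "y \<in> fin_vecs n"
  then have "constf y = rat 0 (\<lambda>k. [:y k:])"
    by (auto simp: constf_def rat_def fin_vecs_def fun_eq_iff)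
  then show ?thesis by (simp add: rat_Rfun)
qed

lemma Fib_inj:
  assumes "b \<noteq> 0" "y \<in> fin_vecs n" "Fib b y = Fib b y'"
  shows "y = y'"
proof -
  have y: "constf y \<in> Rfun" "constf y b = y" using assms constf_Rfun by (auto simp: constf_def)
  then have "Frac (constf y) \<in> Fib b y'" unfolding assms(3)[symmetric] by (auto simp: Fib_def)
  then show ?thesis using Frac_inj[OF y(1)] y(2) by (auto simp: Fib_def)
qed

lemma Fib_nonempty: "\<lbrakk>b \<noteq> 0; y \<in> fin_vecs n\<rbrakk> \<Longrightarrow> Fib b y \<noteq> {}"
  using constf_Rfun[of y] by (auto simp: Fib_def constf_def intro!: exI[of _ "constf y"])

lemma fib_zero: "b \<noteq> 0 \<Longrightarrow> fib Dreg b \<zero>\<^bsub>Dreg\<^esub> = Fib b (\<lambda>k. 0)"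
  by (simp add: Dreg_zero fib_Fib Rfun_zero)

lemma q_pow_inv: "b / q ^ (n - 1) = q * b"
proof -
  have "q * q ^ (n - 1) = 1" using n0 q_n by (metis One_nat_def Suc_pred power_Suc)
  then show ?thesis by (simp add: field_simps)
qed

text \<open>As \<open>s\<close> sends \<open>u\<close> to \<open>u(b/q)\<close>, it carries the fibre at \<open>b\<close> to the fibre at \<open>q b\<close> and preserves
  values.  Hence invariance of a section means \<open>F(q b) = F(b)\<close>.\<close>

lemma ops_Fib: "b \<noteq> 0 \<Longrightarrow> ops Dreg ` Fib b y = Fib (q * b) y"
proof
  show "ops Dreg ` Fib b y \<subseteq> Fib (q * b) y"
    by (force simp: Fib_def Dreg_ops Rfun_mS mS_def fun_eq_iff)
  show "Fib (q * b) y \<subseteq> ops Dreg ` Fib b y"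
  proof
    fix x assume "x \<in> Fib (q * b) y"
    then obtain v where v: "x = Frac v" "v \<in> Rfun" "v (q * b) = y" by (auto simp: Fib_def)
    have R: "(mS ^^ m) v \<in> Rfun" for m by (induction m) (auto simp: v Rfun_mS)
    have S: "(mS ^^ m) v = (\<lambda>b. v (b / q ^ m))" for m
      by (induction m) (auto simp: mS_def fun_eq_iff)
    have "mS ((mS ^^ (n - 1)) v) = (mS ^^ n) v"
      using n0 by (metis One_nat_def Suc_pred comp_apply funpow.simps(2))
    then have "mS ((mS ^^ (n - 1)) v) = v" by (simp add: S[of n])
    moreover have "(mS ^^ (n - 1)) v b = y" using v(3) q_pow_inv[of b] by (simp only: S)
    ultimately show "x \<in> ops Dreg ` Fib b y"
      using Dreg_ops[OF R[of "n - 1"]] R[of "n - 1"] by (force simp: Fib_def v(1))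
  qed
qed

subsection \<open>Horizontal sections\<close>

text \<open>The invariant solutions of \<open>\<nabla>F = F' + A F / b = 0\<close>, in the trivialization by constant functions.\<close>

definition hsol :: "complex set \<Rightarrow> mfun \<Rightarrow> bool" where
  "hsol U F \<longleftrightarrow> (\<forall>b\<in>U. F b \<in> fin_vecs n) \<and>
    (\<forall>b\<in>U. \<forall>k. ((\<lambda>b. F b k) has_field_derivative - bidiag n ev (F b) k / b) (at b)) \<and>
    (\<forall>b\<in>U. F (q * b) = F b)"

definition sec :: "complex set \<Rightarrow> mfun \<Rightarrow> complex set \<times> (complex \<Rightarrow> (delta_elt \<times> nat) set set)" where
  "sec U F = (U, \<lambda>b\<in>U. Fib b (F b))"

lemma bidiag_sum: "bidiag n ev (\<lambda>k. \<Sum>i\<in>A. x i * v i k) k = (\<Sum>i\<in>A. x i * bidiag n ev (v i) k)"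
  by (cases "k < n"; cases "k = 0") (simp_all add: bidiag_def sum_distrib_left sum.distrib distrib_left mult_ac)

text \<open>Finite sums \<open>\<Sum> f\<^sub>i m\<^sub>i\<close> and their covariant derivatives, evaluated in the fibre at \<open>b\<close>.\<close>

lemma has_nabla_finsum:
  assumes u: "\<And>i. i < r \<Longrightarrow> u i \<in> Rfun" and b: "b \<noteq> 0"
  shows "fib Dreg b (\<Oplus>\<^bsub>Dreg\<^esub>i\<in>{..<r::nat}. x i \<odot>\<^bsub>Dreg\<^esub> Frac (u i)) = Fib b (\<lambda>k. \<Sum>i<r. x i * u i b k)"
    and "fib Dreg b (\<Oplus>\<^bsub>Dreg\<^esub>i\<in>{..<r::nat}. x' i \<odot>\<^bsub>Dreg\<^esub> Frac (u i) \<oplus>\<^bsub>Dreg\<^esub> x i \<odot>\<^bsub>Dreg\<^esub> opd Dreg (Frac (u i)))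
      = Fib b (\<lambda>k. \<Sum>i<r. x' i * u i b k + x i * mD (u i) b k)"
proof -
  interpret Dreg: abelian_group Dreg by (rule Dreg_abelian_group)
  have "(\<Oplus>\<^bsub>Dreg\<^esub>i\<in>{..<r}. x i \<odot>\<^bsub>Dreg\<^esub> Frac (u i)) = (\<Oplus>\<^bsub>Dreg\<^esub>i\<in>{..<r}. Frac (mlin (x i) (u i) 0 (u i)))"
    by (rule Dreg.finsum_cong') (auto simp: Dreg_smult u Dreg_carrier Rfun_mlin)
  then show "fib Dreg b (\<Oplus>\<^bsub>Dreg\<^esub>i\<in>{..<r}. x i \<odot>\<^bsub>Dreg\<^esub> Frac (u i)) = Fib b (\<lambda>k. \<Sum>i<r. x i * u i b k)"
    using Dreg_finsum[of r "\<lambda>i. mlin (x i) (u i) 0 (u i)"] u b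
    by (simp add: Rfun_mlin fib_Fib) (simp add: mlin_def)
  have "(\<Oplus>\<^bsub>Dreg\<^esub>i\<in>{..<r}. x' i \<odot>\<^bsub>Dreg\<^esub> Frac (u i) \<oplus>\<^bsub>Dreg\<^esub> x i \<odot>\<^bsub>Dreg\<^esub> opd Dreg (Frac (u i)))
     = (\<Oplus>\<^bsub>Dreg\<^esub>i\<in>{..<r}. Frac (mlin (x' i) (u i) (x i) (mD (u i))))"
  proof (rule Dreg.finsum_cong')
    fix i assume "i \<in> {..<r}"
    then have ui: "u i \<in> Rfun" using u by simp
    then show "x' i \<odot>\<^bsub>Dreg\<^esub> Frac (u i) \<oplus>\<^bsub>Dreg\<^esub> x i \<odot>\<^bsub>Dreg\<^esub> opd Dreg (Frac (u i)) = Frac (mlin (x' i) (u i) (x i) (mD (u i)))"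
      by (simp add: Dreg_smult Dreg_opd Dreg_add Rfun_mD Rfun_mlin) (simp add: mlin_def)
  qed (auto simp: Dreg_carrier Rfun_mlin Rfun_mD u)
  then show "fib Dreg b (\<Oplus>\<^bsub>Dreg\<^esub>i\<in>{..<r}. x' i \<odot>\<^bsub>Dreg\<^esub> Frac (u i) \<oplus>\<^bsub>Dreg\<^esub> x i \<odot>\<^bsub>Dreg\<^esub> opd Dreg (Frac (u i)))
      = Fib b (\<lambda>k. \<Sum>i<r. x' i * u i b k + x i * mD (u i) b k)"
    using Dreg_finsum[of r "\<lambda>i. mlin (x' i) (u i) (x i) (mD (u i))"] u b
    by (simp add: Rfun_mlin Rfun_mD fib_Fib) (simp add: mlin_def)
qed

text \<open>Written as \<open>\<Sum> F\<^sub>i e\<^sub>i\<close> in the constant sections \<open>e\<^sub>i\<close>, a solution of the differential equation is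
  annihilated by the connection, since \<open>\<nabla>e\<^sub>i = A e\<^sub>i / b\<close>.\<close>

lemma sec_hor:
  assumes U: "inv_open n U" and F: "hsol U F"
  shows "sec U F \<in> hor_sections n Dreg"
proof -
  have U0: "b \<noteq> 0" if "b \<in> U" for b using U that by (auto simp: inv_open_def)
  have oU: "open U" using U by (simp add: inv_open_def)
  have der: "((\<lambda>b. F b k) has_field_derivative - bidiag n ev (F b) k / b) (at b)" if "b \<in> U" for b k
    using F that by (simp add: hsol_def)
  define m where "m i = Frac (constf (unit_vec i))" for i
  have cu: "constf (unit_vec i) \<in> Rfun" if "i < n" for i
    by (rule constf_Rfun[OF unit_vec_fin_vecs[OF that]])
  have sumF: "(\<Sum>i<n. F b i * unit_vec i k) = F b k" if "b \<in> U" for b k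
  proof -
    have "(\<Sum>i<n. F b i * unit_vec i k) = (\<Sum>i<n. if i = k then F b k else 0)"
      by (rule sum.cong) (auto simp: unit_vec_def)
    also have "\<dots> = F b k" using F that by (auto simp: hsol_def fin_vecs_def)
    finally show ?thesis .
  qed
  have "has_nabla Dreg U (\<lambda>b\<in>U. Fib b (F b)) (\<lambda>b. fib Dreg b \<zero>\<^bsub>Dreg\<^esub>)"
    unfolding has_nabla_def
  proof (intro ballI)
    fix a assume a: "a \<in> U"
    have "(\<forall>i<n. (\<lambda>b. F b i) holomorphic_on U \<and> m i \<in> carrier Dreg) \<and>
     (\<forall>b\<in>U. (\<lambda>b\<in>U. Fib b (F b)) b = fib Dreg b (\<Oplus>\<^bsub>Dreg\<^esub>i\<in>{..<n}. F b i \<odot>\<^bsub>Dreg\<^esub> m i) \<and>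
             fib Dreg b \<zero>\<^bsub>Dreg\<^esub> = fib Dreg b (\<Oplus>\<^bsub>Dreg\<^esub>i\<in>{..<n}.
                 deriv (\<lambda>b. F b i) b \<odot>\<^bsub>Dreg\<^esub> m i \<oplus>\<^bsub>Dreg\<^esub> F b i \<odot>\<^bsub>Dreg\<^esub> opd Dreg (m i)))"
    proof (intro conjI allI impI ballI)
      show "(\<lambda>b. F b i) holomorphic_on U" for i
        unfolding holomorphic_on_open[OF oU] using der by blast
      show "m i \<in> carrier Dreg" if "i < n" for i using cu[OF that] by (auto simp: m_def Dreg_carrier)
      fix b assume b: "b \<in> U"
      have "(\<Sum>i<n. F b i * constf (unit_vec i) b k) = F b k" for k
        using sumF[OF b] U0[OF b] by (simp add: constf_def)
      then show "(\<lambda>b\<in>U. Fib b (F b)) b = fib Dreg b (\<Oplus>\<^bsub>Dreg\<^esub>i\<in>{..<n}. F b i \<odot>\<^bsub>Dreg\<^esub> m i)"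
        unfolding m_def using b has_nabla_finsum(1)[of n "\<lambda>i. constf (unit_vec i)" b "F b"] cu U0[OF b] by simp
      have D: "mD (constf (unit_vec i)) b k = bidiag n ev (unit_vec i) k / b" if "i < n" for i k
      proof -
        have "mEu (constf (unit_vec i)) = mEu (hv 0 (unit_vec i))"
          by (rule arg_cong[of _ _ mEu]) (auto simp: constf_def hv_def fun_eq_iff)
        also have "\<dots> = hv 0 (bidiag n ev (unit_vec i))"
          using mEu_hv[OF unit_vec_fin_vecs[OF that], of 0] by simp
        finally show ?thesis using U0[OF b] by (simp add: mD_def hv_def)
      qed
      have "(\<Sum>i<n. deriv (\<lambda>b. F b i) b * constf (unit_vec i) b k + F b i * mD (constf (unit_vec i)) b k) = 0" for k
      proof -
        have "(\<Sum>i<n. deriv (\<lambda>b. F b i) b * constf (unit_vec i) b k) = - bidiag n ev (F b) k / b"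
        proof -
          have "(\<Sum>i<n. deriv (\<lambda>b. F b i) b * constf (unit_vec i) b k)
            = (\<Sum>i<n. if i = k then - bidiag n ev (F b) k / b else 0)"
            using U0[OF b] DERIV_imp_deriv[OF der[OF b]]
            by (intro sum.cong) (auto simp: constf_def unit_vec_def)
          also have "\<dots> = - bidiag n ev (F b) k / b"
          proof (cases "k < n")
            case False
            then have "bidiag n ev (F b) k = 0" by (simp add: bidiag_def)
            then show ?thesis by simp
          qed simp
          finally show ?thesis .
        qed
        moreover have "(\<Sum>i<n. F b i * mD (constf (unit_vec i)) b k) = bidiag n ev (F b) k / b"
        proof -
          have "(\<Sum>i<n. F b i * mD (constf (unit_vec i)) b k) = (\<Sum>i<n. F b i * bidiag n ev (unit_vec i) k) / b"
            unfolding sum_divide_distrib by (rule sum.cong) (simp_all add: D)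
          also have "(\<Sum>i<n. F b i * bidiag n ev (unit_vec i) k) = bidiag n ev (\<lambda>k. \<Sum>i<n. F b i * unit_vec i k) k"
            by (rule bidiag_sum[symmetric])
          finally show ?thesis using sumF[OF b] by simp
        qed
        ultimately show ?thesis by (simp add: sum.distrib)
      qed
      then show "fib Dreg b \<zero>\<^bsub>Dreg\<^esub> = fib Dreg b (\<Oplus>\<^bsub>Dreg\<^esub>i\<in>{..<n}.
                 deriv (\<lambda>b. F b i) b \<odot>\<^bsub>Dreg\<^esub> m i \<oplus>\<^bsub>Dreg\<^esub> F b i \<odot>\<^bsub>Dreg\<^esub> opd Dreg (m i))"
        unfolding m_def
        using has_nabla_finsum(2)[of n "\<lambda>i. constf (unit_vec i)" b "\<lambda>i. deriv (\<lambda>b. F b i) b" "F b"] cu U0[OF b]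
        by (simp add: fib_zero)
    qed
    then show "\<exists>B r f m. open B \<and> a \<in> B \<and> B \<subseteq> U \<and>
     (\<forall>i<r. f i holomorphic_on B \<and> m i \<in> carrier Dreg) \<and>
     (\<forall>b\<in>B. (\<lambda>b\<in>U. Fib b (F b)) b = fib Dreg b (\<Oplus>\<^bsub>Dreg\<^esub>i\<in>{..<r::nat}. f i b \<odot>\<^bsub>Dreg\<^esub> m i) \<and>
             fib Dreg b \<zero>\<^bsub>Dreg\<^esub> = fib Dreg b (\<Oplus>\<^bsub>Dreg\<^esub>i\<in>{..<r}.
                 deriv (f i) b \<odot>\<^bsub>Dreg\<^esub> m i \<oplus>\<^bsub>Dreg\<^esub> f i b \<odot>\<^bsub>Dreg\<^esub> opd Dreg (m i)))"
      using oU a by (intro exI[of _ U] exI[of _ n] exI[of _ "\<lambda>i b. F b i"] exI[of _ m]) simp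
  qed
  moreover have "(\<lambda>b\<in>U. Fib b (F b)) (q * a) = ops Dreg ` (\<lambda>b\<in>U. Fib b (F b)) a" if "a \<in> U" for a
  proof -
    have "q * a \<in> U" using U that by (simp add: inv_open_def)
    then show ?thesis using F that U0[OF that] by (simp add: ops_Fib hsol_def)
  qed
  ultimately show ?thesis
    using U by (simp add: hor_sections_def sec_def)
qed

text \<open>Locally a section is a sum \<open>\<Sum> f\<^sub>i m\<^sub>i\<close> with Laurent polynomials \<open>m\<^sub>i\<close>, hence a holomorphic function
  \<open>G\<close> to \<open>\<complex>\<^sup>n\<close>, and horizontality is the differential equation for \<open>G\<close>.  The local functions fit together
  because the value in a fibre is unique.\<close>

lemma hor_sec:
  assumes p: "p \<in> hor_sections n Dreg"
  obtains U F where "inv_open n U" "hsol U F" "p = sec U F"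
proof -
  obtain U \<sigma> where p: "p = (U, \<sigma>)" and U: "inv_open n U" and ext: "\<sigma> \<in> extensional U"
    and nabla: "has_nabla Dreg U \<sigma> (\<lambda>b. fib Dreg b \<zero>\<^bsub>Dreg\<^esub>)"
    and inv: "\<forall>a\<in>U. \<sigma> (q * a) = ops Dreg ` \<sigma> a"
    using p by (auto simp: hor_sections_def)
  have U0: "b \<noteq> 0" if "b \<in> U" for b using U that by (auto simp: inv_open_def)
  have loc: "\<exists>B G. open B \<and> a \<in> B \<and> B \<subseteq> U \<and>
      (\<forall>b\<in>B. G b \<in> fin_vecs n \<and> \<sigma> b = Fib b (G b)) \<and>
      (\<forall>k. ((\<lambda>b. G b k) has_field_derivative - bidiag n ev (G a) k / a) (at a))" if a: "a \<in> U" for a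
  proof -
    obtain B r f m where B: "open B" "a \<in> B" "B \<subseteq> U"
      and fm: "\<And>i. i < r \<Longrightarrow> f i holomorphic_on B" "\<And>i. i < r \<Longrightarrow> m i \<in> carrier Dreg"
      and s: "\<And>b. b \<in> B \<Longrightarrow> \<sigma> b = fib Dreg b (\<Oplus>\<^bsub>Dreg\<^esub>i\<in>{..<r::nat}. f i b \<odot>\<^bsub>Dreg\<^esub> m i)"
      and t: "\<And>b. b \<in> B \<Longrightarrow> fib Dreg b \<zero>\<^bsub>Dreg\<^esub> = fib Dreg b (\<Oplus>\<^bsub>Dreg\<^esub>i\<in>{..<r}.
                 deriv (f i) b \<odot>\<^bsub>Dreg\<^esub> m i \<oplus>\<^bsub>Dreg\<^esub> f i b \<odot>\<^bsub>Dreg\<^esub> opd Dreg (m i))"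
      using nabla[unfolded has_nabla_def, rule_format, OF a] by blast
    define u where "u i = (if i < r then SOME v. v \<in> Rfun \<and> m i = Frac v else (\<lambda>b k. 0))" for i
    have u: "u i \<in> Rfun" "m i = Frac (u i)" if "i < r" for i
    proof -
      have "\<exists>v. v \<in> Rfun \<and> m i = Frac v" using fm(2)[OF that] by (auto simp: Dreg_carrier)
      from someI_ex[OF this] show "u i \<in> Rfun" "m i = Frac (u i)" using that by (simp_all add: u_def)
    qed
    interpret Dreg: abelian_group Dreg by (rule Dreg_abelian_group)
    define G where "G b k = (\<Sum>i<r. f i b * u i b k)" for b k
    have a0: "a \<noteq> 0" by (rule U0[OF a])
    have "\<sigma> b = Fib b (G b)" if "b \<in> B" for b
    proof -
      have b0: "b \<noteq> 0" using that B U0 by blast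
      have "(\<Oplus>\<^bsub>Dreg\<^esub>i\<in>{..<r}. f i b \<odot>\<^bsub>Dreg\<^esub> m i) = (\<Oplus>\<^bsub>Dreg\<^esub>i\<in>{..<r}. f i b \<odot>\<^bsub>Dreg\<^esub> Frac (u i))"
        by (rule Dreg.finsum_cong') (use u in \<open>auto simp: Dreg_smult Dreg_carrier Rfun_mlin\<close>)
      then show ?thesis
        unfolding s[OF that] using has_nabla_finsum(1)[of r u b "\<lambda>i. f i b"] u(1) b0
        by (simp add: G_def[abs_def])
    qed
    moreover have "G b \<in> fin_vecs n" for b
      using Rfun_vec[OF u(1)] by (auto simp: G_def fin_vecs_def)
    moreover have "((\<lambda>b. G b k) has_field_derivative - bidiag n ev (G a) k / a) (at a)" for k
    proof -
      have "((\<lambda>b. G b k) has_field_derivative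
          (\<Sum>i<r. f i a * deriv (\<lambda>b. u i b k) a + deriv (f i) a * u i a k)) (at a)"
        unfolding G_def
      proof (rule DERIV_sum)
        fix i assume "i \<in> {..<r}"
        then have i: "i < r" by simp
        show "((\<lambda>b. f i b * u i b k) has_field_derivative
            f i a * deriv (\<lambda>b. u i b k) a + deriv (f i) a * u i a k) (at a)"
          by (rule DERIV_mult[OF holomorphic_derivI[OF fm(1)[OF i] B(1,2)] Lfun_deriv[OF Rfun_Lfun[OF u(1)[OF i]] a0], THEN DERIV_cong])
             (simp add: mult.commute)
      qed
      moreover have "(\<Sum>i<r. f i a * deriv (\<lambda>b. u i b k) a + deriv (f i) a * u i a k) = - bidiag n ev (G a) k / a"
      proof -
        have "(\<Oplus>\<^bsub>Dreg\<^esub>i\<in>{..<r}. deriv (f i) a \<odot>\<^bsub>Dreg\<^esub> m i \<oplus>\<^bsub>Dreg\<^esub> f i a \<odot>\<^bsub>Dreg\<^esub> opd Dreg (m i))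
           = (\<Oplus>\<^bsub>Dreg\<^esub>i\<in>{..<r}. deriv (f i) a \<odot>\<^bsub>Dreg\<^esub> Frac (u i) \<oplus>\<^bsub>Dreg\<^esub> f i a \<odot>\<^bsub>Dreg\<^esub> opd Dreg (Frac (u i)))"
          by (rule Dreg.finsum_cong') (use u in \<open>auto simp: Dreg_smult Dreg_opd Dreg_carrier Rfun_mlin Rfun_mD Dreg_add\<close>)
        then have "Fib a (\<lambda>k. 0) = Fib a (\<lambda>k. \<Sum>i<r. deriv (f i) a * u i a k + f i a * mD (u i) a k)"
          using t[OF B(2)] fib_zero[OF a0] has_nabla_finsum(2)[of r u a "\<lambda>i. deriv (f i) a" "\<lambda>i. f i a"] u(1) a0
          by simp
        then have "(\<lambda>k. 0) = (\<lambda>k. \<Sum>i<r. deriv (f i) a * u i a k + f i a * mD (u i) a k)"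
          by (rule Fib_inj[OF a0, rotated]) (simp add: fin_vecs_def)
        from fun_cong[OF this, of k] have "(\<Sum>i<r. deriv (f i) a * u i a k + f i a * mD (u i) a k) = 0"
          by simp
        moreover have "f i a * mD (u i) a k = f i a * deriv (\<lambda>b. u i b k) a + f i a * bidiag n ev (u i a) k / a" for i
          using a0 by (simp add: mD_def mEu_def add_divide_distrib distrib_left)
        moreover have "(\<Sum>i<r. f i a * bidiag n ev (u i a) k / a) = bidiag n ev (G a) k / a"
          unfolding G_def[abs_def] bidiag_sum sum_divide_distrib ..
        ultimately show ?thesis
          by (simp add: sum.distrib algebra_simps eq_neg_iff_add_eq_0)
      qed
      ultimately show ?thesis by simp
    qed
    ultimately show ?thesis using B by (intro exI[of _ B] exI[of _ G]) simp
  qed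
  define F where "F b = (SOME y. y \<in> fin_vecs n \<and> \<sigma> b = Fib b y)" for b
  have F: "F b \<in> fin_vecs n" "\<sigma> b = Fib b (F b)" if "b \<in> U" for b
  proof -
    have "\<exists>y. y \<in> fin_vecs n \<and> \<sigma> b = Fib b y" using loc[OF that] by blast
    from someI_ex[OF this] show "F b \<in> fin_vecs n" "\<sigma> b = Fib b (F b)" by (simp_all add: F_def)
  qed
  have "hsol U F"
    unfolding hsol_def
  proof (intro conjI ballI allI)
    show "F b \<in> fin_vecs n" if "b \<in> U" for b by (rule F(1)[OF that])
    fix a assume a: "a \<in> U"
    have qa: "q * a \<in> U" using U a by (simp add: inv_open_def)
    have "Fib (q * a) (F (q * a)) = Fib (q * a) (F a)"
      using inv a F(2)[OF a] F(2)[OF qa] ops_Fib[OF U0[OF a]] by metis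
    then show "F (q * a) = F a" by (rule Fib_inj[OF U0[OF qa] F(1)[OF qa]])
    fix k
    obtain B G where B: "open B" "a \<in> B" "B \<subseteq> U"
      and G: "\<forall>b\<in>B. G b \<in> fin_vecs n \<and> \<sigma> b = Fib b (G b)"
      and d: "\<forall>k. ((\<lambda>b. G b k) has_field_derivative - bidiag n ev (G a) k / a) (at a)"
      using loc[OF a] by blast
    have e: "G b = F b" if "b \<in> B" for b
      using that G F(2)[of b] B(3) U0[of b] by (intro Fib_inj[of b]) auto
    have "((\<lambda>b. F b k) has_field_derivative - bidiag n ev (G a) k / a) (at a)"
      by (rule has_field_derivative_transform_within_open[OF spec[OF d, of k] B(1,2)]) (simp add: e)
    then show "((\<lambda>b. F b k) has_field_derivative - bidiag n ev (F a) k / a) (at a)"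
      by (simp add: e[OF B(2)])
  qed
  moreover have "p = sec U F"
    unfolding p sec_def using ext F(2) by (auto simp: extensional_def fun_eq_iff restrict_def)
  ultimately show ?thesis using that U by blast
qed

end

section \<open>Germs of horizontal sections\<close>

context cyclic_cher
begin

lemma inv_open_power: "\<lbrakk>inv_open n U; b \<in> U\<rbrakk> \<Longrightarrow> q ^ j * b \<in> U"
  by (induction j) (simp_all add: inv_open_def mult.assoc)

lemma inv_open_power_rev:
  assumes U: "inv_open n U" and b: "q ^ j * b \<in> U"
  shows "b \<in> U"
proof -
  have "q ^ (n * j - j) * (q ^ j * b) \<in> U" by (rule inv_open_power[OF U b])
  moreover have "q ^ (n * j - j) * (q ^ j * b) = q ^ (n * j) * b"
  proof -
    have "j \<le> n * j" using n0 by simp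
    then have "q ^ (n * j - j) * q ^ j = q ^ (n * j)" by (simp add: power_add[symmetric])
    then show ?thesis by (simp add: mult.assoc[symmetric])
  qed
  ultimately show ?thesis by (simp add: power_mult)
qed

lemma inv_open_nonzero: "\<lbrakk>inv_open n U; b \<in> U\<rbrakk> \<Longrightarrow> b \<noteq> 0"
  by (auto simp: inv_open_def)

lemma inv_open_Int: "\<lbrakk>inv_open n U; inv_open n U'\<rbrakk> \<Longrightarrow> inv_open n (U \<inter> U')"
  by (auto simp: inv_open_def)

lemma hsol_power: "\<lbrakk>inv_open n U; hsol U F; b \<in> U\<rbrakk> \<Longrightarrow> F (q ^ j * b) = F b"
proof (induction j)
  case (Suc j)
  have "F (q * (q ^ j * b)) = F (q ^ j * b)"
    using Suc.prems(2) inv_open_power[OF Suc.prems(1,3), of j] by (simp add: hsol_def)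
  then show ?case using Suc by (simp add: mult.assoc)
qed simp

lemma Re_pos_near:
  fixes z a :: complex
  assumes "z \<in> ball a (norm a)"
  shows "z / a \<notin> \<real>\<^sub>\<le>\<^sub>0"
proof -
  have a: "a \<noteq> 0" using assms by auto
  have "norm (z / a - 1) = norm (z - a) / norm a"
  proof -
    have "z / a - 1 = (z - a) / a" using a by (simp add: diff_divide_distrib)
    then show ?thesis by (simp add: norm_divide)
  qed
  also have "\<dots> < 1" using assms a by (simp add: dist_norm norm_minus_commute)
  finally have "norm (z / a - 1) < 1" .
  then have "\<bar>Re (z / a - 1)\<bar> < 1" using abs_Re_le_cmod le_less_trans by blast
  then have "0 < Re (z / a)" by simp
  then show ?thesis by (simp add: complex_nonpos_Reals_iff)
qed

lemma bidiag_lincomb_apply: "bidiag n a (lincomb x u y v) k = x * bidiag n a u k + y * bidiag n a v k"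
  by (simp add: bidiag_lincomb) (simp add: lincomb_def)

lemma hsol_unique_ball:
  assumes F: "hsol U F" and F': "hsol U' F'" and r: "0 < r" "r \<le> norm a" "ball a r \<subseteq> U \<inter> U'"
    and eq: "F a = F' a" and b: "b \<in> ball a r"
  shows "F b = F' b"
proof -
  define d where "d z = lincomb 1 (F z) (- 1) (F' z)" for z
  have z0: "z \<noteq> 0" if "z \<in> ball a r" for z
    using that r by (auto simp: dist_norm)
  have a0: "a \<noteq> 0" using r by auto
  have "d b k = 0" if k: "k < n" for k
  proof (rule bidiag_ode_unique[where y = d and z = b and k = k and S = "ball a r"
        and L = "\<lambda>z. - Ln (z / a)" and h = "\<lambda>z. - 1 / z" and ?z0.0 = a and n = n and a = ev])
    fix z assume z: "z \<in> ball a r"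
    have "z \<in> ball a (norm a)" using z r by auto
    then have "z / a \<notin> \<real>\<^sub>\<le>\<^sub>0" by (rule Re_pos_near)
    then show "((\<lambda>z. - Ln (z / a)) has_field_derivative - 1 / z) (at z)"
      using a0 z0[OF z] by (auto intro!: derivative_eq_intros simp: field_simps)
    fix k
    have "((\<lambda>z. F z k) has_field_derivative - bidiag n ev (F z) k / z) (at z)"
      "((\<lambda>z. F' z k) has_field_derivative - bidiag n ev (F' z) k / z) (at z)"
      using F F' z r by (auto simp: hsol_def)
    then show "((\<lambda>z. d z k) has_field_derivative - 1 / z * bidiag n ev (d z) k) (at z)"
      unfolding d_def bidiag_lincomb_apply unfolding lincomb_def
      by (auto intro!: derivative_eq_intros simp: diff_divide_distrib)
  qed (use eq r b that in \<open>auto simp: d_def lincomb_def\<close>)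
  moreover have "F b \<in> fin_vecs n" "F' b \<in> fin_vecs n"
    using F F' r b by (auto simp: hsol_def)
  ultimately have "F b k = F' b k" for k
    by (cases "k < n") (auto simp: d_def lincomb_def fin_vecs_def)
  then show ?thesis by (rule ext)
qed

text \<open>A solution is determined near \<open>a\<close> by its value at \<open>a\<close>.  The neighbourhood has to be invariant, so a
  ball around \<open>a\<close> is saturated under the rotations by powers of \<open>q\<close>.\<close>

lemma hsol_unique:
  assumes U: "inv_open n U" "inv_open n U'" and F: "hsol U F" "hsol U' F'"
    and a: "a \<in> U" "a \<in> U'" and eq: "F a = F' a"
  obtains W where "inv_open n W" "a \<in> W" "W \<subseteq> U \<inter> U'" "\<forall>b\<in>W. F b = F' b"
proof -
  have a0: "a \<noteq> 0" by (rule inv_open_nonzero[OF U(1) a(1)])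
  have "open (U \<inter> U')" using U by (auto simp: inv_open_def)
  then obtain r' where r': "0 < r'" "ball a r' \<subseteq> U \<inter> U'" using a by (meson IntI openE)
  define r where "r = min r' (norm a)"
  have r: "0 < r" "r \<le> norm a" "ball a r \<subseteq> U \<inter> U'" using r' a0 by (auto simp: r_def)
  \<comment> \<open>The saturation of the ball under rotations.\<close>
  define W where "W = {b. \<exists>j. q ^ j * b \<in> ball a r}"
  have W: "b \<in> U \<and> b \<in> U' \<and> F b = F' b" if "b \<in> W" for b
  proof -
    obtain j where j: "q ^ j * b \<in> ball a r" using \<open>b \<in> W\<close> by (auto simp: W_def)
    then have "q ^ j * b \<in> U" "q ^ j * b \<in> U'" using r by auto
    then have "b \<in> U" "b \<in> U'" using inv_open_power_rev U by blast+
    moreover have "F (q ^ j * b) = F' (q ^ j * b)" by (rule hsol_unique_ball[OF F r eq j])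
    ultimately show ?thesis using hsol_power U F by metis
  qed
  have "open W"
  proof -
    have "W = (\<Union>j. (\<lambda>b. q ^ j * b) -` ball a r)" by (auto simp: W_def)
    then show ?thesis by (auto intro!: open_vimage continuous_intros)
  qed
  moreover have "q * b \<in> W" if bW: "b \<in> W" for b
  proof -
    obtain j where j: "q ^ j * b \<in> ball a r" using bW unfolding W_def by blast
    have "q ^ (j + (n - 1)) * q = q ^ (j + n)" using n0 by (simp add: power_Suc2[symmetric] del: power_Suc)
    then have "q ^ (j + (n - 1)) * (q * b) = q ^ j * b" by (simp add: mult.assoc[symmetric] power_add)
    then show ?thesis unfolding W_def using j by (metis mem_Collect_eq)
  qed
  moreover have "0 \<notin> W" using W inv_open_nonzero[OF U(1)] by blast
  ultimately have "inv_open n W" by (simp add: inv_open_def)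
  moreover have "q ^ 0 * a \<in> ball a r" using r by simp
  then have "a \<in> W" unfolding W_def by blast
  ultimately show ?thesis using that W by blast
qed

text \<open>All horizontal sections near \<open>a\<close> with value \<open>y\<close> at \<open>a\<close>.  By uniqueness this is one germ.\<close>

definition Germ :: "complex \<Rightarrow> (nat \<Rightarrow> complex) \<Rightarrow> (delta_elt \<times> nat) set germ" where
  "Germ a y = {sec U F | U F. inv_open n U \<and> hsol U F \<and> a \<in> U \<and> F a = y}"

lemma sec_simps: "fst (sec U F) = U" "b \<in> U \<Longrightarrow> snd (sec U F) b = Fib b (F b)"
  by (simp_all add: sec_def)

lemma germ_Germ:
  assumes U: "inv_open n U" and F: "hsol U F" and a: "a \<in> U"
  shows "germ n Dreg a (sec U F) = Germ a (F a)"
proof (intro subset_antisym subsetI)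
  fix p assume "p \<in> germ n Dreg a (sec U F)"
  then obtain W where p: "p \<in> hor_sections n Dreg" and W: "a \<in> W" "W \<subseteq> fst (sec U F) \<inter> fst p"
    "\<forall>b\<in>W. snd (sec U F) b = snd p b"
    unfolding germ_def by blast
  obtain U' F' where U': "inv_open n U'" "hsol U' F'" "p = sec U' F'" using hor_sec[OF p] .
  have a': "a \<in> U'" using W U' by (auto simp: sec_simps)
  have "Fib a (F a) = Fib a (F' a)" using W U' a a' by (metis sec_simps(2))
  then have "F a = F' a"
    using F a by (intro Fib_inj[OF inv_open_nonzero[OF U a]]) (auto simp: hsol_def)
  then show "p \<in> Germ a (F a)" unfolding Germ_def U'(3) using U'(1,2) a' by (intro CollectI exI[of _ U'] exI[of _ F']) simp
next
  fix p assume "p \<in> Germ a (F a)"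
  then obtain U' F' where U': "inv_open n U'" "hsol U' F'" "p = sec U' F'" "a \<in> U'" "F' a = F a"
    unfolding Germ_def by blast
  obtain W where W: "inv_open n W" "a \<in> W" "W \<subseteq> U \<inter> U'" "\<forall>b\<in>W. F b = F' b"
    using hsol_unique[OF U U'(1) F U'(2) a U'(4) U'(5)[symmetric]] by blast
  have "snd (sec U F) b = snd p b" if "b \<in> W" for b
  proof -
    have "b \<in> U" "b \<in> U'" using that W(3) by auto
    then show ?thesis using W(4)[rule_format, OF that] by (simp add: U'(3) sec_simps)
  qed
  moreover have "p \<in> hor_sections n Dreg" unfolding U'(3) by (rule sec_hor[OF U'(1,2)])
  ultimately show "p \<in> germ n Dreg a (sec U F)"
    unfolding germ_def using W(1-3) by (intro CollectI conjI exI[of _ W]) (auto simp: U'(3) sec_simps)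
qed

subsection \<open>Explicit local solutions\<close>

text \<open>The solution with value \<open>y\<close> at \<open>a\<close> is \<open>exp(- A log (b/a)) y\<close>.  It has to be invariant under \<open>b \<mapsto> q b\<close>,
  which \<open>Ln (b/a)\<close> is not, but \<open>Ln ((b/a)\<^sup>n) / n\<close> is; both agree near \<open>a\<close>, and \<open>log_dom a\<close> is where the
  latter is holomorphic.\<close>

definition log_dom :: "complex \<Rightarrow> complex set" where
  "log_dom a = {b. b \<noteq> 0 \<and> (b / a) ^ n \<notin> \<real>\<^sub>\<le>\<^sub>0}"

definition log_sol :: "complex \<Rightarrow> (nat \<Rightarrow> complex) \<Rightarrow> mfun" where
  "log_sol a y b = bexp n ev (- (Ln ((b / a) ^ n) / of_nat n)) y"

lemma log_dom_inv_open:
  assumes a: "a \<noteq> 0" shows "inv_open n (log_dom a)"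
proof -
  have "log_dom a = - {0} \<inter> (\<lambda>b. (b / a) ^ n) -` (- \<real>\<^sub>\<le>\<^sub>0)" by (auto simp: log_dom_def)
  moreover have "open (- {0} \<inter> (\<lambda>b. (b / a) ^ n) -` (- \<real>\<^sub>\<le>\<^sub>0) :: complex set)"
    by (intro open_Int open_cstar open_vimage) (use a in \<open>auto intro!: continuous_intros\<close>)
  moreover have "(q * b / a) ^ n = (b / a) ^ n" for b
    by (simp add: power_divide power_mult_distrib)
  ultimately show ?thesis by (auto simp: inv_open_def log_dom_def)
qed

lemma log_sol_hsol:
  assumes a: "a \<noteq> 0" and y: "y \<in> fin_vecs n"
  shows "hsol (log_dom a) (log_sol a y)"
  unfolding hsol_def
proof (intro conjI ballI allI)
  fix b assume b: "b \<in> log_dom a"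
  show "log_sol a y b \<in> fin_vecs n" unfolding log_sol_def by (rule bexp_fin_vecs[OF y])
  have "(q * b / a) ^ n = (b / a) ^ n" by (simp add: power_divide power_mult_distrib)
  then show "log_sol a y (q * b) = log_sol a y b" by (simp add: log_sol_def)
  fix k
  have b0: "b \<noteq> 0" using b by (simp add: log_dom_def)
  have 1: "((\<lambda>b. (b / a) ^ n) has_field_derivative of_nat n * (1 / a * (b / a) ^ (n - Suc 0))) (at b)"
    by (rule DERIV_power) (use a in \<open>auto intro!: derivative_eq_intros\<close>)
  have "(Ln has_field_derivative inverse ((b / a) ^ n)) (at ((b / a) ^ n))"
    using b by (intro has_field_derivative_Ln) (simp add: log_dom_def)
  from DERIV_chain2[OF this 1]
  have "((\<lambda>b. Ln ((b / a) ^ n)) has_field_derivative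
      inverse ((b / a) ^ n) * (of_nat n * (1 / a * (b / a) ^ (n - Suc 0)))) (at b)" .
  moreover have "inverse ((b / a) ^ n) * (of_nat n * (1 / a * (b / a) ^ (n - Suc 0))) = of_nat n / b"
  proof -
    obtain m where m: "n = Suc m" using n0 by (cases n) auto
    have "(b / a) ^ m \<noteq> 0" using a b0 by simp
    then show ?thesis using a b0 unfolding m by (simp add: field_simps)
  qed
  ultimately have "((\<lambda>b. Ln ((b / a) ^ n)) has_field_derivative of_nat n / b) (at b)" by simp
  then have "((\<lambda>b. - (Ln ((b / a) ^ n) / of_nat n)) has_field_derivative - (of_nat n / b / of_nat n)) (at b)"
    by (intro DERIV_minus DERIV_cdivide)
  then have "((\<lambda>b. - (Ln ((b / a) ^ n) / of_nat n)) has_field_derivative - 1 / b) (at b)"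
    using n0 by simp
  from DERIV_chain2[OF bexp_deriv this, of n ev y k]
  show "((\<lambda>b. log_sol a y b k) has_field_derivative - bidiag n ev (log_sol a y b) k / b) (at b)"
    by (simp add: log_sol_def[abs_def])
qed

lemma a_log_dom: "a \<noteq> 0 \<Longrightarrow> a \<in> log_dom a"
  by (simp add: log_dom_def complex_nonpos_Reals_iff)

lemma log_sol_a: "a \<noteq> 0 \<Longrightarrow> log_sol a y a = y"
  by (simp add: log_sol_def)

lemma Germ_nonempty: "\<lbrakk>a \<noteq> 0; y \<in> fin_vecs n\<rbrakk> \<Longrightarrow> sec (log_dom a) (log_sol a y) \<in> Germ a y"
  unfolding Germ_def using log_dom_inv_open log_sol_hsol a_log_dom log_sol_a
  by (intro CollectI exI[of _ "log_dom a"] exI[of _ "log_sol a y"]) simp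

lemma Germ_inj:
  assumes "a \<noteq> 0" "y \<in> fin_vecs n" "Germ a y = Germ a y'"
  shows "y = y'"
proof -
  have "sec (log_dom a) (log_sol a y) \<in> Germ a y'" using Germ_nonempty[OF assms(1,2)] assms(3) by simp
  then obtain U F where U: "sec (log_dom a) (log_sol a y) = sec U F" "a \<in> U" "F a = y'"
    by (auto simp: Germ_def)
  have "Fib a (log_sol a y a) = Fib a (F a)"
    using U a_log_dom[OF assms(1)] by (metis sec_simps(2))
  then show ?thesis
    using U assms by (intro Fib_inj[OF assms(1,2)]) (simp add: log_sol_a)
qed

text \<open>Germs live on the quotient by the rotations: the path from \<open>x\<^sub>0\<close> to \<open>q x\<^sub>0\<close> becomes a loop there.\<close>

lemma Germ_shift: "Germ (q * a) y = Germ a y"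
proof -
  have "q * a \<in> U \<longleftrightarrow> a \<in> U" if "inv_open n U" for U
    using inv_open_power[OF that, of a 1] inv_open_power_rev[OF that, of 1 a] by auto
  moreover have "F (q * a) = F a" if "hsol U F" "a \<in> U" for U F
    using that by (simp add: hsol_def)
  ultimately show ?thesis
    unfolding Germ_def by (intro Collect_cong ex_cong1) (metis (no_types, lifting))
qed

subsection \<open>Continuation along the loop\<close>

definition gam :: "complex \<Rightarrow> real \<Rightarrow> complex" where
  "gam x0 t = exp (2 * of_real pi * \<i> * of_real t / of_nat n) * x0"

lemma gam_fun: "gam x0 = (\<lambda>t. exp (2 * of_real pi * \<i> * of_real t / of_nat n) * x0)"
  by (rule ext) (simp add: gam_def)

lemma gam_ratio: "x0 \<noteq> 0 \<Longrightarrow> (gam x0 u / gam x0 t) ^ n = exp (\<i> * of_real (2 * pi * (u - t)))"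
proof -
  assume "x0 \<noteq> 0"
  then have "gam x0 u / gam x0 t = exp (2 * of_real pi * \<i> * of_real u / of_nat n - 2 * of_real pi * \<i> * of_real t / of_nat n)"
    by (simp add: gam_def exp_diff)
  then have "(gam x0 u / gam x0 t) ^ n
     = exp (of_nat n * (2 * of_real pi * \<i> * of_real u / of_nat n - 2 * of_real pi * \<i> * of_real t / of_nat n))"
    by (simp only: exp_of_nat_mult)
  also have "of_nat n * (2 * of_real pi * \<i> * of_real u / of_nat n - 2 * of_real pi * \<i> * of_real t / of_nat n)
     = \<i> * of_real (2 * pi * (u - t))"
    using n0 by (simp add: right_diff_distrib algebra_simps)
  finally show ?thesis .
qed

lemma gam_nonzero: "x0 \<noteq> 0 \<Longrightarrow> gam x0 t \<noteq> 0"
  by (simp add: gam_def)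

text \<open>For parameters at distance less than \<open>1/4\<close> the \<open>n\<close>-th power of the ratio of the points is
  \<open>exp(2\<pi>i(u - t))\<close> in the right half plane, so the principal logarithm is the expected one.\<close>

lemma gam_near:
  assumes x0: "x0 \<noteq> 0" and ut: "\<bar>u - t\<bar> < 1 / 4"
  shows "gam x0 u \<in> log_dom (gam x0 t)" "log_sol (gam x0 t) y (gam x0 u) = bexp n ev (- (of_real (u - t) * om)) y"
proof -
  have t: "\<bar>2 * pi * (u - t)\<bar> < pi / 2"
  proof -
    have "\<bar>2 * pi * (u - t)\<bar> = 2 * pi * \<bar>u - t\<bar>" by (simp add: abs_mult)
    also have "\<dots> < 2 * pi * (1 / 4)" using ut by (intro mult_strict_left_mono) auto
    finally show ?thesis by simp
  qed
  then have "- (pi / 2) < 2 * pi * (u - t)" "2 * pi * (u - t) < pi / 2" by linarith+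
  then have "0 < cos (2 * pi * (u - t))" by (rule cos_gt_zero_pi)
  then have "0 < Re (exp (\<i> * of_real (2 * pi * (u - t))))" by (simp add: Re_exp)
  then have "(gam x0 u / gam x0 t) ^ n \<notin> \<real>\<^sub>\<le>\<^sub>0"
    unfolding gam_ratio[OF x0] by (simp add: complex_nonpos_Reals_iff)
  then show "gam x0 u \<in> log_dom (gam x0 t)" using gam_nonzero[OF x0] by (simp add: log_dom_def)
  have "- pi < 2 * pi * (u - t)" "2 * pi * (u - t) \<le> pi" using t pi_gt_zero by linarith+
  then have "Ln ((gam x0 u / gam x0 t) ^ n) = \<i> * of_real (2 * pi * (u - t))"
    unfolding gam_ratio[OF x0] by (intro Ln_exp) simp_all
  moreover have "\<i> * of_real (2 * pi * (u - t)) / of_nat n = of_real (u - t) * om"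
    by (simp add: om_def)
  ultimately show "log_sol (gam x0 t) y (gam x0 u) = bexp n ev (- (of_real (u - t) * om)) y"
    by (simp only: log_sol_def)
qed

lemma gam_0: "gam x0 0 = x0" and gam_1: "gam x0 1 = q * x0"
  by (simp_all add: gam_def rootq_def)

text \<open>The horizontal germs with value \<open>exp(2\<pi>i/n (1 - t) A) y\<close> at time \<open>t\<close> continue each other along the
  path.  They start with \<open>B y\<close> and end with \<open>y\<close>.\<close>

lemma continues_exists:
  assumes x0: "x0 \<noteq> 0" and y: "y \<in> fin_vecs n"
  shows "continues n Dreg (gam x0) (Germ x0 (bexp n ev om y)) (Germ x0 y)"
  unfolding continues_def
proof (intro exI[of _ "\<lambda>t. Germ (gam x0 t) (bexp n ev (of_real (1 - t) * om) y)"] conjI ballI)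
  show "Germ (gam x0 0) (bexp n ev (of_real (1 - 0) * om) y) = Germ x0 (bexp n ev om y)"
    by (simp add: gam_0)
  show "Germ (gam x0 1) (bexp n ev (of_real (1 - 1) * om) y) = Germ x0 y"
    by (simp add: gam_1 Germ_shift)
  fix t :: real
  define yt where "yt = bexp n ev (of_real (1 - t) * om) y"
  have yt: "yt \<in> fin_vecs n" unfolding yt_def by (rule bexp_fin_vecs[OF y])
  let ?p = "sec (log_dom (gam x0 t)) (log_sol (gam x0 t) yt)"
  note Ut = log_dom_inv_open[OF gam_nonzero[OF x0]] log_sol_hsol[OF gam_nonzero[OF x0] yt]
  show "\<exists>p\<in>hor_sections n Dreg. \<exists>\<epsilon>>0. \<forall>u\<in>{0..1}. \<bar>u - t\<bar> < \<epsilon> \<longrightarrow> gam x0 u \<in> fst p \<and>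
      Germ (gam x0 u) (bexp n ev (of_real (1 - u) * om) y) = germ n Dreg (gam x0 u) p"
  proof (intro bexI[of _ ?p] exI[of _ "1/4"] conjI ballI impI)
    show "?p \<in> hor_sections n Dreg" by (rule sec_hor[OF Ut])
    fix u assume ut: "\<bar>u - t\<bar> < 1 / 4"
    show "gam x0 u \<in> fst ?p" using gam_near(1)[OF x0 ut] by (simp add: sec_simps)
    have "log_sol (gam x0 t) yt (gam x0 u) = bexp n ev (- (of_real (u - t) * om) + of_real (1 - t) * om) y"
      unfolding gam_near(2)[OF x0 ut] yt_def bexp_add ..
    also have "- (of_real (u - t) * om) + of_real (1 - t) * om = of_real (1 - u) * om"
      by (simp add: algebra_simps)
    finally show "Germ (gam x0 u) (bexp n ev (of_real (1 - u) * om) y) = germ n Dreg (gam x0 u) ?p"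
      using germ_Germ[OF Ut gam_near(1)[OF x0 ut]] by simp
  qed simp
qed

lemma gam_continuous: "continuous (at t) (gam x0)"
  unfolding gam_def by (intro continuous_intros) (use n0 in auto)

text \<open>For the value \<open>v(t)\<close> of a continued germ at time \<open>t\<close>, the vector \<open>exp(2\<pi>i/n t A) v(t)\<close> is locally
  constant, by comparison with the explicit solutions; hence it is the same at \<open>t = 0\<close> and \<open>t = 1\<close>.\<close>

lemma continues_unique:
  assumes x0: "x0 \<noteq> 0" and y: "y \<in> fin_vecs n" and y': "y' \<in> fin_vecs n"
    and c: "continues n Dreg (gam x0) (Germ x0 y') (Germ x0 y)"
  shows "y' = bexp n ev om y"
proof -
  obtain G where G01: "G 0 = Germ x0 y'" "G 1 = Germ x0 y"
    and G: "\<And>t. t \<in> {0..1} \<Longrightarrow> \<exists>p\<in>hor_sections n Dreg. \<exists>\<epsilon>>0. \<forall>u\<in>{0..1}.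
      \<bar>u - t\<bar> < \<epsilon> \<longrightarrow> gam x0 u \<in> fst p \<and> G u = germ n Dreg (gam x0 u) p"
    using c unfolding continues_def by blast
  note g0 = gam_nonzero[OF x0]
  have loc: "\<exists>U F \<epsilon>. inv_open n U \<and> hsol U F \<and> \<epsilon> > 0 \<and>
      (\<forall>u\<in>{0..1}. \<bar>u - t\<bar> < \<epsilon> \<longrightarrow> gam x0 u \<in> U \<and> G u = Germ (gam x0 u) (F (gam x0 u)))" if t: "t \<in> {0..1}" for t
  proof -
    obtain p \<epsilon> where p: "p \<in> hor_sections n Dreg" "\<epsilon> > 0"
      "\<forall>u\<in>{0..1}. \<bar>u - t\<bar> < \<epsilon> \<longrightarrow> gam x0 u \<in> fst p \<and> G u = germ n Dreg (gam x0 u) p"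
      using G[OF t] by blast
    obtain U F where U: "inv_open n U" "hsol U F" "p = sec U F" using hor_sec[OF p(1)] .
    have "gam x0 u \<in> U \<and> G u = Germ (gam x0 u) (F (gam x0 u))" if "u \<in> {0..1}" "\<bar>u - t\<bar> < \<epsilon>" for u
    proof -
      have "gam x0 u \<in> U" "G u = germ n Dreg (gam x0 u) (sec U F)" using p(3) that U(3) by (auto simp: sec_simps)
      then show ?thesis using germ_Germ[OF U(1,2)] by simp
    qed
    then show ?thesis using U p(2) by blast
  qed
  \<comment> \<open>The value at \<open>\<gamma>(t)\<close> of the continued germ.\<close>
  define val where "val t = (SOME v. v \<in> fin_vecs n \<and> G t = Germ (gam x0 t) v)" for t
  have val_eq: "val t = v" if "v \<in> fin_vecs n" "G t = Germ (gam x0 t) v" for t v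
  proof -
    have "val t \<in> fin_vecs n \<and> G t = Germ (gam x0 t) (val t)"
      unfolding val_def by (rule someI[of _ v]) (use that in simp)
    then show ?thesis using that by (intro Germ_inj[OF g0[of t]]) auto
  qed
  define Q where "Q t = bexp n ev (of_real t * om) (val t)" for t
  have "Q 0 = Q 1"
  proof (rule connected_local_const[of "{0..1::real}"])
    show "\<forall>t\<in>{0..1}. \<forall>\<^sub>F u in at t within {0..1}. Q t = Q u"
    proof
      fix t :: real assume t: "t \<in> {0..1}"
      obtain U F \<epsilon> where U: "inv_open n U" "hsol U F" and eps: "\<epsilon> > 0"
        and U2: "\<And>u. \<lbrakk>u \<in> {0..1}; \<bar>u - t\<bar> < \<epsilon>\<rbrakk> \<Longrightarrow> gam x0 u \<in> U \<and> G u = Germ (gam x0 u) (F (gam x0 u))"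
        using loc[OF t] by blast
      have tU: "gam x0 t \<in> U" using U2[OF t] eps by simp
      have Ff: "F b \<in> fin_vecs n" if "b \<in> U" for b using U(2) that by (simp add: hsol_def)
      have vt: "val u = F (gam x0 u)" if "u \<in> {0..1}" "\<bar>u - t\<bar> < \<epsilon>" for u
        using U2[OF that] Ff by (intro val_eq) auto
      define s where "s = log_sol (gam x0 t) (val t)"
      have vtt: "val t = F (gam x0 t)" using vt[OF t] eps by simp
      have s: "hsol (log_dom (gam x0 t)) s" unfolding s_def vtt by (rule log_sol_hsol[OF g0 Ff[OF tU]])
      have st: "F (gam x0 t) = s (gam x0 t)" by (simp add: s_def log_sol_a[OF g0] vtt)
      obtain W where W: "inv_open n W" "gam x0 t \<in> W" "W \<subseteq> U \<inter> log_dom (gam x0 t)"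
        "\<forall>b\<in>W. F b = s b"
        by (rule hsol_unique[OF U(1) log_dom_inv_open[OF g0] U(2) s tU a_log_dom[OF g0] st])
      have oW: "open W" using W(1) by (simp add: inv_open_def)
      have "(gam x0 \<longlongrightarrow> gam x0 t) (at t)" using gam_continuous unfolding continuous_at .
      then have "\<forall>\<^sub>F u in at t. gam x0 u \<in> W" by (rule topological_tendstoD[OF _ oW W(2)])
      then have "\<forall>\<^sub>F u in at t within {0..1}. gam x0 u \<in> W" by (rule filter_leD[OF at_le[OF subset_UNIV]])
      moreover have "\<forall>\<^sub>F u in at t within {0..1}. \<bar>u - t\<bar> < min \<epsilon> (1/4)"
        unfolding eventually_at using eps by (intro exI[of _ "min \<epsilon> (1/4)"]) (auto simp: dist_real_def)
      moreover have "\<forall>\<^sub>F u in at t within {0..1}. u \<in> {0..1}"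
        by (simp add: eventually_at_filter)
      ultimately show "\<forall>\<^sub>F u in at t within {0..1}. Q t = Q u"
      proof eventually_elim
        case (elim u)
        have "val u = s (gam x0 u)" using vt[of u] W(4) elim by simp
        also have "\<dots> = bexp n ev (- (of_real (u - t) * om)) (val t)"
          unfolding s_def using elim by (intro gam_near(2)[OF x0]) simp
        finally have "Q u = bexp n ev (of_real u * om + - (of_real (u - t) * om)) (val t)"
          unfolding Q_def bexp_add by simp
        also have "of_real u * om + - (of_real (u - t) * om) = of_real t * om" by (simp add: algebra_simps)
        finally show ?case by (simp add: Q_def)
      qed
    qed
  qed auto
  moreover have "val 0 = y'" using G01 y' by (intro val_eq) (simp_all add: gam_0)
  moreover have "val 1 = y" using G01 y by (intro val_eq) (simp_all add: gam_1 Germ_shift)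
  ultimately show ?thesis by (simp add: Q_def)
qed

section \<open>The KZ functor on the standard module\<close>

context
  fixes x0 :: complex
  assumes x0: "x0 \<noteq> 0"
begin

abbreviation "Dgerms \<equiv> germ_space n Dreg x0"

lemma Dgerms_carrier: "carrier Dgerms = Germ x0 ` fin_vecs n"
proof (intro subset_antisym subsetI)
  fix g assume "g \<in> carrier Dgerms"
  then obtain p where p: "g = germ n Dreg x0 p" "p \<in> hor_sections n Dreg" "x0 \<in> fst p"
    by (auto simp: germ_space_def)
  obtain U F where U: "inv_open n U" "hsol U F" "p = sec U F" using hor_sec[OF p(2)] .
  have xU: "x0 \<in> U" using p U by (simp add: sec_simps)
  then have "g = Germ x0 (F x0)" using germ_Germ[OF U(1,2)] p U by simp
  then show "g \<in> Germ x0 ` fin_vecs n" using U(2) xU by (auto simp: hsol_def)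
next
  fix g assume "g \<in> Germ x0 ` fin_vecs n"
  then obtain y where y: "y \<in> fin_vecs n" "g = Germ x0 y" by blast
  have "g = germ n Dreg x0 (sec (log_dom x0) (log_sol x0 y))"
    using germ_Germ[OF log_dom_inv_open[OF x0] log_sol_hsol[OF x0 y(1)] a_log_dom[OF x0]] by (simp add: y log_sol_a x0)
  moreover have "sec (log_dom x0) (log_sol x0 y) \<in> hor_sections n Dreg"
    by (rule sec_hor[OF log_dom_inv_open[OF x0] log_sol_hsol[OF x0 y(1)]])
  moreover have "x0 \<in> fst (sec (log_dom x0) (log_sol x0 y))" using a_log_dom[OF x0] by (simp add: sec_simps)
  ultimately show "g \<in> carrier Dgerms" unfolding germ_space_def by (simp del: split_paired_Ex) blast
qed

lemma Dgerms_zero: "\<zero>\<^bsub>Dgerms\<^esub> = Germ x0 (\<lambda>k. 0)"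
proof -
  have "hsol (- {0}) (\<lambda>b k. 0)"
    by (auto simp: hsol_def fin_vecs_def bidiag_def)
  moreover have "inv_open n (- {0})" by (auto simp: inv_open_def)
  moreover have "(- {0}, \<lambda>b\<in>- {0}. fib Dreg b \<zero>\<^bsub>Dreg\<^esub>) = sec (- {0}) (\<lambda>b k. 0)"
    unfolding sec_def using fib_zero by (auto intro!: restrict_ext)
  ultimately show ?thesis using germ_Germ[of "- {0}" "\<lambda>b k. 0" x0] x0 by (simp add: germ_space_def)
qed

lemma hsol_lincomb:
  assumes "hsol U F" "hsol U' F'"
  shows "hsol (U \<inter> U') (\<lambda>b. lincomb x (F b) y (F' b))"
  unfolding hsol_def
proof (intro conjI ballI allI)
  fix b k assume b: "b \<in> U \<inter> U'"
  show "lincomb x (F b) y (F' b) \<in> fin_vecs n"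
    using assms b by (auto simp: hsol_def fin_vecs_def lincomb_def)
  show "lincomb x (F (q * b)) y (F' (q * b)) = lincomb x (F b) y (F' b)"
    using assms b by (auto simp: hsol_def)
  have "((\<lambda>z. F z k) has_field_derivative - bidiag n ev (F b) k / b) (at b)"
      "((\<lambda>z. F' z k) has_field_derivative - bidiag n ev (F' b) k / b) (at b)"
    using assms b by (auto simp: hsol_def)
  then show "((\<lambda>b. lincomb x (F b) y (F' b) k) has_field_derivative
      - bidiag n ev (lincomb x (F b) y (F' b)) k / b) (at b)"
    unfolding bidiag_lincomb_apply unfolding lincomb_def
    by (auto intro!: derivative_eq_intros simp: add_divide_distrib diff_divide_distrib mult.commute)
qed

lemma set_add_mem: "x \<in> A <+>\<^bsub>N\<^esub> B \<longleftrightarrow> (\<exists>a\<in>A. \<exists>b\<in>B. x = a \<oplus>\<^bsub>N\<^esub> b)"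
  by (auto simp: set_add_def set_mult_def)

lemma Fib_add: "\<lbrakk>b \<noteq> 0; y \<in> fin_vecs n; y' \<in> fin_vecs n\<rbrakk> \<Longrightarrow> Fib b y <+>\<^bsub>Dreg\<^esub> Fib b y' = Fib b (lincomb 1 y 1 y')"
proof (intro subset_antisym subsetI)
  fix x assume "x \<in> Fib b y <+>\<^bsub>Dreg\<^esub> Fib b y'"
  then obtain u v where uv: "u \<in> Rfun" "v \<in> Rfun" "u b = y" "v b = y'" "x = Frac u \<oplus>\<^bsub>Dreg\<^esub> Frac v"
    unfolding set_add_mem Fib_def by blast
  have "mlin 1 u 1 v b = lincomb 1 y 1 y'" by (simp add: mlin_def lincomb_def uv)
  then show "x \<in> Fib b (lincomb 1 y 1 y')"
    using uv Rfun_mlin by (auto simp: Dreg_add Fib_def)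
next
  assume b: "b \<noteq> 0" and y: "y \<in> fin_vecs n" "y' \<in> fin_vecs n"
  fix x assume "x \<in> Fib b (lincomb 1 y 1 y')"
  then obtain w where w: "w \<in> Rfun" "w b = lincomb 1 y 1 y'" "x = Frac w" by (auto simp: Fib_def)
  define v where "v = mlin 1 w (- 1) (constf y)"
  have v: "v \<in> Rfun" unfolding v_def by (intro Rfun_mlin w constf_Rfun y)
  have "v b = y'" using b w(2) by (simp add: v_def mlin_def constf_def lincomb_def fun_eq_iff)
  moreover have "x = Frac (constf y) \<oplus>\<^bsub>Dreg\<^esub> Frac v"
    using w v by (simp add: Dreg_add constf_Rfun y) (simp add: v_def mlin_def)
  moreover have "constf y b = y" using b by (simp add: constf_def)
  ultimately show "x \<in> Fib b y <+>\<^bsub>Dreg\<^esub> Fib b y'"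
    unfolding set_add_mem using v constf_Rfun[OF y(1)]
    by (intro bexI[of _ "Frac (constf y)"] bexI[of _ "Frac v"]) (auto simp: Fib_def)
qed

lemma Germ_memD:
  assumes "(U, \<sigma>) \<in> Germ x0 y"
  obtains F where "inv_open n U" "hsol U F" "x0 \<in> U" "F x0 = y" "\<sigma> = (\<lambda>b\<in>U. Fib b (F b))"
  using assms by (auto simp: Germ_def sec_def)

lemma Dgerms_add:
  assumes "y \<in> fin_vecs n" "y' \<in> fin_vecs n"
  shows "Germ x0 y \<oplus>\<^bsub>Dgerms\<^esub> Germ x0 y' = Germ x0 (lincomb 1 y 1 y')"
proof -
  have "Germ x0 y \<oplus>\<^bsub>Dgerms\<^esub> Germ x0 y' = (\<Union>(U, \<sigma>)\<in>Germ x0 y. \<Union>(U', \<sigma>')\<in>Germ x0 y'.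
        germ n Dreg x0 (U \<inter> U', \<lambda>b\<in>U \<inter> U'. \<sigma> b <+>\<^bsub>Dreg\<^esub> \<sigma>' b))"
    by (simp add: germ_space_def)
  also have "\<dots> = Germ x0 (lincomb 1 y 1 y')"
  proof (intro UN_pair_const)
    show "Germ x0 y \<noteq> {}" "Germ x0 y' \<noteq> {}" using Germ_nonempty[OF x0] assms by blast+
    fix U \<sigma> U' \<sigma>' assume 1: "(U, \<sigma>) \<in> Germ x0 y" and 2: "(U', \<sigma>') \<in> Germ x0 y'"
    obtain F where F: "inv_open n U" "hsol U F" "x0 \<in> U" "F x0 = y" "\<sigma> = (\<lambda>b\<in>U. Fib b (F b))"
      using Germ_memD[OF 1] .
    obtain F' where F': "inv_open n U'" "hsol U' F'" "x0 \<in> U'" "F' x0 = y'" "\<sigma>' = (\<lambda>b\<in>U'. Fib b (F' b))"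
      using Germ_memD[OF 2] .
    have "(U \<inter> U', \<lambda>b\<in>U \<inter> U'. \<sigma> b <+>\<^bsub>Dreg\<^esub> \<sigma>' b) = sec (U \<inter> U') (\<lambda>b. lincomb 1 (F b) 1 (F' b))"
      unfolding sec_def
    proof (intro arg_cong2[of _ _ _ _ Pair] refl restrict_ext)
      fix b assume b: "b \<in> U \<inter> U'"
      then show "\<sigma> b <+>\<^bsub>Dreg\<^esub> \<sigma>' b = Fib b (lincomb 1 (F b) 1 (F' b))"
        using Fib_add[OF inv_open_nonzero[OF F(1)], of b "F b" "F' b"] F F' by (auto simp: hsol_def)
    qed
    then show "germ n Dreg x0 (U \<inter> U', \<lambda>b\<in>U \<inter> U'. \<sigma> b <+>\<^bsub>Dreg\<^esub> \<sigma>' b) = Germ x0 (lincomb 1 y 1 y')"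
      using germ_Germ[OF inv_open_Int[OF F(1) F'(1)] hsol_lincomb[OF F(2) F'(2)]] F F' by simp
  qed
  finally show ?thesis .
qed

text \<open>Scalar multiplication of germs and the effect of \<open>KZ\<close> on a morphism have the same shape: a map
  \<open>f\<close> of the bundle that acts on every fibre by one and the same map \<open>H\<close>.  On initial values it is
  then \<open>H\<close> again.\<close>

lemma germ_pointwise:
  assumes y: "y \<in> fin_vecs n"
    and f: "\<And>u. u \<in> Rfun \<Longrightarrow> \<exists>w\<in>Rfun. f (Frac u) = Frac w \<and> (\<forall>b. w b = H (u b))"
    and H: "\<And>U F. \<lbrakk>inv_open n U; hsol U F\<rbrakk> \<Longrightarrow> hsol U (\<lambda>b. H (F b))"
  shows "(\<Union>(U, \<sigma>)\<in>Germ x0 y. germ n Dreg x0 (U, \<lambda>b\<in>U. \<Union>v\<in>\<sigma> b. fib Dreg b (f v))) = Germ x0 (H y)"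
proof (intro UN_pair_const)
  show "Germ x0 y \<noteq> {}" using Germ_nonempty[OF x0 y] by blast
  fix U \<sigma> assume 1: "(U, \<sigma>) \<in> Germ x0 y"
  obtain F where F: "inv_open n U" "hsol U F" "x0 \<in> U" "F x0 = y" "\<sigma> = (\<lambda>b\<in>U. Fib b (F b))"
    using Germ_memD[OF 1] .
  have "(U, \<lambda>b\<in>U. \<Union>v\<in>\<sigma> b. fib Dreg b (f v)) = sec U (\<lambda>b. H (F b))"
    unfolding sec_def
  proof (intro arg_cong2[of _ _ _ _ Pair] refl restrict_ext)
    fix b assume b: "b \<in> U"
    have b0: "b \<noteq> 0" by (rule inv_open_nonzero[OF F(1) b])
    have Fb: "F b \<in> fin_vecs n" using F b by (simp add: hsol_def)
    have "fib Dreg b (f v) = Fib b (H (F b))" if v: "v \<in> Fib b (F b)" for v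
    proof -
      obtain u where u: "v = Frac u" "u \<in> Rfun" "u b = F b" using v unfolding Fib_def by blast
      then obtain w where "w \<in> Rfun" "f v = Frac w" "w b = H (F b)" using f[OF u(2)] by auto
      then show ?thesis by (simp add: fib_Fib b0)
    qed
    then have "(\<Union>v\<in>Fib b (F b). fib Dreg b (f v)) = Fib b (H (F b))"
      by (rule SUP_eq_const[OF Fib_nonempty[OF b0 Fb]])
    then show "(\<Union>v\<in>\<sigma> b. fib Dreg b (f v)) = Fib b (H (F b))"
      using b by (simp add: F(5))
  qed
  then show "germ n Dreg x0 (U, \<lambda>b\<in>U. \<Union>v\<in>\<sigma> b. fib Dreg b (f v)) = Germ x0 (H y)"
    using germ_Germ[OF F(1) H[OF F(1,2)] F(3)] F(4) by simp
qed

lemma Dgerms_smult: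
  assumes y: "y \<in> fin_vecs n"
  shows "z \<odot>\<^bsub>Dgerms\<^esub> Germ x0 y = Germ x0 (lincomb z y 0 y)"
proof -
  have "z \<odot>\<^bsub>Dgerms\<^esub> Germ x0 y = (\<Union>(U, \<sigma>)\<in>Germ x0 y.
      germ n Dreg x0 (U, \<lambda>b\<in>U. \<Union>v\<in>\<sigma> b. fib Dreg b (z \<odot>\<^bsub>Dreg\<^esub> v)))"
    by (simp add: germ_space_def)
  also have "\<dots> = Germ x0 (lincomb z y 0 y)"
  proof (rule germ_pointwise[OF y])
    show "\<exists>w\<in>Rfun. z \<odot>\<^bsub>Dreg\<^esub> Frac u = Frac w \<and> (\<forall>b. w b = lincomb z (u b) 0 (u b))" if "u \<in> Rfun" for u
      using Dreg_smult[OF that, of z] Rfun_scale[OF that, of z]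
      by (intro bexI[of _ "mlin z u 0 u"] conjI allI) (simp_all add: mlin_def lincomb_def)
    show "hsol U (\<lambda>b. lincomb z (F b) 0 (F b))" if "hsol U F" for U F
      using hsol_lincomb[OF that that] by simp
  qed
  finally show ?thesis .
qed

text \<open>The constant matrix \<open>B\<close> commutes with \<open>A\<close>, so it maps solutions to solutions.\<close>

lemma hsol_bexp:
  assumes U: "inv_open n U" and F: "hsol U F"
  shows "hsol U (\<lambda>b. bexp n ev om (F b))"
  unfolding hsol_def
proof (intro conjI ballI allI)
  fix b k assume b: "b \<in> U"
  have Fb: "F b \<in> fin_vecs n" if "b \<in> U" for b using F that by (simp add: hsol_def)
  show "bexp n ev om (F b) \<in> fin_vecs n" by (rule bexp_fin_vecs[OF Fb[OF b]])
  show "bexp n ev om (F (q * b)) = bexp n ev om (F b)" using F b by (simp add: hsol_def)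
  have ex: "bexp n ev om v k = (\<Sum>l<n. v l * Ent k l)" if "v \<in> fin_vecs n" for v
    unfolding Ent_def by (rule bexp_expand[OF that])
  have oU: "open U" using U by (simp add: inv_open_def)
  have "((\<lambda>b. \<Sum>l<n. F b l * Ent k l) has_field_derivative (\<Sum>l<n. - bidiag n ev (F b) l / b * Ent k l)) (at b)"
    by (intro DERIV_sum DERIV_cmult_right) (use F b in \<open>simp add: hsol_def\<close>)
  moreover have "(\<Sum>l<n. - bidiag n ev (F b) l / b * Ent k l) = - bidiag n ev (bexp n ev om (F b)) k / b"
    unfolding bidiag_bexp ex[OF bidiag_fin_vecs] sum_negf[symmetric] sum_divide_distrib
    by (rule sum.cong) simp_all
  ultimately have "((\<lambda>b. \<Sum>l<n. F b l * Ent k l) has_field_derivative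
      - bidiag n ev (bexp n ev om (F b)) k / b) (at b)" by simp
  then show "((\<lambda>b. bexp n ev om (F b) k) has_field_derivative - bidiag n ev (bexp n ev om (F b)) k / b) (at b)"
    by (rule has_field_derivative_transform_within_open[OF _ oU b]) (simp add: ex[OF Fb])
qed

lemma Rfun_mExp:
  assumes "u \<in> Rfun" shows "mExp u \<in> Rfun" "Mreg_map n c (Delta n c) etaop (Frac u) = Frac (mExp u)"
proof -
  have e: "evf (etaop m) k = mExp (evf m k)" if m: "m \<in> carrier (Delta n c)" for m k
  proof
    fix b
    have "evf m k b = lincomb (1 / b ^ k) (Phi m b) 0 (Phi m b)" by (simp add: evf_def lincomb_def fun_eq_iff)
    then show "evf (etaop m) k b = mExp (evf m k) b"
      unfolding mExp_def by (simp add: bexp_lincomb) (simp add: evf_def etaop m mExp_def lincomb_def fun_eq_iff)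
  qed
  obtain m k where m: "m \<in> carrier (Delta n c)" "u = evf m k" using Rfun_cases[OF assms] .
  have "evf (etaop m) k \<in> Rfun" by (rule evf_Rfun[OF etaop(1)[OF m(1)]])
  then show "mExp u \<in> Rfun" by (simp add: e m)
  show "Mreg_map n c (Delta n c) etaop (Frac u) = Frac (mExp u)"
    unfolding Mreg_map_def
    by (rule UN_pair_const[OF Frac_nonempty[OF assms]], drule Frac_memD) (auto simp: frac_Frac etaop e)
qed

lemma KZ_map_etaop:
  assumes y: "y \<in> fin_vecs n"
  shows "KZ_map n c x0 (Delta n c) etaop (Germ x0 y) = Germ x0 (bexp n ev om y)"
  unfolding KZ_map_def
proof (rule germ_pointwise[OF y _ hsol_bexp])
  fix u assume "u \<in> Rfun"
  then show "\<exists>w\<in>Rfun. Mreg_map n c (Delta n c) etaop (Frac u) = Frac w \<and> (\<forall>b. w b = bexp n ev om (u b))"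
    using Rfun_mExp by (intro bexI[of _ "mExp u"]) (auto simp: mExp_def)
qed

text \<open>The operator \<open>T\<close> is the inverse of analytic continuation: its value on the germ with value \<open>y\<close> is the
  germ that continues to it, and this has value \<open>B y\<close>.\<close>

lemma monodromy_Germ:
  assumes y: "y \<in> fin_vecs n"
  shows "monodromy n Dreg x0 (Germ x0 y) = Germ x0 (bexp n ev om y)"
  unfolding monodromy_def gam_fun[symmetric]
proof (rule the_equality)
  show "Germ x0 (bexp n ev om y) \<in> carrier Dgerms \<and> continues n Dreg (gam x0) (Germ x0 (bexp n ev om y)) (Germ x0 y)"
    using continues_exists[OF x0 y] bexp_fin_vecs[OF y] by (simp add: Dgerms_carrier)
  fix g assume g: "g \<in> carrier Dgerms \<and> continues n Dreg (gam x0) g (Germ x0 y)"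
  then obtain y' where y': "y' \<in> fin_vecs n" "g = Germ x0 y'" by (auto simp: Dgerms_carrier)
  then show "g = Germ x0 (bexp n ev om y)" using continues_unique[OF x0 y y'(1)] g by simp
qed

lemma monodromy_power_Germ:
  assumes y: "y \<in> fin_vecs n"
  shows "(monodromy n Dreg x0 ^^ i) (Germ x0 y) = Germ x0 ((bexp n ev om ^^ i) y) \<and> (bexp n ev om ^^ i) y \<in> fin_vecs n"
  by (induction i) (simp_all add: y monodromy_Germ bexp_fin_vecs)

lemma Dgerms_finsum:
  assumes y: "\<And>i. y i \<in> fin_vecs n"
  shows "(\<Oplus>\<^bsub>Dgerms\<^esub>i\<in>{..(d::nat)}. a i \<odot>\<^bsub>Dgerms\<^esub> Germ x0 (y i)) = Germ x0 (\<lambda>k. \<Sum>i\<le>d. a i * y i k)"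
proof -
  have l: "lincomb 1 u 1 v = u + v" for u v by (simp add: lincomb_def fun_eq_iff)
  have z: "(\<lambda>k. 0) = (0 :: nat \<Rightarrow> complex)" by (simp add: fun_eq_iff)
  have f: "0 \<in> fin_vecs n" "\<And>u v. \<lbrakk>u \<in> fin_vecs n; v \<in> fin_vecs n\<rbrakk> \<Longrightarrow> u - v \<in> fin_vecs n"
    "\<And>i. lincomb (a i) (y i) 0 (y i) \<in> fin_vecs n"
    using y by (simp_all add: fin_vecs_def lincomb_def)
  have "(\<Sum>i\<le>d. lincomb (a i) (y i) 0 (y i)) = (\<lambda>k. \<Sum>i\<le>d. a i * y i k)"
    by (simp add: fun_eq_iff sum_fun_apply) (simp add: lincomb_def)
  moreover have "(\<Oplus>\<^bsub>Dgerms\<^esub>i\<in>{..d}. Germ x0 (lincomb (a i) (y i) 0 (y i)))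
      = Germ x0 (\<Sum>i\<le>d. lincomb (a i) (y i) 0 (y i)) \<and> (\<Sum>i\<le>d. lincomb (a i) (y i) 0 (y i)) \<in> fin_vecs n"
  proof (rule abelian_group_image(2)[OF Dgerms_carrier Dgerms_zero[unfolded z] _ f(1,2)])
    show "Germ x0 u \<oplus>\<^bsub>Dgerms\<^esub> Germ x0 v = Germ x0 (u + v)" if "u \<in> fin_vecs n" "v \<in> fin_vecs n" for u v
      using Dgerms_add[OF that] by (simp add: l)
  qed (use f(3) in auto)
  ultimately show ?thesis by (simp add: Dgerms_smult y)
qed

end

section \<open>The Hecke algebra\<close>

text \<open>The characteristic polynomial of \<open>B\<close>, and by \<open>chi_eq\<close> the one that defines the Hecke algebra.\<close>

definition chi :: "complex poly" where
  "chi = (\<Prod>k<n. [:- exp (ev k * om), 1:])"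

lemma exp_om_n: "exp (of_nat k * om) = q ^ k"
  using exp_om[of "int k"] by simp

text \<open>The substitution \<open>k = n - j\<close> turns \<open>exp(2\<pi>i/n (k - c\<^sub>n\<^sub>-\<^sub>k))\<close> into \<open>q\<^sup>-\<^sup>j q\<^sub>j\<^sup>-\<^sup>1\<close>.\<close>

lemma chi_eq: "(\<Prod>j\<in>{1..n}. [:- (inverse (q ^ j) * inverse (rootc n c j)), 1:]) = chi"
  unfolding chi_def
proof (rule prod.reindex_bij_witness[where i = "\<lambda>k. n - k" and j = "\<lambda>j. n - j"])
  fix j assume j: "j \<in> {1..n}"
  then show "n - (n - j) = j" "n - j \<in> {..<n}" by auto
  have "q ^ (n - j) * q ^ j = 1" using j by (simp add: power_add[symmetric])
  then have "q ^ (n - j) = inverse (q ^ j)" by (metis inverse_unique mult.commute)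
  moreover have "exp (ev (n - j) * om) = exp (of_nat (n - j) * om) * exp (- (om * c j))"
    using j by (simp add: ev_def exp_add[symmetric] algebra_simps)
  moreover have "exp (- (om * c j)) = inverse (rootc n c j)"
    by (simp add: rootc_def om_def exp_minus)
  ultimately show "[:- exp (ev (n - j) * om), 1:] = [:- (inverse (q ^ j) * inverse (rootc n c j)), 1:]"
    by (simp add: exp_om_n)
qed auto

lemma Hecke_ideal_eq: "Hecke_ideal n c = {p. chi dvd p}"
  unfolding Hecke_ideal_def cgenideal_poly chi_eq ..

lemma Hecke_ideal_ideal: "ideal (Hecke_ideal n c) type_ring"
  unfolding Hecke_ideal_eq by (rule dvd_ideal)

lemma Hecke_cl_mem: "p' \<in> Hecke_cl n c p \<longleftrightarrow> chi dvd p' - p"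
  unfolding Hecke_cl_def poly_ring_type type_coset_mem[OF Hecke_ideal_ideal] by (simp add: Hecke_ideal_eq)

lemma Hecke_cl_eq_iff: "Hecke_cl n c p = Hecke_cl n c p' \<longleftrightarrow> chi dvd p - p'"
  unfolding Hecke_cl_def poly_ring_type type_coset_eq_iff[OF Hecke_ideal_ideal] by (simp add: Hecke_ideal_eq)

lemma Hecke_carrier: "carrier (Hecke n c) = range (Hecke_cl n c)"
  unfolding Hecke_def Hecke_cl_def[abs_def] poly_ring_type by (rule type_quot_carrier[OF Hecke_ideal_ideal])

lemma Hecke_ops:
  "Hecke_cl n c p \<oplus>\<^bsub>Hecke n c\<^esub> Hecke_cl n c p' = Hecke_cl n c (p + p')"
  "Hecke_cl n c p \<otimes>\<^bsub>Hecke n c\<^esub> Hecke_cl n c p' = Hecke_cl n c (p * p')"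
  "\<one>\<^bsub>Hecke n c\<^esub> = Hecke_cl n c 1"
  "\<zero>\<^bsub>Hecke n c\<^esub> = Hecke_cl n c 0"
  unfolding Hecke_def Hecke_cl_def poly_ring_type by (rule type_quot_ops[OF Hecke_ideal_ideal])+

lemma chi_degree: "degree chi = n" "chi \<noteq> 0"
proof -
  have "degree (\<Prod>k<m. [:- exp (ev k * om), 1:]) = m \<and> (\<Prod>k<m. [:- exp (ev k * om), 1:]) \<noteq> 0" for m
  proof (induction m)
    case (Suc m)
    let ?f = "[:- exp (ev m * om), 1:]"
    have "?f \<noteq> 0" "degree ?f = 1" by simp_all
    then show ?case unfolding prod.lessThan_Suc using Suc degree_mult_eq[of _ ?f] mult_eq_0_iff[of _ ?f]
      by (simp del: mult_pCons_right mult_pCons_left)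
  qed simp
  then show "degree chi = n" "chi \<noteq> 0" by (simp_all add: chi_def)
qed

abbreviation "Bop \<equiv> bexp n ev om"

lemma poly_op_chi_dvd:
  assumes "chi dvd p - p'" "y \<in> fin_vecs n"
  shows "poly_op Bop p y = poly_op Bop p' y"
proof -
  obtain r where r: "p - p' = r * chi" using assms(1) by (metis dvdE mult.commute)
  have "poly_op Bop chi y = (\<lambda>k. 0)" unfolding chi_def by (rule poly_op_char_poly[OF assms(2)])
  then have "poly_op Bop (p - p') y = (\<lambda>k. 0)"
    unfolding r poly_op_mult[OF lin_op_bexp] using lin_op_zero[OF lin_op_poly_op[OF lin_op_bexp]] by simp
  then show ?thesis by (simp add: poly_op_diff lincomb_def fun_eq_iff)
qed

lemma Bop_fin_vecs: "y \<in> fin_vecs n \<Longrightarrow> poly_op Bop p y \<in> fin_vecs n"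
  by (rule poly_op_fin_vecs[OF bexp_fin_vecs])

lemma KZ_carrier: "x0 \<noteq> 0 \<Longrightarrow> carrier (KZ n c x0 (Delta n c)) = Germ x0 ` fin_vecs n"
  by (simp add: KZ_def Let_def Dgerms_carrier)

lemma KZ_smult:
  assumes x0: "x0 \<noteq> 0" and y: "y \<in> fin_vecs n"
  shows "Hecke_cl n c p \<odot>\<^bsub>KZ n c x0 (Delta n c)\<^esub> Germ x0 y = Germ x0 (poly_op Bop p y)"
proof -
  let ?V = "germ_space n Dreg x0"
  have s: "(\<Oplus>\<^bsub>?V\<^esub>i\<in>{..degree p'}. coeff p' i \<odot>\<^bsub>?V\<^esub> (monodromy n Dreg x0 ^^ i) (Germ x0 y)) = Germ x0 (poly_op Bop p' y)" for p'
    using Dgerms_finsum[OF x0, where y = "\<lambda>i. (Bop ^^ i) y" and d = "degree p'" and a = "coeff p'"] monodromy_power_Germ[OF x0 y]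
    by (simp add: poly_op_def)
  have "Hecke_cl n c p \<odot>\<^bsub>KZ n c x0 (Delta n c)\<^esub> Germ x0 y
    = (THE g'. \<forall>p'\<in>Hecke_cl n c p. g' = Germ x0 (poly_op Bop p' y))"
    by (simp add: KZ_def Let_def s)
  also have "\<dots> = Germ x0 (poly_op Bop p y)"
  proof (rule the_equality)
    show "\<forall>p'\<in>Hecke_cl n c p. Germ x0 (poly_op Bop p y) = Germ x0 (poly_op Bop p' y)"
      using poly_op_chi_dvd[OF _ y] by (metis Hecke_cl_mem)
    fix g assume "\<forall>p'\<in>Hecke_cl n c p. g = Germ x0 (poly_op Bop p' y)"
    moreover have "p \<in> Hecke_cl n c p" by (simp add: Hecke_cl_mem)
    ultimately show "g = Germ x0 (poly_op Bop p y)" by blast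
  qed
  finally show ?thesis .
qed

end

section \<open>The endomorphism algebra of the standard module\<close>

lemma ring_hom_oppI:
  assumes "\<phi> \<in> ring_hom R (opp_ring S)"
    and "\<And>a b. \<lbrakk>a \<in> carrier R; b \<in> carrier R\<rbrakk> \<Longrightarrow> a \<otimes>\<^bsub>R\<^esub> b = b \<otimes>\<^bsub>R\<^esub> a"
  shows "\<phi> \<in> ring_hom R S"
proof -
  have "\<phi> (x \<otimes>\<^bsub>R\<^esub> y) = \<phi> x \<otimes>\<^bsub>S\<^esub> \<phi> y" if "x \<in> carrier R" "y \<in> carrier R" for x y
  proof -
    have "\<phi> (y \<otimes>\<^bsub>R\<^esub> x) = \<phi> x \<otimes>\<^bsub>S\<^esub> \<phi> y"
      using ring_hom_mult[OF assms(1) that(2,1)] by (simp add: opp_ring_def)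
    then show ?thesis using assms(2)[OF that] by simp
  qed
  then show ?thesis using assms(1) unfolding ring_hom_def opp_ring_def by simp
qed

text \<open>This is where \<open>c \<in> \<F>\<close> enters.  If the exponentials for \<open>k = n - i\<close> and \<open>l = n - j\<close> agree, then
  \<open>c\<^sub>i - c\<^sub>j\<close> and \<open>j - i\<close> differ by a multiple of \<open>n\<close>, hence are equal.\<close>

lemma exp_eq_imp_eq:
  assumes c: "c \<in> param_F n" and n: "2 \<le> n" and kl: "k < n" "l < n"
    and e: "exp ((of_nat k - c (n - k)) * (2 * of_real pi * \<i> / of_nat n))
      = exp ((of_nat l - c (n - l)) * (2 * of_real pi * \<i> / of_nat n))"
  shows "of_nat k - c (n - k) = of_nat l - c (n - l)"
proof -
  define d where "d = (of_nat k - c (n - k)) - (of_nat l - c (n - l))"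
  let ?w = "2 * of_real pi * \<i> / of_nat n :: complex"
  have "d * ?w = (of_nat k - c (n - k)) * ?w - (of_nat l - c (n - l)) * ?w"
    by (simp only: d_def left_diff_distrib)
  then have "exp (d * ?w) = 1" using e by (simp only: exp_diff) simp
  then obtain m :: int where m: "Re (d * ?w) = 0" "Im (d * ?w) = of_int (2 * m) * pi"
    unfolding exp_eq_1 by blast
  have "d * ?w = of_int m * (2 * of_real pi * \<i>)"
    by (rule complex_eqI) (use m in simp_all)
  then have dm: "d = of_nat n * of_int m" using n by (simp add: field_simps)
  define i where "i = n - k"
  define j where "j = n - l"
  have ij: "i \<in> {1..n}" "j \<in> {1..n}" "of_nat j - of_nat i = (of_nat k - of_nat l :: complex)"
    using kl by (auto simp: i_def j_def)
  have "(c i - c j) - (of_nat j - of_nat i) = of_nat n * of_int (- m)"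
    using dm unfolding ij(3) by (simp add: d_def i_def j_def algebra_simps)
  then have "cong_mod n (c i - c j) (of_nat j - of_nat i)" unfolding cong_mod_def by blast
  then have "c i - c j = of_nat j - of_nat i" using c ij(1,2) by (simp add: param_F_def)
  then show ?thesis unfolding ij(3) by (simp add: i_def j_def algebra_simps)
qed

theorem theoremD:
  fixes n :: nat
    and c :: "nat \<Rightarrow> complex"
    and x0 :: complex
    and \<phi> :: "complex poly set \<Rightarrow> delta_elt \<Rightarrow> delta_elt"
  assumes "n \<ge> 2"
    and "c \<in> param_F n"
    and "x0 \<noteq> 0"
    and "KZ_induces n c x0 \<phi>"
  shows "\<phi> \<in> ring_iso (Hecke n c) (End_ring (Cher n c) (Delta n c)) \<and>
         \<phi> (Tbar n c) = eta n c"
proof -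
  interpret cyclic_cher n c
    using assms(1,2) by unfold_locales (auto simp: param_F_def)
  let ?P = "Delta n c" and ?E = "End_ring (Cher n c) (Delta n c)" and ?K = "KZ n c x0 (Delta n c)"
  let ?H = "Hom_module n c \<phi> (Delta n c)"
  note x0 = assms(3)
  obtain \<Psi> :: "(falg set, delta_elt) module \<Rightarrow> (delta_elt \<times> nat) set germ \<Rightarrow> delta_elt \<Rightarrow> delta_elt"
    where hom: "\<phi> \<in> ring_hom (Hecke n c) (opp_ring ?E)"
      and Psi0: "\<forall>M\<in>cat_O n c. \<Psi> M \<in> mod_hom (Hecke n c) (KZ n c x0 M) (Hom_module n c \<phi> M) \<and>
           bij_betw (\<Psi> M) (carrier (KZ n c x0 M)) (carrier (Hom_module n c \<phi> M))"
      and nat0: "\<forall>M\<in>cat_O n c. \<forall>M'\<in>cat_O n c. \<forall>f\<in>mod_hom (Cher n c) M M'.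
           \<forall>g\<in>carrier (KZ n c x0 M). \<Psi> M' (KZ_map n c x0 M' f g) = compose (carrier ?P) f (\<Psi> M g)"
    using assms(4) unfolding KZ_induces_def by blast
  define \<psi> where "\<psi> y = \<Psi> ?P (Germ x0 y)" for y
  have Psi: "\<Psi> ?P \<in> mod_hom (Hecke n c) ?K ?H" "bij_betw (\<Psi> ?P) (carrier ?K) (carrier ?H)"
    using Psi0 Delta_cat_O by blast+
  have Hc: "carrier ?H = mod_hom (Cher n c) ?P ?P" by (simp add: Hom_module_def Let_def)
  have Ec: "carrier ?E = mod_hom (Cher n c) ?P ?P" by (simp add: End_ring_def)
  have psi_surj: "\<exists>y\<in>fin_vecs n. \<psi> y = f" if "f \<in> mod_hom (Cher n c) ?P ?P" for f
    using Psi(2) that unfolding bij_betw_def Hc KZ_carrier[OF x0] \<psi>_def by (metis imageE)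
  have psi_inj: "y = y'" if "y \<in> fin_vecs n" "y' \<in> fin_vecs n" "\<psi> y = \<psi> y'" for y y'
  proof -
    have "Germ x0 y = Germ x0 y'"
      using Psi(2) that unfolding bij_betw_def KZ_carrier[OF x0] \<psi>_def by (meson imageI inj_onD)
    then show ?thesis by (rule Germ_inj[OF x0 that(1)])
  qed
  \<comment> \<open>\<open>\<Psi>\<close> is linear over the Hecke algebra, which acts on homomorphisms by precomposition with \<open>\<phi>\<close>.\<close>
  have psi_smult: "\<psi> (poly_op Bop p y) = compose (carrier ?P) (\<psi> y) (\<phi> (Hecke_cl n c p))"
    if y: "y \<in> fin_vecs n" for p y
  proof -
    have "\<Psi> ?P (Hecke_cl n c p \<odot>\<^bsub>?K\<^esub> Germ x0 y) = Hecke_cl n c p \<odot>\<^bsub>?H\<^esub> \<Psi> ?P (Germ x0 y)"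
      using Psi(1) y unfolding mod_hom_def by (simp add: KZ_carrier[OF x0] Hecke_carrier)
    then show ?thesis unfolding KZ_smult[OF x0 y] by (simp add: \<psi>_def Hom_module_def Let_def)
  qed
  have phi_End: "\<phi> (Hecke_cl n c p) \<in> mod_hom (Cher n c) ?P ?P" for p
    using ring_hom_closed[OF hom, of "Hecke_cl n c p"] by (simp add: Hecke_carrier opp_ring_def Ec)
  define idP where "idP = (\<lambda>v\<in>carrier ?P. v)"
  have idP: "idP \<in> mod_hom (Cher n c) ?P ?P"
    unfolding mod_hom_def idP_def using P.M.smult_closed by (auto simp: P.M.add.m_closed)
  \<comment> \<open>The universal element of the representable functor: the germ that corresponds to the identity.\<close>
  obtain y0 where y0: "y0 \<in> fin_vecs n" "\<psi> y0 = idP" using psi_surj[OF idP] by blast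
  \<comment> \<open>Yoneda: \<open>\<phi>\<close> is recovered from the action on the universal element.\<close>
  have phi_psi: "\<phi> (Hecke_cl n c p) = \<psi> (poly_op Bop p y0)" for p
  proof -
    have "\<phi> (Hecke_cl n c p) \<in> carrier ?P \<rightarrow>\<^sub>E carrier ?P" using phi_End by (simp add: mod_hom_def)
    then have "compose (carrier ?P) idP (\<phi> (Hecke_cl n c p)) = \<phi> (Hecke_cl n c p)"
      by (auto simp: compose_def idP_def PiE_def extensional_def fun_eq_iff)
    then show ?thesis by (simp add: psi_smult[OF y0(1)] y0(2))
  qed
  \<comment> \<open>Both \<open>T\<close> and \<open>KZ(\<eta>)\<close> act by \<open>B\<close>; naturality of \<open>\<Psi>\<close> turns the latter into composition with \<open>\<eta>\<close>.\<close>
  have Tbar: "\<phi> (Tbar n c) = eta n c"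
  proof -
    have "\<phi> (Tbar n c) = \<psi> (poly_op Bop [:0, 1:] y0)" unfolding Tbar_def by (rule phi_psi)
    also have "poly_op Bop [:0, 1:] y0 = Bop y0" by (simp add: poly_op_pCons)
    also have "\<psi> (Bop y0) = compose (carrier ?P) etaop idP"
      using nat0[rule_format, OF Delta_cat_O Delta_cat_O etaop_End, of "Germ x0 y0"] y0
      by (simp add: KZ_carrier[OF x0] KZ_map_etaop[OF x0] \<psi>_def)
    also have "\<dots> = etaop"
      using etaop_End by (auto simp: mod_hom_def compose_def idP_def PiE_def extensional_def fun_eq_iff)
    finally show ?thesis by (simp add: eta_eq_etaop)
  qed
  have sep: "ev k = ev l" if "k < n" "l < n" "exp (ev k * om) = exp (ev l * om)" for k l
    using exp_eq_imp_eq[OF assms(2,1) that(1,2)] that(3) by (simp add: ev_def om_def)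
  have om0: "om \<noteq> 0" using n0 by (simp add: om_def)
  \<comment> \<open>If \<open>p(B)\<close> kills the universal element then \<open>\<phi>(p) = 0\<close>, and therefore \<open>p(B)\<close> kills everything.\<close>
  have ann: "chi dvd p" if "poly_op Bop p y0 = (\<lambda>k. 0)" for p
  proof -
    have z: "(\<lambda>k. 0) \<in> fin_vecs n" by (simp add: fin_vecs_def)
    have "\<phi> (Hecke_cl n c p) = \<phi> (Hecke_cl n c 0)" by (simp add: phi_psi that)
    then have "\<psi> (poly_op Bop p y) = \<psi> (poly_op Bop 0 y)" if "y \<in> fin_vecs n" for y
      using psi_smult[OF that] by metis
    then have "poly_op Bop p y = (\<lambda>k. 0)" if "y \<in> fin_vecs n" for y
      using psi_inj[OF Bop_fin_vecs[OF that] z] that by simp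
    then show ?thesis
      unfolding chi_def by (intro char_poly_dvd[OF sep om0 order_refl]) auto
  qed
  have "inj_on \<phi> (carrier (Hecke n c))"
  proof (rule inj_onI)
    fix h h' assume "h \<in> carrier (Hecke n c)" "h' \<in> carrier (Hecke n c)" and eq: "\<phi> h = \<phi> h'"
    then obtain p p' where p: "h = Hecke_cl n c p" "h' = Hecke_cl n c p'" by (auto simp: Hecke_carrier)
    have "poly_op Bop p y0 = poly_op Bop p' y0"
      using eq unfolding p phi_psi by (intro psi_inj Bop_fin_vecs y0)
    then have "poly_op Bop (p - p') y0 = (\<lambda>k. 0)" by (simp add: poly_op_diff lincomb_def)
    then show "h = h'" unfolding p Hecke_cl_eq_iff by (rule ann)
  qed
  moreover have "\<phi> ` carrier (Hecke n c) = carrier ?E"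
  proof
    show "\<phi> ` carrier (Hecke n c) \<subseteq> carrier ?E" using phi_End by (auto simp: Hecke_carrier Ec)
    show "carrier ?E \<subseteq> \<phi> ` carrier (Hecke n c)"
    proof
      fix f assume "f \<in> carrier ?E"
      then obtain y where y: "y \<in> fin_vecs n" "\<psi> y = f" using psi_surj by (auto simp: Ec)
      obtain p where "y = poly_op Bop p y0"
        using cyclic_vector_generates[OF lin_op_bexp bexp_fin_vecs y0(1) chi_degree(2,1) ann y(1)] by blast
      then have "f = \<phi> (Hecke_cl n c p)" using y by (simp add: phi_psi)
      then show "f \<in> \<phi> ` carrier (Hecke n c)" by (simp add: Hecke_carrier)
    qed
  qed
  moreover have "\<phi> \<in> ring_hom (Hecke n c) ?E"
    by (rule ring_hom_oppI[OF hom]) (auto simp: Hecke_carrier Hecke_ops mult.commute)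
  ultimately show ?thesis using Tbar by (simp add: ring_iso_def bij_betw_def)
qed

end
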